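(* Assume that for some $T>0$, $$u\in Z_T=C([-T,T]:H^1(\mathbb R))\cap L^\infty([-T,T]:W^{1,\infty}(\mathbb R))\cap C^1((-T,T):L^2(\mathbb R))$$ is a solution of the initial value problem for the reduced Camassa--Holm equation $$\partial_tu+3u\,\partial_xu-\partial_t\partial_x^2u=2\,\partial_xu\,\partial_x^2u+u\,\partial_x^3u,$$ with initial data $u_0(x)=u(x,0)$ in $H^1(\mathbb R)\cap W^{1,\infty}(\mathbb R)$. If $$|u_0(x)|=o(e^{-x})\quad\text{and}\quad|\partial_xu_0(x)|=O(e^{-\alpha x})\qquad\text{as }x\uparrow\infty,$$ for some $\alpha\in(1/2,1)$, and there exists $t_1\in(0,T]$ such that $$|u(x,t_1)|=o(e^{-x})\qquad\text{as }x\uparrow\infty,$$ then $u\equiv0$.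
   Context: $W^{1,\infty}(\mathbb R)=\{f\in L^\infty(\mathbb R): f'\in L^\infty(\mathbb R)\}$ (distributional derivative). For functions in $Z_T$ the reduced Camassa--Holm equation is understood in the form $\partial_tu+u\,\partial_xu=-\partial_x(1-\partial_x^2)^{-1}\bigl(u^2+\tfrac12(\partial_xu)^2\bigr)$, as an identity in $L^2(\mathbb R)$, where $(1-\partial_x^2)^{-1}$ is convolution with $\tfrac12e^{-|x|}$. Pointwise bounds on $\partial_xu_0$ are understood almost everywhere. *)

theory Defs
  imports "HOL-Probability.Probability" "HOL-Library.Landau_Symbols"
begin

text \<open>
  Elements of Lebesgue and Sobolev spaces are represented by Borel functions on the real line;
  operators whose value is only determined almost everywhere (weak and strong derivatives) pick
  some representative. A function of space and time is written \<open>u t x\<close>, time first.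
\<close>

definition L2 :: "(real \<Rightarrow> real) set" where
  "L2 = {f \<in> borel_measurable lborel. integrable lborel (\<lambda>x. (f x)\<^sup>2)}"

definition L2_norm :: "(real \<Rightarrow> real) \<Rightarrow> real" where
  "L2_norm f = sqrt (\<integral>x. (f x)\<^sup>2 \<partial>lborel)"

definition Linf_norm :: "(real \<Rightarrow> real) \<Rightarrow> ereal" where
  "Linf_norm f = esssup lborel (\<lambda>x. ereal \<bar>f x\<bar>)"

definition Linf :: "(real \<Rightarrow> real) set" where
  "Linf = {f \<in> borel_measurable lborel. Linf_norm f < \<infinity>}"

definition L1_loc :: "(real \<Rightarrow> real) set" where
  "L1_loc = {f \<in> borel_measurable lborel. \<forall>a b. set_integrable lborel {a..b} f}"

definition test_fun :: "(real \<Rightarrow> real) set" where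
  "test_fun = {\<phi>. (\<forall>n. (deriv ^^ n) \<phi> differentiable_on UNIV) \<and> compact (closure {x. \<phi> x \<noteq> 0})}"

definition has_weak_deriv :: "(real \<Rightarrow> real) \<Rightarrow> (real \<Rightarrow> real) \<Rightarrow> bool" where
  "has_weak_deriv f g \<longleftrightarrow> f \<in> L1_loc \<and> g \<in> L1_loc \<and>
     (\<forall>\<phi>\<in>test_fun. (\<integral>x. f x * deriv \<phi> x \<partial>lborel) = - (\<integral>x. g x * \<phi> x \<partial>lborel))"

definition weak_deriv :: "(real \<Rightarrow> real) \<Rightarrow> real \<Rightarrow> real" where
  "weak_deriv f = (SOME g. has_weak_deriv f g)"

definition H1 :: "(real \<Rightarrow> real) set" where
  "H1 = {f \<in> L2. \<exists>g\<in>L2. has_weak_deriv f g}"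

definition H1_norm :: "(real \<Rightarrow> real) \<Rightarrow> real" where
  "H1_norm f = sqrt ((L2_norm f)\<^sup>2 + (L2_norm (weak_deriv f))\<^sup>2)"

definition W1inf :: "(real \<Rightarrow> real) set" where
  "W1inf = {f \<in> Linf. \<exists>g\<in>Linf. has_weak_deriv f g}"

definition W1inf_norm :: "(real \<Rightarrow> real) \<Rightarrow> ereal" where
  "W1inf_norm f = Linf_norm f + Linf_norm (weak_deriv f)"

definition cont_H1 :: "real set \<Rightarrow> (real \<Rightarrow> real \<Rightarrow> real) set" where
  "cont_H1 I = {u. (\<forall>t\<in>I. u t \<in> H1) \<and>
     (\<forall>t\<in>I. ((\<lambda>s. H1_norm (\<lambda>x. u s x - u t x)) \<longlongrightarrow> 0) (at t within I))}"

definition cont_L2 :: "real set \<Rightarrow> (real \<Rightarrow> real \<Rightarrow> real) set" where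
  "cont_L2 I = {u. (\<forall>t\<in>I. u t \<in> L2) \<and>
     (\<forall>t\<in>I. ((\<lambda>s. L2_norm (\<lambda>x. u s x - u t x)) \<longlongrightarrow> 0) (at t within I))}"

text \<open>
  Only essential boundedness in time is required below: measurability of \<open>t \<mapsto> u t\<close> is
  automatic (in the weak-* sense) for functions that are also continuous into \<open>H1\<close>, the only
  case used, while strong measurability into the nonseparable space \<open>W1inf\<close> is not intended.
\<close>

definition ess_bdd_W1inf :: "real set \<Rightarrow> (real \<Rightarrow> real \<Rightarrow> real) set" where
  "ess_bdd_W1inf I = {u. \<exists>C::real. AE t in lborel. t \<in> I \<longrightarrow> u t \<in> W1inf \<and> W1inf_norm (u t) \<le> ereal C}"

definition has_time_deriv :: "(real \<Rightarrow> real \<Rightarrow> real) \<Rightarrow> (real \<Rightarrow> real) \<Rightarrow> real \<Rightarrow> bool" where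
  "has_time_deriv u v t \<longleftrightarrow> v \<in> L2 \<and>
     ((\<lambda>h. L2_norm (\<lambda>x. (u (t + h) x - u t x) / h - v x)) \<longlongrightarrow> 0) (at 0)"

definition time_deriv :: "(real \<Rightarrow> real \<Rightarrow> real) \<Rightarrow> real \<Rightarrow> real \<Rightarrow> real" where
  "time_deriv u t = (SOME v. has_time_deriv u v t)"

text \<open>The set \<open>I\<close> is meant to be open.\<close>

definition C1_L2 :: "real set \<Rightarrow> (real \<Rightarrow> real \<Rightarrow> real) set" where
  "C1_L2 I = {u. (\<forall>t\<in>I. u t \<in> L2) \<and> (\<forall>t\<in>I. \<exists>v. has_time_deriv u v t) \<and> time_deriv u \<in> cont_L2 I}"

text \<open>
  As usual, each \<open>u t\<close>, being an element of \<open>H1\<close>, is identified with its unique continuous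
  representative, so that pointwise statements about \<open>u t\<close> make sense; this is what the last
  conjunct expresses.
\<close>

definition Z_space :: "real \<Rightarrow> (real \<Rightarrow> real \<Rightarrow> real) set" where
  "Z_space T = {u. u \<in> cont_H1 {-T..T} \<and> u \<in> ess_bdd_W1inf {-T..T} \<and> u \<in> C1_L2 {-T<..<T} \<and>
     (\<forall>t\<in>{-T..T}. continuous_on UNIV (u t))}"

text \<open>The operator $(1 - \partial_x^2)^{-1}$.\<close>

definition inv_helmholtz :: "(real \<Rightarrow> real) \<Rightarrow> real \<Rightarrow> real" where
  "inv_helmholtz f x = (\<integral>y. 1/2 * exp (- \<bar>x - y\<bar>) * f y \<partial>lborel)"

definition CH_solution :: "real \<Rightarrow> (real \<Rightarrow> real \<Rightarrow> real) \<Rightarrow> bool" where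
  "CH_solution T u \<longleftrightarrow> (\<forall>t\<in>{-T<..<T}. AE x in lborel.
     time_deriv u t x + u t x * weak_deriv (u t) x =
       - weak_deriv (inv_helmholtz (\<lambda>y. (u t y)\<^sup>2 + 1/2 * (weak_deriv (u t) y)\<^sup>2)) x)"

text \<open>
  The filter of conditions that hold for almost every sufficiently large \<open>x\<close>; it expresses
  asymptotics for functions that are only defined almost everywhere.
\<close>

definition ae_at_top :: "real filter" where
  "ae_at_top = inf at_top (ae_filter lborel)"

end

theory Submission
  imports Defs
begin

text \<open>
  Write \<open>v = \<partial>\<^sub>x u\<close>, \<open>F = u\<^sup>2 + v\<^sup>2/2\<close> and \<open>P = (1 - \<partial>\<^sub>x\<^sup>2)\<^sup>-\<^sup>1 F\<close>, the convolution of \<open>F\<close> with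
  \<open>1/2 e\<^bsup>-\<bar>x\<bar>\<^esup>\<close>. The equation is a conservation law \<open>\<partial>\<^sub>t u = - \<partial>\<^sub>x (u\<^sup>2/2 + P)\<close> whose flux is nonnegative
  and cannot decay fast: from \<open>\<bar>x - y\<bar> \<le> \<bar>x\<bar> + \<bar>y\<bar>\<close> one gets \<open>P(t, x) \<ge> e\<^bsup>-\<bar>x\<bar>\<^esup> P(t, 0)\<close>.

  Vanishing at time \<open>0\<close>. Formally, integrating the conservation law over \<open>[x, \<infinity>)\<close> and over
  \<open>[0, t1]\<close> gives
  \<open>\<integral>\<^sub>x\<^sup>\<infinity> (u(t1, y) - u(0, y)) dy = \<integral>\<^sub>0\<^sup>t\<^sup>1 (u\<^sup>2/2 + P)(t, x) dt \<ge> e\<^sup>-\<^sup>x \<integral>\<^sub>0\<^sup>t\<^sup>1 P(t, 0) dt\<close>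
  for \<open>x \<ge> 0\<close>. By the decay at the two times the left-hand side is \<open>o(e\<^sup>-\<^sup>x)\<close>, so the last integral
  is \<open>0\<close>. As \<open>P(t, 0)\<close> is continuous in \<open>t\<close> and nonnegative, \<open>P(0, 0) = 0\<close>, so \<open>F(0, \<cdot>) = 0\<close> and
  \<open>u(0, \<cdot>) = 0\<close>. Rigorously, \<open>u\<close> is tested with a smooth plateau that rises just to the right of
  \<open>x\<close> and then descends slowly; the descent costs an arbitrarily small error, because the flux
  has finite integral (\<open>flux_plateau_ge\<close>, \<open>u_plateau_le\<close>, \<open>pressure_0_eq_0\<close>).

  Vanishing at all times. It remains to show that the zero solution is unique among solutions
  that are Lipschitz in space, with bound \<open>M\<close>. The function \<open>\<parallel>u\<parallel>\<^sup>2 + \<parallel>v\<parallel>\<^sup>2\<close> need not be visibly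
  differentiable in time, but \<open>\<parallel>u\<parallel>\<^sup>2 + \<parallel>D\<^sub>k u\<parallel>\<^sup>2\<close> with the difference quotient \<open>D\<^sub>k\<close> is. In its
  derivative the transport term \<open>\<integral> D\<^sub>k u D\<^sub>k(u v)\<close> becomes \<open>1/2 \<integral> (D\<^sub>k u)\<^sup>2 m'\<close>, where \<open>m\<close> is the mean of
  \<open>u\<close> and its translate, and is at most \<open>M/2 \<parallel>v\<parallel>\<^sup>2\<close> (\<open>increment_transport\<close>); the nonlocal term is at
  most a constant times \<open>M \<parallel>F\<parallel>\<^sub>1\<close> (\<open>increment_pressure\<close>). These bounds are uniform in \<open>k\<close>, so
  Gronwall's lemma applies in the limit \<open>k \<rightarrow> 0\<close> (\<open>Gronwall_approx\<close>, \<open>zero_if_zero_initially\<close>).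

  All this requires little regularity theory: a continuous function with a weak derivative in
  \<open>L\<^sup>2\<close> satisfies the fundamental theorem of calculus (\<open>has_weak_deriv_continuous_FTC\<close>), so its
  difference quotients converge in \<open>L\<^sup>2\<close> (\<open>tendsto_L2_diff_quotient\<close>), and integrations by parts are
  limits of discrete ones.
\<close>

section \<open>The space of square integrable functions\<close>

lemma L2I: "f \<in> borel_measurable borel \<Longrightarrow> integrable lborel (\<lambda>x. (f x)\<^sup>2) \<Longrightarrow> f \<in> L2"
  by (simp add: L2_def)

lemma L2_measurable [measurable_dest]: "f \<in> L2 \<Longrightarrow> f \<in> borel_measurable borel"
  by (simp add: L2_def)

lemma L2_integrable_square: "f \<in> L2 \<Longrightarrow> integrable lborel (\<lambda>x. (f x)\<^sup>2)"
  by (simp add: L2_def)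

lemma L2_integrable_mult:
  assumes "f \<in> L2" "g \<in> L2"
  shows "integrable lborel (\<lambda>x. f x * g x)"
proof (rule Bochner_Integration.integrable_bound)
  show "integrable lborel (\<lambda>x. (f x)\<^sup>2 + (g x)\<^sup>2)"
    using assms by (intro Bochner_Integration.integrable_add L2_integrable_square)
  show "(\<lambda>x. f x * g x) \<in> borel_measurable lborel"
    using assms by (auto dest!: L2_measurable)
  have "\<bar>a * b\<bar> \<le> \<bar>a\<^sup>2 + b\<^sup>2\<bar>" for a b :: real
  proof -
    have "2 * (\<bar>a\<bar> * \<bar>b\<bar>) \<le> a\<^sup>2 + b\<^sup>2"
      using sum_squares_bound[of "\<bar>a\<bar>" "\<bar>b\<bar>"] by simp
    moreover have "0 \<le> \<bar>a\<bar> * \<bar>b\<bar>"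
      by simp
    ultimately show ?thesis
      unfolding abs_mult by linarith
  qed
  then show "AE x in lborel. norm (f x * g x) \<le> norm ((f x)\<^sup>2 + (g x)\<^sup>2)"
    by auto
qed

lemma integrable_bounded_mult:
  fixes w f :: "real \<Rightarrow> real"
  assumes f: "integrable lborel f" and w: "w \<in> borel_measurable borel" "\<And>x. \<bar>w x\<bar> \<le> B"
  shows "integrable lborel (\<lambda>x. w x * f x)"
proof (rule Bochner_Integration.integrable_bound)
  show "integrable lborel (\<lambda>x. B * f x)"
    using f by simp
  show "(\<lambda>x. w x * f x) \<in> borel_measurable lborel"
    using f w(1) by simp
  have "\<bar>w x\<bar> \<le> \<bar>B\<bar>" for x
    using w(2)[of x] by linarith
  then show "AE x in lborel. norm (w x * f x) \<le> norm (B * f x)"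
    unfolding real_norm_def abs_mult by (intro AE_I2 mult_right_mono) auto
qed

lemma L2_integrable_weighted_mult:
  fixes w :: "real \<Rightarrow> real"
  assumes "f \<in> L2" "g \<in> L2" "w \<in> borel_measurable borel" "\<And>x. \<bar>w x\<bar> \<le> B"
  shows "integrable lborel (\<lambda>x. w x * (f x * g x))"
  using assms by (intro integrable_bounded_mult[OF L2_integrable_mult])

lemma L2_add:
  assumes "f \<in> L2" "g \<in> L2"
  shows "(\<lambda>x. f x + g x) \<in> L2"
proof (rule L2I)
  show "(\<lambda>x. f x + g x) \<in> borel_measurable borel"
    using assms by (auto dest!: L2_measurable)
  have "integrable lborel (\<lambda>x. (f x)\<^sup>2 + (g x)\<^sup>2 + 2 * (f x * g x))"
    using assms by (intro Bochner_Integration.integrable_add L2_integrable_square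
      integrable_mult_right L2_integrable_mult)
  then show "integrable lborel (\<lambda>x. (f x + g x)\<^sup>2)"
    by (simp add: power2_sum mult.assoc)
qed

lemma L2_cmult: "f \<in> L2 \<Longrightarrow> (\<lambda>x. c * f x) \<in> L2"
  by (intro L2I) (auto dest: L2_measurable L2_integrable_square simp: power_mult_distrib)

lemma L2_cdiv: "f \<in> L2 \<Longrightarrow> (\<lambda>x. f x / c) \<in> L2"
  using L2_cmult[of f "1 / c"] by simp

lemma L2_uminus: "f \<in> L2 \<Longrightarrow> (\<lambda>x. - f x) \<in> L2"
  using L2_cmult[of f "-1"] by simp

lemma L2_diff: "f \<in> L2 \<Longrightarrow> g \<in> L2 \<Longrightarrow> (\<lambda>x. f x - g x) \<in> L2"
  using L2_add[of f "\<lambda>x. - g x"] L2_uminus[of g] by simp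

lemma L2_shift: 
  assumes "f \<in> L2"
  shows "(\<lambda>x. f (x + r)) \<in> L2"
proof (rule L2I)
  show "(\<lambda>x. f (x + r)) \<in> borel_measurable borel"
    using assms by (auto dest!: L2_measurable)
  show "integrable lborel (\<lambda>x. (f (x + r))\<^sup>2)"
    using lborel_integrable_real_affine[OF L2_integrable_square[OF assms], of 1 r]
    by (simp add: add.commute)
qed

lemma L2_bounded_mult:
  fixes w :: "real \<Rightarrow> real"
  assumes "f \<in> L2" "w \<in> borel_measurable borel" "\<And>x. \<bar>w x\<bar> \<le> B"
  shows "(\<lambda>x. w x * f x) \<in> L2"
proof (rule L2I)
  have [measurable]: "f \<in> borel_measurable borel"
    using assms by (auto dest!: L2_measurable)
  note [measurable] = assms(2)
  show "(\<lambda>x. w x * f x) \<in> borel_measurable borel"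
    by simp
  have "\<bar>(w x)\<^sup>2\<bar> \<le> B\<^sup>2" for x
    using power_mono[OF assms(3)[of x], of 2] by simp
  from L2_integrable_weighted_mult[OF assms(1,1) _ this]
  have "integrable lborel (\<lambda>x. (w x)\<^sup>2 * (f x * f x))"
    by measurable
  then show "integrable lborel (\<lambda>x. (w x * f x)\<^sup>2)"
    by (simp add: power2_eq_square ac_simps)
qed

lemma integral_shift:
  fixes f :: "real \<Rightarrow> real"
  shows "(\<integral>x. f (x + r) \<partial>lborel) = (\<integral>x. f x \<partial>lborel)"
  using lborel_integral_real_affine[of 1 f r] by (simp add: add.commute)

lemma integrable_shift:
  fixes f :: "real \<Rightarrow> real"
  shows "integrable lborel f \<Longrightarrow> integrable lborel (\<lambda>x. f (x + r))"
  using lborel_integrable_real_affine[of f 1 r] by (simp add: add.commute)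

lemma L2_norm_nonneg [simp]: "0 \<le> L2_norm f"
  by (simp add: L2_norm_def)

lemma L2_norm_square: "(L2_norm f)\<^sup>2 = (\<integral>x. (f x)\<^sup>2 \<partial>lborel)"
  by (simp add: L2_norm_def)

lemma L2_norm_cong_AE:
  assumes "AE x in lborel. f x = g x" "f \<in> borel_measurable borel" "g \<in> borel_measurable borel"
  shows "L2_norm f = L2_norm g"
proof -
  have "(\<integral>x. (f x)\<^sup>2 \<partial>lborel) = (\<integral>x. (g x)\<^sup>2 \<partial>lborel)"
    using assms by (intro integral_cong_AE) auto
  then show ?thesis
    by (simp add: L2_norm_def)
qed

lemma L2_norm_abs: "L2_norm (\<lambda>x. \<bar>f x\<bar>) = L2_norm f"
  by (simp add: L2_norm_def)

lemma L2_norm_shift: "L2_norm (\<lambda>x. f (x + r)) = L2_norm f"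
  using integral_shift[of "\<lambda>x. (f x)\<^sup>2" r] by (simp add: L2_norm_def)

lemma L2_norm_cmult: "L2_norm (\<lambda>x. c * f x) = \<bar>c\<bar> * L2_norm f"
  by (simp add: L2_norm_def power_mult_distrib real_sqrt_mult)

lemma L2_norm_minus_commute: "L2_norm (\<lambda>x. f x - g x) = L2_norm (\<lambda>x. g x - f x)"
  by (simp add: L2_norm_def power2_commute)

text \<open>
  Expand \<open>0 \<le> \<integral> (s f - r g)\<^sup>2\<close> with \<open>s\<close> and \<open>r\<close> slightly larger than the norms of \<open>g\<close> and \<open>f\<close>; the
  slack keeps the factor \<open>s r\<close> positive when a norm vanishes.
\<close>

lemma L2_Cauchy_Schwarz:
  assumes f: "f \<in> L2" and g: "g \<in> L2"
  shows "(\<integral>x. f x * g x \<partial>lborel) \<le> L2_norm f * L2_norm g"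
proof -
  have fg: "integrable lborel (\<lambda>x. f x * g x)" and ff: "integrable lborel (\<lambda>x. (f x)\<^sup>2)"
    and gg: "integrable lborel (\<lambda>x. (g x)\<^sup>2)"
    using f g by (auto intro: L2_integrable_mult L2_integrable_square)
  define a where "a = L2_norm f"
  define b where "b = L2_norm g"
  define c where "c = (\<integral>x. f x * g x \<partial>lborel)"
  have pos: "0 \<le> s\<^sup>2 * a\<^sup>2 + r\<^sup>2 * b\<^sup>2 - 2 * (s * r) * c" for s r
  proof -
    have "0 \<le> (\<integral>x. (s * f x - r * g x)\<^sup>2 \<partial>lborel)"
      by simp
    also have "\<dots> = (\<integral>x. s\<^sup>2 * (f x)\<^sup>2 + r\<^sup>2 * (g x)\<^sup>2 - 2 * (s * r) * (f x * g x) \<partial>lborel)"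
      by (intro Bochner_Integration.integral_cong) (auto simp: power2_eq_square algebra_simps)
    also have "\<dots> = s\<^sup>2 * a\<^sup>2 + r\<^sup>2 * b\<^sup>2 - 2 * (s * r) * c"
      using fg ff gg by (simp add: a_def b_def c_def L2_norm_square)
    finally show ?thesis .
  qed
  have "c \<le> (a + d) * (b + d)" if "d > 0" for d
  proof -
    have ab: "0 \<le> a" "0 \<le> b"
      by (simp_all add: a_def b_def)
    have "2 * ((b + d) * (a + d)) * c \<le> (b + d)\<^sup>2 * a\<^sup>2 + (a + d)\<^sup>2 * b\<^sup>2"
      using pos[of "b + d" "a + d"] by simp
    also have "\<dots> \<le> (b + d)\<^sup>2 * (a + d)\<^sup>2 + (a + d)\<^sup>2 * (b + d)\<^sup>2"
      using ab that by (intro add_mono mult_left_mono power_mono) auto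
    also have "\<dots> = 2 * ((b + d) * (a + d)) * ((a + d) * (b + d))"
      by (simp add: power2_eq_square)
    finally show ?thesis
      using ab that by (subst (asm) mult_le_cancel_left_pos) auto
  qed
  moreover have "((\<lambda>d. (a + d) * (b + d)) \<longlongrightarrow> (a + 0) * (b + 0)) (at_right 0)"
    by (intro tendsto_intros)
  ultimately have "c \<le> (a + 0) * (b + 0)"
    by (intro tendsto_lowerbound[where F = "at_right 0"]) (auto simp: eventually_at_filter)
  then show ?thesis
    by (simp add: a_def b_def c_def)
qed

lemma L2_Cauchy_Schwarz_abs:
  assumes "f \<in> L2" "g \<in> L2"
  shows "(\<integral>x. \<bar>f x * g x\<bar> \<partial>lborel) \<le> L2_norm f * L2_norm g"
proof -
  have "(\<lambda>x. \<bar>f x\<bar>) \<in> L2" "(\<lambda>x. \<bar>g x\<bar>) \<in> L2"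
    using assms by (auto simp: L2_def)
  from L2_Cauchy_Schwarz[OF this] show ?thesis
    by (simp add: L2_norm_abs abs_mult)
qed

lemma L2_norm_triangle:
  assumes f: "f \<in> L2" and g: "g \<in> L2"
  shows "L2_norm (\<lambda>x. f x + g x) \<le> L2_norm f + L2_norm g"
proof (rule power2_le_imp_le)
  have fg: "integrable lborel (\<lambda>x. f x * g x)" and ff: "integrable lborel (\<lambda>x. (f x)\<^sup>2)"
    and gg: "integrable lborel (\<lambda>x. (g x)\<^sup>2)"
    using f g by (auto intro: L2_integrable_mult L2_integrable_square)
  have "(L2_norm (\<lambda>x. f x + g x))\<^sup>2 = (\<integral>x. (f x)\<^sup>2 + (g x)\<^sup>2 + 2 * (f x * g x) \<partial>lborel)"
    by (simp add: L2_norm_square power2_sum mult.assoc)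
  also have "\<dots> = (L2_norm f)\<^sup>2 + (L2_norm g)\<^sup>2 + 2 * (\<integral>x. f x * g x \<partial>lborel)"
    using fg ff gg by (simp add: L2_norm_square)
  also have "\<dots> \<le> (L2_norm f + L2_norm g)\<^sup>2"
    using L2_Cauchy_Schwarz[OF f g] by (simp add: power2_sum)
  finally show "(L2_norm (\<lambda>x. f x + g x))\<^sup>2 \<le> (L2_norm f + L2_norm g)\<^sup>2" .
qed simp

lemma L2_norm_diff_le:
  assumes "f \<in> L2" "g \<in> L2"
  shows "\<bar>L2_norm f - L2_norm g\<bar> \<le> L2_norm (\<lambda>x. f x - g x)"
  using L2_norm_triangle[OF L2_diff[OF assms] assms(2)]
    L2_norm_triangle[OF L2_diff[OF assms(2,1)] assms(1)]
  by (simp add: L2_norm_minus_commute[of f g] abs_le_iff)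

lemma L2_norm_eq_0D:
  assumes "f \<in> L2" "L2_norm f = 0"
  shows "AE x in lborel. f x = 0"
proof -
  have "(\<integral>x. (f x)\<^sup>2 \<partial>lborel) = 0"
    using assms(2) L2_norm_square[of f] by simp
  then have "AE x in lborel. (f x)\<^sup>2 = 0"
    using integral_nonneg_eq_0_iff_AE[OF L2_integrable_square[OF assms(1)]] by auto
  then show ?thesis
    by simp
qed

subsection \<open>Strong convergence\<close>

definition tendsto_L2 :: "('i \<Rightarrow> real \<Rightarrow> real) \<Rightarrow> (real \<Rightarrow> real) \<Rightarrow> 'i filter \<Rightarrow> bool" where
  "tendsto_L2 a b F \<longleftrightarrow> (\<forall>\<^sub>F i in F. a i \<in> L2) \<and> b \<in> L2 \<and> ((\<lambda>i. L2_norm (\<lambda>x. a i x - b x)) \<longlongrightarrow> 0) F"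

lemma tendsto_L2_const: "b \<in> L2 \<Longrightarrow> tendsto_L2 (\<lambda>_. b) b F"
  by (simp add: tendsto_L2_def L2_norm_def)

lemma tendsto_L2_le:
  assumes "\<forall>\<^sub>F i in F. a i \<in> L2" "b \<in> L2" "\<forall>\<^sub>F i in F. L2_norm (\<lambda>x. a i x - b x) \<le> r i" "(r \<longlongrightarrow> 0) F"
  shows "tendsto_L2 a b F"
  unfolding tendsto_L2_def using assms
  by (auto intro: tendsto_sandwich[OF _ assms(3) tendsto_const assms(4)])

lemma tendsto_L2_add:
  assumes "tendsto_L2 a b F" "tendsto_L2 c d F"
  shows "tendsto_L2 (\<lambda>i x. a i x + c i x) (\<lambda>x. b x + d x) F"
proof (rule tendsto_L2_le)
  note ev = assms[unfolded tendsto_L2_def]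
  show "\<forall>\<^sub>F i in F. (\<lambda>x. a i x + c i x) \<in> L2"
    using ev[THEN conjunct1] by eventually_elim (rule L2_add)
  show "(\<lambda>x. b x + d x) \<in> L2"
    using ev by (auto intro: L2_add)
  show "((\<lambda>i. L2_norm (\<lambda>x. a i x - b x) + L2_norm (\<lambda>x. c i x - d x)) \<longlongrightarrow> 0) F"
    using ev by (auto intro!: tendsto_add_zero)
  have bd: "b \<in> L2" "d \<in> L2"
    using ev by auto
  show "\<forall>\<^sub>F i in F. L2_norm (\<lambda>x. a i x + c i x - (b x + d x))
      \<le> L2_norm (\<lambda>x. a i x - b x) + L2_norm (\<lambda>x. c i x - d x)"
    using ev[THEN conjunct1]
  proof eventually_elim
    case (elim i)
    show ?case
      using L2_norm_triangle[OF L2_diff[OF elim(1) bd(1)] L2_diff[OF elim(2) bd(2)]]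
      by (simp add: algebra_simps)
  qed
qed

lemma tendsto_L2_cmult:
  assumes "tendsto_L2 a b F"
  shows "tendsto_L2 (\<lambda>i x. c * a i x) (\<lambda>x. c * b x) F"
proof -
  have "L2_norm (\<lambda>x. c * a i x - c * b x) = \<bar>c\<bar> * L2_norm (\<lambda>x. a i x - b x)" for i
    by (simp flip: right_diff_distrib add: L2_norm_cmult)
  then show ?thesis
    using assms unfolding tendsto_L2_def
    by (auto intro!: tendsto_mult_right_zero L2_cmult elim!: eventually_mono)
qed

lemma tendsto_L2_shift:
  assumes "tendsto_L2 a b F"
  shows "tendsto_L2 (\<lambda>i x. a i (x + r)) (\<lambda>x. b (x + r)) F"
  using assms L2_norm_shift[of "\<lambda>x. a _ x - b x" r] unfolding tendsto_L2_def
  by (auto intro!: L2_shift elim!: eventually_mono)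

lemma tendsto_L2_diff:
  assumes "tendsto_L2 a b F" "tendsto_L2 c d F"
  shows "tendsto_L2 (\<lambda>i x. a i x - c i x) (\<lambda>x. b x - d x) F"
  using tendsto_L2_add[OF assms(1) tendsto_L2_cmult[OF assms(2), of "-1"]] by simp

lemma tendsto_L2_norm: "tendsto_L2 a b F \<Longrightarrow> ((\<lambda>i. L2_norm (a i)) \<longlongrightarrow> L2_norm b) F"
  unfolding tendsto_L2_def
  by (rule LIM_zero_cancel, rule Lim_null_comparison[where g = "\<lambda>i. L2_norm (\<lambda>x. a i x - b x)"])
     (auto elim!: eventually_mono simp: L2_norm_diff_le)

text \<open>
  Every passage to the limit in a bilinear expression, whether the small parameter is a spatial
  shift or a time increment, is an instance of this lemma.
\<close>

lemma tendsto_L2_integral: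
  assumes a: "tendsto_L2 a a' F" and b: "tendsto_L2 b b' F"
    and w: "w \<in> borel_measurable borel" "\<And>x. \<bar>w x\<bar> \<le> B"
  shows "((\<lambda>i. \<integral>x. w x * (a i x * b i x) \<partial>lborel) \<longlongrightarrow> (\<integral>x. w x * (a' x * b' x) \<partial>lborel)) F"
proof (rule LIM_zero_cancel, rule Lim_null_comparison)
  let ?d = "\<lambda>i. L2_norm (\<lambda>x. a i x - a' x)" and ?e = "\<lambda>i. L2_norm (\<lambda>x. b i x - b' x)"
  have a': "a' \<in> L2" and b': "b' \<in> L2"
    using a b by (auto simp: tendsto_L2_def)
  have "((\<lambda>i. B * (?d i * L2_norm (b i) + L2_norm a' * ?e i)) \<longlongrightarrow> B * (0 * L2_norm b' + L2_norm a' * 0)) F"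
    using a b by (intro tendsto_intros tendsto_L2_norm) (auto simp: tendsto_L2_def)
  then show "((\<lambda>i. B * (?d i * L2_norm (b i) + L2_norm a' * ?e i)) \<longlongrightarrow> 0) F"
    by simp
  have "\<forall>\<^sub>F i in F. a i \<in> L2 \<and> b i \<in> L2"
    using a b by (auto simp: tendsto_L2_def eventually_conj_iff)
  then show "\<forall>\<^sub>F i in F. norm ((\<integral>x. w x * (a i x * b i x) \<partial>lborel) - (\<integral>x. w x * (a' x * b' x) \<partial>lborel))
      \<le> B * (?d i * L2_norm (b i) + L2_norm a' * ?e i)"
  proof eventually_elim
    case (elim i)
    then have ab: "a i \<in> L2" "b i \<in> L2" by auto
    have B: "0 \<le> B"
      using w(2)[of 0] by linarith
    let ?f = "\<lambda>x. (a i x - a' x) * b i x" and ?g = "\<lambda>x. a' x * (b i x - b' x)"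
    have int: "integrable lborel ?f" "integrable lborel ?g"
      "integrable lborel (\<lambda>x. w x * ?f x)" "integrable lborel (\<lambda>x. w x * ?g x)"
      using ab a' b' by (intro L2_integrable_mult L2_integrable_weighted_mult[OF _ _ w] L2_diff; simp)+
    have "(\<integral>x. w x * (a i x * b i x) \<partial>lborel) - (\<integral>x. w x * (a' x * b' x) \<partial>lborel)
        = (\<integral>x. w x * (a i x * b i x) - w x * (a' x * b' x) \<partial>lborel)"
      using ab a' b'
      by (intro Bochner_Integration.integral_diff[symmetric] L2_integrable_weighted_mult[OF _ _ w])
    also have "\<dots> = (\<integral>x. w x * ?f x + w x * ?g x \<partial>lborel)"
      by (intro Bochner_Integration.integral_cong) (auto simp: algebra_simps)
    finally have "norm ((\<integral>x. w x * (a i x * b i x) \<partial>lborel) - (\<integral>x. w x * (a' x * b' x) \<partial>lborel))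
        \<le> (\<integral>x. norm (w x * ?f x + w x * ?g x) \<partial>lborel)"
      by (simp only: integral_norm_bound)
    also have "\<dots> \<le> (\<integral>x. B * (\<bar>?f x\<bar> + \<bar>?g x\<bar>) \<partial>lborel)"
    proof (rule integral_mono)
      fix x
      have "norm (w x * ?f x + w x * ?g x) \<le> \<bar>w x\<bar> * (\<bar>?f x\<bar> + \<bar>?g x\<bar>)"
        unfolding distrib_left[symmetric] real_norm_def abs_mult[of "w x"]
        by (intro mult_left_mono abs_triangle_ineq) auto
      also have "\<dots> \<le> B * (\<bar>?f x\<bar> + \<bar>?g x\<bar>)"
        using w(2)[of x] by (intro mult_right_mono) auto
      finally show "norm (w x * ?f x + w x * ?g x) \<le> B * (\<bar>?f x\<bar> + \<bar>?g x\<bar>)" .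
    qed (use int in auto)
    also have "\<dots> = B * ((\<integral>x. \<bar>?f x\<bar> \<partial>lborel) + (\<integral>x. \<bar>?g x\<bar> \<partial>lborel))"
      using int by simp
    also have "\<dots> \<le> B * (?d i * L2_norm (b i) + L2_norm a' * ?e i)"
      using ab a' b' B by (intro mult_left_mono add_mono L2_Cauchy_Schwarz_abs L2_diff)
    finally show ?case .
  qed
qed

section \<open>Continuity of translations\<close>

text \<open>
  Continuity in \<open>L\<^sup>1\<close> is phrased with sequences because the dominated convergence theorem is
  about sequences.
\<close>

definition translation_continuous :: "(real \<Rightarrow> real) \<Rightarrow> bool" where
  "translation_continuous f \<longleftrightarrow>
     (\<forall>\<sigma>::nat \<Rightarrow> real. \<sigma> \<longlonglongrightarrow> 0 \<longrightarrow> (\<lambda>n. \<integral>x. \<bar>f (x + \<sigma> n) - f x\<bar> \<partial>lborel) \<longlonglongrightarrow> 0)"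

text \<open>
  Translations are isometries of \<open>L\<^sup>1\<close>, so an approximation of \<open>f\<close> by \<open>g\<close>
  approximates all translates of \<open>f\<close> equally well.
\<close>

lemma translation_continuous_approx:
  assumes f: "integrable lborel f"
    and approx: "\<And>e. 0 < e \<Longrightarrow> \<exists>g. integrable lborel g \<and> translation_continuous g \<and>
      (\<integral>x. \<bar>f x - g x\<bar> \<partial>lborel) \<le> e"
  shows "translation_continuous f"
  unfolding translation_continuous_def
proof (intro allI impI)
  fix \<sigma> :: "nat \<Rightarrow> real" assume \<sigma>: "\<sigma> \<longlonglongrightarrow> 0"
  show "(\<lambda>n. \<integral>x. \<bar>f (x + \<sigma> n) - f x\<bar> \<partial>lborel) \<longlonglongrightarrow> 0"
  proof (rule LIMSEQ_I)
    fix r :: real assume "0 < r"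
    then obtain g where g: "integrable lborel g" "translation_continuous g"
      and fg: "(\<integral>x. \<bar>f x - g x\<bar> \<partial>lborel) \<le> r / 4"
      using approx[of "r / 4"] by auto
    have "(\<lambda>n. \<integral>x. \<bar>g (x + \<sigma> n) - g x\<bar> \<partial>lborel) \<longlonglongrightarrow> 0"
      using g(2) \<sigma> by (auto simp: translation_continuous_def)
    from LIMSEQ_D[OF this, of "r / 2"] \<open>0 < r\<close>
    obtain N where N: "\<And>n. n \<ge> N \<Longrightarrow> norm ((\<integral>x. \<bar>g (x + \<sigma> n) - g x\<bar> \<partial>lborel) - 0) < r / 2"
      by auto
    have "norm ((\<integral>x. \<bar>f (x + \<sigma> n) - f x\<bar> \<partial>lborel) - 0) < r" if n: "n \<ge> N" for n
    proof -
      have int: "integrable lborel (\<lambda>x. \<bar>f (x + \<sigma> n) - g (x + \<sigma> n)\<bar>)"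
          "integrable lborel (\<lambda>x. \<bar>g (x + \<sigma> n) - g x\<bar>)" "integrable lborel (\<lambda>x. \<bar>f x - g x\<bar>)"
          "integrable lborel (\<lambda>x. \<bar>f (x + \<sigma> n) - f x\<bar>)"
        using f g(1) integrable_shift[OF f, of "\<sigma> n"] integrable_shift[OF g(1), of "\<sigma> n"] by auto
      have "(\<integral>x. \<bar>f (x + \<sigma> n) - f x\<bar> \<partial>lborel)
          \<le> (\<integral>x. \<bar>f (x + \<sigma> n) - g (x + \<sigma> n)\<bar> + \<bar>g (x + \<sigma> n) - g x\<bar> + \<bar>f x - g x\<bar> \<partial>lborel)"
        using int by (intro integral_mono) auto
      also have "\<dots> = (\<integral>x. \<bar>f x - g x\<bar> \<partial>lborel) + (\<integral>x. \<bar>g (x + \<sigma> n) - g x\<bar> \<partial>lborel)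
          + (\<integral>x. \<bar>f x - g x\<bar> \<partial>lborel)"
        using int integral_shift[of "\<lambda>x. \<bar>f x - g x\<bar>" "\<sigma> n"] by simp
      also have "\<dots> < r"
        using fg N[OF n] by simp
      finally show ?thesis
        by simp
    qed
    then show "\<exists>N. \<forall>n\<ge>N. norm ((\<integral>x. \<bar>f (x + \<sigma> n) - f x\<bar> \<partial>lborel) - 0) < r"
      by blast
  qed
qed

lemma translation_continuous_add:
  assumes "integrable lborel f" "integrable lborel g" "translation_continuous f" "translation_continuous g"
  shows "translation_continuous (\<lambda>x. f x + g x)"
  unfolding translation_continuous_def
proof (intro allI impI)
  fix \<sigma> :: "nat \<Rightarrow> real" assume \<sigma>: "\<sigma> \<longlonglongrightarrow> 0"
  let ?I = "\<lambda>h n. \<integral>x. \<bar>h (x + \<sigma> n) - h x\<bar> \<partial>lborel"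
  have "(\<lambda>n. ?I f n + ?I g n) \<longlonglongrightarrow> 0"
    using assms(3,4) \<sigma> by (auto simp: translation_continuous_def intro!: tendsto_add_zero)
  moreover have "norm (?I (\<lambda>x. f x + g x) n) \<le> ?I f n + ?I g n" for n
  proof -
    have int: "integrable lborel (\<lambda>x. \<bar>f (x + \<sigma> n) - f x\<bar>)" "integrable lborel (\<lambda>x. \<bar>g (x + \<sigma> n) - g x\<bar>)"
      "integrable lborel (\<lambda>x. \<bar>(f (x + \<sigma> n) + g (x + \<sigma> n)) - (f x + g x)\<bar>)"
      using assms(1,2) integrable_shift[OF assms(1), of "\<sigma> n"] integrable_shift[OF assms(2), of "\<sigma> n"] by auto
    have "?I (\<lambda>x. f x + g x) n \<le> (\<integral>x. \<bar>f (x + \<sigma> n) - f x\<bar> + \<bar>g (x + \<sigma> n) - g x\<bar> \<partial>lborel)"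
      using int by (intro integral_mono) auto
    then show ?thesis
      using int by simp
  qed
  ultimately show "?I (\<lambda>x. f x + g x) \<longlonglongrightarrow> 0"
    by (intro Lim_null_comparison[of "?I (\<lambda>x. f x + g x)" "\<lambda>n. ?I f n + ?I g n"]) auto
qed

lemma translation_continuous_cmult:
  assumes "translation_continuous f"
  shows "translation_continuous (\<lambda>x. c * f x)"
proof -
  have "(\<integral>x. \<bar>c * f (x + s) - c * f x\<bar> \<partial>lborel) = \<bar>c\<bar> * (\<integral>x. \<bar>f (x + s) - f x\<bar> \<partial>lborel)" for s
    by (simp flip: right_diff_distrib add: abs_mult)
  then show ?thesis
    using assms by (auto simp: translation_continuous_def intro!: tendsto_mult_right_zero)
qed

text \<open>
  The indicator function of an open set \<open>U\<close> is lower semicontinuous, so \<open>1\<^sub>U(x) 1\<^sub>U(x + s)\<close> tends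
  to \<open>1\<^sub>U(x)\<close> at every point, and the measure of the symmetric difference of \<open>U\<close> and \<open>U - s\<close> is
  \<open>2 \<bar>U\<bar> - 2 \<bar>U \<inter> (U - s)\<bar>\<close>.
\<close>

lemma translation_continuous_open:
  assumes U: "open U" "emeasure lborel U < \<infinity>"
  shows "translation_continuous (indicator U)"
  unfolding translation_continuous_def
proof (intro allI impI)
  fix \<sigma> :: "nat \<Rightarrow> real" assume \<sigma>: "\<sigma> \<longlonglongrightarrow> 0"
  let ?i = "indicator U :: real \<Rightarrow> real"
  have [measurable]: "U \<in> sets borel"
    using U(1) by simp
  have int: "integrable lborel ?i"
    using U(2) by (simp add: integrable_indicator_iff)
  have intn: "integrable lborel (\<lambda>x. ?i (x + \<sigma> n))" for n
    using integrable_shift[OF int] .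
  have int2: "integrable lborel (\<lambda>x. ?i x * ?i (x + \<sigma> n))" for n
    by (rule Bochner_Integration.integrable_bound[OF int]) (auto split: split_indicator)
  have "(\<lambda>n. \<integral>x. ?i x * ?i (x + \<sigma> n) \<partial>lborel) \<longlonglongrightarrow> (\<integral>x. ?i x \<partial>lborel)"
  proof (rule integral_dominated_convergence[where w = ?i])
    show "AE x in lborel. (\<lambda>n. ?i x * ?i (x + \<sigma> n)) \<longlonglongrightarrow> ?i x"
    proof (rule AE_I2)
      fix x
      show "(\<lambda>n. ?i x * ?i (x + \<sigma> n)) \<longlonglongrightarrow> ?i x"
      proof (cases "x \<in> U")
        case True
        have "(\<lambda>n. x + \<sigma> n) \<longlonglongrightarrow> x + 0"
          by (intro tendsto_intros \<sigma>)
        then have "\<forall>\<^sub>F n in sequentially. x + \<sigma> n \<in> U"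
          using True U(1) by (auto intro: topological_tendstoD)
        then have "\<forall>\<^sub>F n in sequentially. ?i x * ?i (x + \<sigma> n) = ?i x"
          by eventually_elim (use True in auto)
        then show ?thesis
          by (rule tendsto_eventually)
      qed simp
    qed
  qed (use int in \<open>auto split: split_indicator\<close>)
  then have lim: "(\<lambda>n. 2 * (\<integral>x. ?i x \<partial>lborel) - 2 * (\<integral>x. ?i x * ?i (x + \<sigma> n) \<partial>lborel))
      \<longlonglongrightarrow> 2 * (\<integral>x. ?i x \<partial>lborel) - 2 * (\<integral>x. ?i x \<partial>lborel)"
    by (intro tendsto_intros)
  have "(\<integral>x. \<bar>?i (x + \<sigma> n) - ?i x\<bar> \<partial>lborel)
      = 2 * (\<integral>x. ?i x \<partial>lborel) - 2 * (\<integral>x. ?i x * ?i (x + \<sigma> n) \<partial>lborel)" for n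
  proof -
    have "(\<integral>x. \<bar>?i (x + \<sigma> n) - ?i x\<bar> \<partial>lborel)
        = (\<integral>x. ?i (x + \<sigma> n) + ?i x - 2 * (?i x * ?i (x + \<sigma> n)) \<partial>lborel)"
      by (intro Bochner_Integration.integral_cong) (auto split: split_indicator)
    also have "\<dots> = (\<integral>x. ?i (x + \<sigma> n) \<partial>lborel) + (\<integral>x. ?i x \<partial>lborel) - 2 * (\<integral>x. ?i x * ?i (x + \<sigma> n) \<partial>lborel)"
      using int intn[of n] int2[of n] by simp
    finally show ?thesis
      by (simp only: integral_shift)
  qed
  then show "(\<lambda>n. \<integral>x. \<bar>?i (x + \<sigma> n) - ?i x\<bar> \<partial>lborel) \<longlonglongrightarrow> 0"
    using lim by simp
qed

text \<open>
  Outer regularity passes from open sets to Borel sets, and approximation by simple functions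
  from indicator functions to integrable functions.
\<close>

lemma integrable_translation_continuous:
  assumes "integrable lborel f"
  shows "translation_continuous f"
  using assms
proof (induction rule: integrable_induct)
  case (base A c)
  have [measurable]: "A \<in> sets borel"
    using base by simp
  have intA: "integrable lborel (indicator A :: real \<Rightarrow> real)"
    using base by (simp add: integrable_indicator_iff)
  have "translation_continuous (indicator A)"
  proof (rule translation_continuous_approx[OF intA])
    fix e :: real assume "0 < e"
    from outer_regular_lborel[OF _ this, of A]
    obtain U where U: "open U" "A \<subseteq> U" "emeasure lborel (U - A) < e"
      by auto
    have [measurable]: "U \<in> sets borel"
      using U by simp
    have "emeasure lborel U \<le> emeasure lborel A + emeasure lborel (U - A)"
    proof -
      have "A \<union> (U - A) = U"
        using U by auto
      then show ?thesis
        using emeasure_subadditive[of A lborel "U - A"] by simp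
    qed
    also have "\<dots> < \<infinity>"
      using base(2) U(3) by (simp add: order.strict_trans[OF U(3)])
    finally have fin: "emeasure lborel U < \<infinity>" .
    have "(\<integral>x. \<bar>indicator A x - indicator U x :: real\<bar> \<partial>lborel) = (\<integral>x. indicator (U - A) x \<partial>lborel)"
      using U(2) by (intro Bochner_Integration.integral_cong) (auto split: split_indicator)
    also have "\<dots> = measure lborel (U - A)"
      by simp
    also have "\<dots> \<le> e"
      using U(3) \<open>0 < e\<close> by (simp add: measure_def enn2real_leI less_imp_le)
    finally show "\<exists>g. integrable lborel g \<and> translation_continuous g \<and>
        (\<integral>x. \<bar>indicator A x - g x\<bar> \<partial>lborel) \<le> e"
      using U fin translation_continuous_open[OF U(1) fin]
      by (intro exI[of _ "indicator U"]) (auto simp: integrable_indicator_iff)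
  qed
  from translation_continuous_cmult[OF this, of c] show ?case
    by (simp add: mult.commute)
next
  case (add f g)
  then show ?case
    by (intro translation_continuous_add)
next
  case (lim f s)
  show ?case
  proof (rule translation_continuous_approx)
    fix e :: real assume "0 < e"
    have "(\<lambda>i. \<integral>x. \<bar>f x - s i x\<bar> \<partial>lborel) \<longlonglongrightarrow> (\<integral>(x::real). (0::real) \<partial>lborel)"
    proof (rule integral_dominated_convergence[where w = "\<lambda>x. 3 * \<bar>f x\<bar>"])
      show "AE x in lborel. (\<lambda>i. \<bar>f x - s i x\<bar>) \<longlonglongrightarrow> 0"
      proof (rule AE_I2)
        fix x
        have "(\<lambda>i. \<bar>f x - s i x\<bar>) \<longlonglongrightarrow> \<bar>f x - f x\<bar>"
          using lim by (intro tendsto_intros) auto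
        then show "(\<lambda>i. \<bar>f x - s i x\<bar>) \<longlonglongrightarrow> 0"
          by simp
      qed
      show "AE x in lborel. norm \<bar>f x - s i x\<bar> \<le> 3 * \<bar>f x\<bar>" for i
      proof (rule AE_I2)
        fix x
        show "norm \<bar>f x - s i x\<bar> \<le> 3 * \<bar>f x\<bar>"
          using lim(3)[of x i] by simp
      qed
    qed (use lim in auto)
    from LIMSEQ_D[OF this \<open>0 < e\<close>] obtain i where "(\<integral>x. \<bar>f x - s i x\<bar> \<partial>lborel) < e"
      by (auto dest!: spec)
    then show "\<exists>g. integrable lborel g \<and> translation_continuous g \<and> (\<integral>x. \<bar>f x - g x\<bar> \<partial>lborel) \<le> e"
      using lim by (intro exI[of _ "s i"]) (auto intro: less_imp_le)
  qed (use lim in auto)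
qed

text \<open>
  For nonnegative functions the square integrable case reduces to the integrable one through
  \<open>(a - b)\<^sup>2 \<le> \<bar>a\<^sup>2 - b\<^sup>2\<bar>\<close>; a general function is split into its positive and negative parts.
\<close>

lemma tendsto_L2_translation_nonneg:
  assumes f: "f \<in> L2" and nonneg: "\<And>x. 0 \<le> f x"
  shows "tendsto_L2 (\<lambda>s x. f (x + s)) f (at 0)"
  unfolding tendsto_L2_def
proof (intro conjI)
  show "\<forall>\<^sub>F s in at 0. (\<lambda>x. f (x + s)) \<in> L2"
    using L2_shift[OF f] by simp
  show "f \<in> L2"
    by (rule f)
  show "((\<lambda>s. L2_norm (\<lambda>x. f (x + s) - f x)) \<longlongrightarrow> 0) (at 0)"
    unfolding tendsto_at_iff_sequentially
  proof (intro allI impI)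
    fix \<sigma> :: "nat \<Rightarrow> real" assume \<sigma>: "\<sigma> \<longlonglongrightarrow> 0"
    have int: "integrable lborel (\<lambda>x. (f x)\<^sup>2)"
      using f by (rule L2_integrable_square)
    have "(\<lambda>n. \<integral>x. \<bar>(f (x + \<sigma> n))\<^sup>2 - (f x)\<^sup>2\<bar> \<partial>lborel) \<longlonglongrightarrow> 0"
      using integrable_translation_continuous[OF int] \<sigma> by (auto simp: translation_continuous_def)
    then have lim: "(\<lambda>n. sqrt (\<integral>x. \<bar>(f (x + \<sigma> n))\<^sup>2 - (f x)\<^sup>2\<bar> \<partial>lborel)) \<longlonglongrightarrow> sqrt 0"
      by (rule tendsto_real_sqrt)
    have "L2_norm (\<lambda>x. f (x + \<sigma> n) - f x) \<le> sqrt (\<integral>x. \<bar>(f (x + \<sigma> n))\<^sup>2 - (f x)\<^sup>2\<bar> \<partial>lborel)" for n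
      unfolding L2_norm_def
    proof (intro real_sqrt_le_mono integral_mono)
      show "integrable lborel (\<lambda>x. (f (x + \<sigma> n) - f x)\<^sup>2)"
        by (rule L2_integrable_square[OF L2_diff[OF L2_shift[OF f] f]])
      show "integrable lborel (\<lambda>x. \<bar>(f (x + \<sigma> n))\<^sup>2 - (f x)\<^sup>2\<bar>)"
        using int integrable_shift[OF int, of "\<sigma> n"] by auto
      fix x
      have "\<bar>f (x + \<sigma> n) - f x\<bar> * \<bar>f (x + \<sigma> n) - f x\<bar> \<le> \<bar>f (x + \<sigma> n) - f x\<bar> * \<bar>f (x + \<sigma> n) + f x\<bar>"
        using nonneg[of x] nonneg[of "x + \<sigma> n"] by (intro mult_left_mono) auto
      also have "\<dots> = \<bar>(f (x + \<sigma> n))\<^sup>2 - (f x)\<^sup>2\<bar>"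
        by (simp add: power2_eq_square algebra_simps flip: abs_mult)
      finally show "(f (x + \<sigma> n) - f x)\<^sup>2 \<le> \<bar>(f (x + \<sigma> n))\<^sup>2 - (f x)\<^sup>2\<bar>"
        by (simp add: power2_eq_square)
    qed
    then have "\<forall>n. norm (L2_norm (\<lambda>x. f (x + \<sigma> n) - f x)) \<le> sqrt (\<integral>x. \<bar>(f (x + \<sigma> n))\<^sup>2 - (f x)\<^sup>2\<bar> \<partial>lborel)"
      by simp
    from Lim_null_comparison[OF always_eventually[OF this]] lim
    show "((\<lambda>s. L2_norm (\<lambda>x. f (x + s) - f x)) \<circ> \<sigma>) \<longlonglongrightarrow> 0"
      by (simp add: o_def)
  qed
qed

lemma tendsto_L2_translation:
  assumes f: "f \<in> L2"
  shows "tendsto_L2 (\<lambda>s x. f (x + s)) f (at 0)"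
proof -
  have [measurable]: "f \<in> borel_measurable borel"
    using f by (rule L2_measurable)
  have int: "integrable lborel (\<lambda>x. (f x)\<^sup>2)"
    using f by (rule L2_integrable_square)
  have "(\<lambda>x. max 0 (f x)) \<in> L2"
    by (intro L2I Bochner_Integration.integrable_bound[OF int] AE_I2) (simp_all add: max_def)
  moreover have "(\<lambda>x. max 0 (- f x)) \<in> L2"
    by (intro L2I Bochner_Integration.integrable_bound[OF int] AE_I2) (simp_all add: max_def)
  ultimately have "tendsto_L2 (\<lambda>s x. max 0 (f (x + s)) - max 0 (- f (x + s))) (\<lambda>x. max 0 (f x) - max 0 (- f x)) (at 0)"
    by (intro tendsto_L2_diff tendsto_L2_translation_nonneg[where f = "\<lambda>x. max 0 (f x)"]
      tendsto_L2_translation_nonneg[where f = "\<lambda>x. max 0 (- f x)"]) simp_all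
  moreover have "max 0 y - max 0 (- y) = y" for y :: real
    by (auto simp: max_def)
  ultimately show ?thesis
    by simp
qed

section \<open>Smooth cutoff functions\<close>

text \<open>
  The derivatives of \<open>e\<^bsup>-1/x\<^esup>\<close>, extended by \<open>0\<close> to the left half line, are combinations of
  the functions \<open>x\<^bsup>-k\<^esup> e\<^bsup>-1/x\<^esup>\<close>.
\<close>

definition flat :: "nat \<Rightarrow> real \<Rightarrow> real" where
  "flat k x = (if x > 0 then exp (- inverse x) * inverse x ^ k else 0)"

text \<open>
  With \<open>y = 1/x\<close> this is \<open>e\<^sup>y \<ge> y\<^bsup>k + 2\<^esup> / (k + 2)!\<close>. The square makes the derivative at \<open>0\<close> vanish.
\<close>

lemma flat_le_square: "\<bar>flat k x\<bar> \<le> fact (k + 2) * x\<^sup>2"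
proof (cases "x > 0")
  case True
  define y where "y = inverse x"
  have y: "y > 0" "y * x = 1"
    using True by (auto simp: y_def)
  have "y ^ (k + 2) /\<^sub>R fact (k + 2) \<le> exp y"
    using sum_le_suminf[OF sums_summable[OF exp_converges[of y]], of "{k + 2}"] y(1)
      sums_unique[OF exp_converges[of y]] by (simp del: fact_Suc power_Suc)
  then have "y ^ k * y\<^sup>2 \<le> fact (k + 2) * exp y"
    by (simp add: divide_simps mult.commute power2_eq_square mult.left_commute del: fact_Suc)
  then have "exp (- y) * (y ^ k * y\<^sup>2) \<le> exp (- y) * (fact (k + 2) * exp y)"
    by (intro mult_left_mono) auto
  also have "\<dots> = fact (k + 2)"
    by (simp add: exp_minus)
  finally have "exp (- y) * (y ^ k * y\<^sup>2) * x\<^sup>2 \<le> fact (k + 2) * x\<^sup>2"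
    by (intro mult_right_mono) auto
  moreover have "exp (- y) * (y ^ k * y\<^sup>2) * x\<^sup>2 = exp (- y) * y ^ k * (y * x)\<^sup>2"
    by (simp add: power_mult_distrib)
  ultimately have "exp (- y) * y ^ k \<le> fact (k + 2) * x\<^sup>2"
    unfolding y(2) by simp
  then show ?thesis
    using True by (simp add: flat_def y_def del: fact_Suc)
qed (simp add: flat_def)

lemma flat_has_real_derivative:
  "(flat k has_real_derivative flat (k + 2) x + (- real k) * flat (k + 1) x) (at x)"
proof -
  consider "x > 0" | "x < 0" | "x = 0"
    by linarith
  then show ?thesis
  proof cases
    case 1
    have eq: "real k * (inverse x ^ (k - 1) * (inverse x)\<^sup>2) = real k * inverse x ^ (k + 1)"
      by (cases k) (simp_all add: power2_eq_square)
    have "((\<lambda>x. exp (- inverse x) * inverse x ^ k) has_real_derivative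
        exp (- inverse x) * (inverse x)\<^sup>2 * inverse x ^ k
        - exp (- inverse x) * (real k * (inverse x ^ (k - 1) * (inverse x)\<^sup>2))) (at x)"
      using 1 by (auto intro!: derivative_eq_intros simp: power2_eq_square)
    also have "exp (- inverse x) * (inverse x)\<^sup>2 * inverse x ^ k
        - exp (- inverse x) * (real k * (inverse x ^ (k - 1) * (inverse x)\<^sup>2))
        = flat (k + 2) x + (- real k) * flat (k + 1) x"
      unfolding eq using 1 by (simp add: flat_def power2_eq_square)
    finally have "((\<lambda>x. exp (- inverse x) * inverse x ^ k) has_real_derivative
        flat (k + 2) x + (- real k) * flat (k + 1) x) (at x)" .
    then show ?thesis
      by (rule has_field_derivative_transform_within_open[where S = "{0<..}"]) (use 1 in \<open>auto simp: flat_def\<close>)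
  next
    case 2
    have "((\<lambda>x. 0) has_real_derivative flat (k + 2) x + (- real k) * flat (k + 1) x) (at x)"
      using 2 by (simp add: flat_def)
    then show ?thesis
      by (rule has_field_derivative_transform_within_open[where S = "{..<0}"]) (use 2 in \<open>auto simp: flat_def\<close>)
  next
    case 3
    have "((\<lambda>h. flat k h / h) \<longlongrightarrow> 0) (at 0)"
    proof (rule Lim_null_comparison)
      show "\<forall>\<^sub>F h in at 0. norm (flat k h / h) \<le> fact (k + 2) * \<bar>h\<bar>"
        unfolding eventually_at_filter
      proof (intro always_eventually allI impI)
        fix h :: real assume "h \<noteq> 0"
        have "\<bar>flat k h\<bar> / \<bar>h\<bar> \<le> fact (k + 2) * h\<^sup>2 / \<bar>h\<bar>"
          by (intro divide_right_mono flat_le_square) simp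
        also have "\<dots> = fact (k + 2) * (\<bar>h\<bar> * \<bar>h\<bar> / \<bar>h\<bar>)"
          by (simp add: power2_eq_square)
        also have "\<bar>h\<bar> * \<bar>h\<bar> / \<bar>h\<bar> = \<bar>h\<bar>"
          using \<open>h \<noteq> 0\<close> nonzero_mult_div_cancel_left[of "\<bar>h\<bar>" "\<bar>h\<bar>"] by linarith
        finally show "norm (flat k h / h) \<le> fact (k + 2) * \<bar>h\<bar>"
          by simp
      qed
      show "((\<lambda>h::real. fact (k + 2) * \<bar>h\<bar>) \<longlongrightarrow> 0) (at 0)"
        by (intro tendsto_mult_right_zero tendsto_rabs_zero tendsto_ident_at)
    qed
    then show ?thesis
      using 3 by (simp add: DERIV_def flat_def)
  qed
qed

text \<open>
  A family of functions that is closed under differentiation consists of smooth functions; closing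
  the functions above under the operations below gives such a family.
\<close>

inductive_set flat_algebra :: "(real \<Rightarrow> real) set" where
  flat: "flat k \<in> flat_algebra"
| affine: "f \<in> flat_algebra \<Longrightarrow> (\<lambda>x. f (c * x + d)) \<in> flat_algebra"
| cmult: "f \<in> flat_algebra \<Longrightarrow> (\<lambda>x. c * f x) \<in> flat_algebra"
| add: "f \<in> flat_algebra \<Longrightarrow> g \<in> flat_algebra \<Longrightarrow> (\<lambda>x. f x + g x) \<in> flat_algebra"
| mult: "f \<in> flat_algebra \<Longrightarrow> g \<in> flat_algebra \<Longrightarrow> (\<lambda>x. f x * g x) \<in> flat_algebra"

lemma flat_algebra_derivative:
  "f \<in> flat_algebra \<Longrightarrow> \<exists>g\<in>flat_algebra. \<forall>x. (f has_real_derivative g x) (at x)"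
proof (induction rule: flat_algebra.induct)
  case (flat k)
  show ?case
    using flat_has_real_derivative[of k]
    by (intro bexI[of _ "\<lambda>x. flat (k + 2) x + (- real k) * flat (k + 1) x"] flat_algebra.intros) auto
next
  case (affine f c d)
  then obtain g where g: "g \<in> flat_algebra" "\<And>x. (f has_real_derivative g x) (at x)"
    by auto
  have "((\<lambda>x. f (c * x + d)) has_real_derivative c * g (c * x + d)) (at x)" for x
  proof -
    have "((\<lambda>x. c * x + d) has_real_derivative c) (at x)"
      by (auto intro!: derivative_eq_intros)
    from DERIV_chain2[OF g(2) this] show ?thesis
      unfolding mult.commute[of c "g (c * x + d)"] .
  qed
  then show ?case
    using g(1) by (intro bexI[of _ "\<lambda>x. c * g (c * x + d)"] flat_algebra.cmult flat_algebra.affine) auto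
next
  case (cmult f c)
  then obtain g where g: "g \<in> flat_algebra" "\<And>x. (f has_real_derivative g x) (at x)"
    by auto
  then show ?case
    by (intro bexI[of _ "\<lambda>x. c * g x"] flat_algebra.cmult) (auto intro: DERIV_cmult)
next
  case (add f1 f2)
  then obtain g1 g2 where g: "g1 \<in> flat_algebra" "\<And>x. (f1 has_real_derivative g1 x) (at x)"
    "g2 \<in> flat_algebra" "\<And>x. (f2 has_real_derivative g2 x) (at x)"
    by auto
  then show ?case
    by (intro bexI[of _ "\<lambda>x. g1 x + g2 x"] flat_algebra.add) (auto intro: DERIV_add)
next
  case (mult f1 f2)
  then obtain g1 g2 where g: "g1 \<in> flat_algebra" "\<And>x. (f1 has_real_derivative g1 x) (at x)"
    "g2 \<in> flat_algebra" "\<And>x. (f2 has_real_derivative g2 x) (at x)"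
    by auto
  with mult.hyps show ?case
    by (intro bexI[of _ "\<lambda>x. g1 x * f2 x + g2 x * f1 x"] flat_algebra.add flat_algebra.mult)
       (auto intro: DERIV_mult)
qed

lemma flat_algebra_smooth:
  assumes "f \<in> flat_algebra"
  shows "(deriv ^^ n) f \<in> flat_algebra"
proof (induction n)
  case (Suc n)
  then obtain g where g: "g \<in> flat_algebra" "\<And>x. ((deriv ^^ n) f has_real_derivative g x) (at x)"
    using flat_algebra_derivative by blast
  have "deriv ((deriv ^^ n) f) = g"
    using g(2) by (intro ext DERIV_imp_deriv)
  then show ?case
    using g(1) by simp
qed (use assms in simp)

lemma flat_algebra_differentiable_on: "f \<in> flat_algebra \<Longrightarrow> f differentiable_on UNIV"
  using flat_algebra_derivative[of f]
  by (auto simp: differentiable_on_def real_differentiable_def)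

lemma flat_algebra_isCont: "f \<in> flat_algebra \<Longrightarrow> isCont f x"
  using flat_algebra_derivative[of f] DERIV_isCont by blast

lemma test_funI:
  assumes f: "\<And>x. (f has_real_derivative g x) (at x)" and g: "g \<in> flat_algebra"
    and supp: "\<And>x. x \<notin> {a..b} \<Longrightarrow> f x = 0"
  shows "f \<in> test_fun"
proof -
  have "deriv f = g"
    using f by (intro ext DERIV_imp_deriv)
  have "(deriv ^^ n) f differentiable_on UNIV" for n
  proof (cases n)
    case 0
    then show ?thesis
      using f by (auto simp: differentiable_on_def real_differentiable_def)
  next
    case (Suc m)
    then have "(deriv ^^ n) f = (deriv ^^ m) g"
      using \<open>deriv f = g\<close> by (simp add: funpow_swap1)
    then show ?thesis
      using flat_algebra_differentiable_on[OF flat_algebra_smooth[OF g, of m]] by simp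
  qed
  moreover have "{x. f x \<noteq> 0} \<subseteq> {a..b}"
    using supp by blast
  then have "closure {x. f x \<noteq> 0} \<subseteq> {a..b}"
    by (intro closure_minimal) auto
  then have "compact (closure {x. f x \<noteq> 0})"
    using compact_Icc[of a b] compact_Int_closed[of "{a..b}" "closure {x. f x \<noteq> 0}"]
    by (simp add: Int_absorb1)
  ultimately show ?thesis
    by (simp add: test_fun_def)
qed

definition bump0 :: "real \<Rightarrow> real" where
  "bump0 x = flat 0 x * flat 0 ((-1) * x + 1)"

text \<open>
  The integral may start at any negative number; then \<open>0\<close> is an interior point of the interval
  of integration for every \<open>x \<ge> 0\<close>.
\<close>

definition step0 :: "real \<Rightarrow> real" where
  "step0 x = integral {-1..x} bump0"

definition bump :: "real \<Rightarrow> real" where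
  "bump x = 1 / step0 1 * bump0 x"

definition smooth_step :: "real \<Rightarrow> real" where
  "smooth_step x = step0 x / step0 1"

lemma bump0_flat_algebra: "bump0 \<in> flat_algebra"
proof -
  have "(\<lambda>x. flat 0 x * flat 0 ((-1) * x + 1)) \<in> flat_algebra"
    by (intro flat_algebra.mult flat_algebra.affine flat_algebra.flat)
  then show ?thesis
    by (simp add: bump0_def[abs_def])
qed

lemma bump0_nonneg: "0 \<le> bump0 x"
  by (simp add: bump0_def flat_def)

lemma bump0_pos: "0 < x \<Longrightarrow> x < 1 \<Longrightarrow> 0 < bump0 x"
  by (simp add: bump0_def flat_def)

lemma bump0_eq_0: "x \<le> 0 \<or> 1 \<le> x \<Longrightarrow> bump0 x = 0"
  by (auto simp: bump0_def flat_def)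

lemma bump0_le_1: "bump0 x \<le> 1"
proof -
  have "flat 0 y \<le> 1" "0 \<le> flat 0 y" for y
    by (simp_all add: flat_def)
  then show ?thesis
    unfolding bump0_def by (intro mult_le_one)
qed

lemma step0_eq_0: "x \<le> 0 \<Longrightarrow> step0 x = 0"
  unfolding step0_def by (intro integral_unique has_integral_is_0) (auto simp: bump0_eq_0)

lemma step0_has_real_derivative: "(step0 has_real_derivative bump0 x) (at x)"
proof (cases "x < 0")
  case True
  have "((\<lambda>x. 0) has_real_derivative bump0 x) (at x)"
    using True by (simp add: bump0_eq_0)
  then show ?thesis
    by (rule has_field_derivative_transform_within_open[where S = "{..<0}"])
       (use True in \<open>auto simp: step0_eq_0\<close>)
next
  case False
  have "continuous_on {-1..x + 1} bump0"
    using flat_algebra_isCont[OF bump0_flat_algebra] by (intro continuous_at_imp_continuous_on) auto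
  then have "((\<lambda>y. integral {-1..y} bump0) has_real_derivative bump0 x) (at x within {-1..x + 1})"
    using False by (intro integral_has_real_derivative) auto
  moreover have "at x within {-1..x + 1} = at x"
    using False by (intro at_within_interior) auto
  ultimately show ?thesis
    by (simp add: step0_def[abs_def])
qed

lemma step0_1_pos: "0 < step0 1"
proof -
  have "\<exists>z>0. z < 1 \<and> step0 1 - step0 0 = (1 - 0) * bump0 z"
    by (rule MVT2) (auto intro: step0_has_real_derivative)
  then show ?thesis
    using bump0_pos step0_eq_0[of 0] by auto
qed

lemma step0_eq_1: 
  assumes "1 \<le> x"
  shows "step0 x = step0 1"
proof (cases "x = 1")
  case False
  then have "\<exists>z>1. z < x \<and> step0 x - step0 1 = (x - 1) * bump0 z"
    using assms by (intro MVT2) (auto intro: step0_has_real_derivative)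
  then show ?thesis
    by (auto simp: bump0_eq_0)
qed simp

lemma bump_nonneg: "0 \<le> bump x"
  using step0_1_pos bump0_nonneg[of x] by (simp add: bump_def)

lemma bump_le: "bump x \<le> 1 / step0 1"
  using step0_1_pos bump0_le_1[of x] by (simp add: bump_def divide_right_mono)

lemma bump_eq_0: "x \<le> 0 \<or> 1 \<le> x \<Longrightarrow> bump x = 0"
  by (simp add: bump_def bump0_eq_0)

lemma bump_flat_algebra: "bump \<in> flat_algebra"
  using flat_algebra.cmult[OF bump0_flat_algebra, of "1 / step0 1"] by (simp add: bump_def[abs_def])

lemma bump_isCont: "isCont bump x"
  by (rule flat_algebra_isCont[OF bump_flat_algebra])

lemma bump_measurable [measurable]: "bump \<in> borel_measurable borel"
  using bump_isCont by (intro borel_measurable_continuous_onI continuous_at_imp_continuous_on) auto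

lemma smooth_step_has_real_derivative: "(smooth_step has_real_derivative bump x) (at x)"
  unfolding smooth_step_def[abs_def] bump_def
  by (rule DERIV_cong[OF DERIV_cdivide[OF step0_has_real_derivative]]) simp

lemma smooth_step_eq_0: "x \<le> 0 \<Longrightarrow> smooth_step x = 0"
  by (simp add: smooth_step_def step0_eq_0)

lemma smooth_step_eq_1: "1 \<le> x \<Longrightarrow> smooth_step x = 1"
  using step0_1_pos step0_eq_1[of x] by (simp add: smooth_step_def)

lemma smooth_step_mono: "x \<le> y \<Longrightarrow> smooth_step x \<le> smooth_step y"
  using smooth_step_has_real_derivative bump_nonneg
  by (blast intro: DERIV_nonneg_imp_nondecreasing[of x y smooth_step])

lemma smooth_step_nonneg: "0 \<le> smooth_step x"
  using smooth_step_mono[of 0 x] smooth_step_eq_0[of 0] smooth_step_eq_0[of x] by linarith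

lemma smooth_step_le_1: "smooth_step x \<le> 1"
  using smooth_step_mono[of x 1] smooth_step_eq_1[of 1] smooth_step_eq_1[of x] by linarith

lemma bump_integral:
  shows bump_integrable: "integrable lborel bump" and bump_integral_1: "(\<integral>x. bump x \<partial>lborel) = 1"
proof -
  have "has_bochner_integral lborel (\<lambda>x. bump x * indicator {0..1} x) (smooth_step 1 - smooth_step 0)"
    by (rule has_bochner_integral_FTC_Icc_real) (auto intro: smooth_step_has_real_derivative bump_isCont)
  moreover have "bump x * indicator {0..1} x = bump x" for x
    by (auto simp: bump_eq_0 split: split_indicator)
  ultimately have "has_bochner_integral lborel bump 1"
    by (simp add: smooth_step_eq_0 smooth_step_eq_1)
  then show "integrable lborel bump" "(\<integral>x. bump x \<partial>lborel) = 1"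
    by (auto simp: has_bochner_integral_iff)
qed

text \<open>A plateau that rises over \<open>{a..a + l}\<close> and falls over \<open>{b..b + m}\<close>.\<close>

definition plateau :: "real \<Rightarrow> real \<Rightarrow> real \<Rightarrow> real \<Rightarrow> real \<Rightarrow> real" where
  "plateau a l b m x = smooth_step ((x - a) / l) - smooth_step ((x - b) / m)"

definition plateau_deriv :: "real \<Rightarrow> real \<Rightarrow> real \<Rightarrow> real \<Rightarrow> real \<Rightarrow> real" where
  "plateau_deriv a l b m x = bump ((x - a) / l) / l - bump ((x - b) / m) / m"

lemma plateau_has_real_derivative:
  "(plateau a l b m has_real_derivative plateau_deriv a l b m x) (at x)"
proof -
  have "((\<lambda>x. smooth_step ((x - c) / k)) has_real_derivative bump ((x - c) / k) / k) (at x)" for c k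
  proof -
    have "((\<lambda>x. (x - c) / k) has_real_derivative 1 / k) (at x)"
      by (rule DERIV_cdivide) (auto intro!: derivative_eq_intros)
    from DERIV_chain2[OF smooth_step_has_real_derivative this] show ?thesis
      by simp
  qed
  from DERIV_diff[OF this this] show ?thesis
    unfolding plateau_def[abs_def] plateau_deriv_def .
qed

lemma plateau_deriv_flat_algebra: "plateau_deriv a l b m \<in> flat_algebra"
proof -
  have "(\<lambda>x. (1 / l) * bump ((1 / l) * x + (- a / l)) + (- 1 / m) * bump ((1 / m) * x + (- b / m))) \<in> flat_algebra"
    by (intro flat_algebra.add flat_algebra.cmult flat_algebra.affine bump_flat_algebra)
  then show ?thesis
    by (simp add: plateau_deriv_def[abs_def] diff_divide_distrib)
qed

lemma plateau_eq_0:
  assumes "0 < l" "0 < m" "a \<le> b" "x \<notin> {a..max (a + l) (b + m)}"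
  shows "plateau a l b m x = 0"
proof -
  consider "x < a" | "x > a + l" "x > b + m"
    using assms(4) by force
  then show ?thesis
  proof cases
    case 1
    then show ?thesis
      using assms by (simp add: plateau_def smooth_step_eq_0 divide_nonpos_pos)
  next
    case 2
    then show ?thesis
      using assms by (simp add: plateau_def smooth_step_eq_1 le_divide_eq)
  qed
qed

lemma plateau_test_fun:
  assumes "0 < l" "0 < m" "a \<le> b"
  shows "plateau a l b m \<in> test_fun"
  using plateau_has_real_derivative plateau_deriv_flat_algebra plateau_eq_0[OF assms]
  by (rule test_funI)

lemma deriv_plateau: "deriv (plateau a l b m) = plateau_deriv a l b m"
  by (intro ext DERIV_imp_deriv plateau_has_real_derivative)

section \<open>Weak derivatives\<close>

lemma test_fun_has_real_derivative:
  assumes "\<phi> \<in> test_fun"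
  shows "(\<phi> has_real_derivative deriv \<phi> x) (at x)"
proof -
  have "(deriv ^^ 0) \<phi> differentiable_on UNIV"
    using assms unfolding test_fun_def by blast
  then show ?thesis
    using DERIV_deriv_iff_real_differentiable by (auto simp: differentiable_on_def)
qed

lemma test_fun_isCont: "\<phi> \<in> test_fun \<Longrightarrow> isCont \<phi> x"
  using test_fun_has_real_derivative DERIV_isCont by blast

lemma test_fun_support:
  assumes "\<phi> \<in> test_fun"
  obtains R where "R > 0" "\<And>x. R < \<bar>x\<bar> \<Longrightarrow> \<phi> x = 0"
proof -
  have "bounded (closure {x. \<phi> x \<noteq> 0})"
    using assms by (auto simp: test_fun_def compact_imp_bounded)
  from this[unfolded bounded_pos]
  obtain R where R: "R > 0 \<and> (\<forall>x\<in>closure {x. \<phi> x \<noteq> 0}. norm x \<le> R)" ..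
  have "\<phi> x = 0" if "R < \<bar>x\<bar>" for x
  proof (rule ccontr)
    assume "\<phi> x \<noteq> 0"
    then have "x \<in> closure {x. \<phi> x \<noteq> 0}"
      by (intro subsetD[OF closure_subset]) simp
    then show False
      using bspec[OF conjunct2[OF R], of x] that by simp
  qed
  then show thesis
    using R by (intro that[of R]) auto
qed

lemma deriv_test_fun:
  assumes "\<phi> \<in> test_fun"
  shows "deriv \<phi> \<in> test_fun"
proof -
  obtain R where R: "\<And>x. R < \<bar>x\<bar> \<Longrightarrow> \<phi> x = 0"
    using test_fun_support[OF assms] by blast
  have "(deriv ^^ n) (deriv \<phi>) differentiable_on UNIV" for n
  proof -
    have "(deriv ^^ Suc n) \<phi> differentiable_on UNIV"
      using assms unfolding test_fun_def by blast
    then show ?thesis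
      by (simp add: funpow_swap1)
  qed
  moreover have "deriv \<phi> x = 0" if "R < \<bar>x\<bar>" for x
  proof -
    have "open {y::real. R < \<bar>y\<bar>}"
      by (intro open_Collect_less continuous_intros)
    from has_field_derivative_transform_within_open[OF DERIV_const this, of x 0 \<phi>] that R
    show ?thesis
      by (intro DERIV_imp_deriv) auto
  qed
  then have "{x. deriv \<phi> x \<noteq> 0} \<subseteq> {-R..R}"
    by (force simp: not_less[symmetric])
  then have "closure {x. deriv \<phi> x \<noteq> 0} \<subseteq> {-R..R}"
    by (intro closure_minimal) auto
  then have "compact (closure {x. deriv \<phi> x \<noteq> 0})"
    using compact_Icc[of "-R" R] compact_Int_closed[of "{-R..R}" "closure {x. deriv \<phi> x \<noteq> 0}"]
    by (simp add: Int_absorb1)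
  ultimately show ?thesis
    by (simp add: test_fun_def)
qed

lemma test_fun_measurable [measurable_dest]: "\<phi> \<in> test_fun \<Longrightarrow> \<phi> \<in> borel_measurable borel"
  using test_fun_isCont by (intro borel_measurable_continuous_onI continuous_at_imp_continuous_on) auto

lemma test_fun_bounded:
  assumes "\<phi> \<in> test_fun"
  obtains B where "\<And>x. \<bar>\<phi> x\<bar> \<le> B"
proof -
  obtain R where R: "R > 0" "\<And>x. R < \<bar>x\<bar> \<Longrightarrow> \<phi> x = 0"
    using test_fun_support[OF assms] by blast
  have "compact (\<phi> ` {-R..R})"
    using test_fun_isCont[OF assms]
    by (intro compact_continuous_image continuous_at_imp_continuous_on) auto
  then have "bounded (\<phi> ` {-R..R})"
    by (rule compact_imp_bounded)
  then obtain B where B: "B > 0" "\<And>x. x \<in> {-R..R} \<Longrightarrow> \<bar>\<phi> x\<bar> \<le> B"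
    unfolding bounded_pos by auto
  have "\<bar>\<phi> x\<bar> \<le> B" for x
    using B(2)[of x] R(2)[of x] B(1) by (cases "R < \<bar>x\<bar>") (auto simp: not_less abs_le_iff)
  then show thesis
    by (rule that)
qed

lemma L1_loc_measurable [measurable_dest]: "f \<in> L1_loc \<Longrightarrow> f \<in> borel_measurable borel"
  by (simp add: L1_loc_def)

lemma L1_loc_integrable: "f \<in> L1_loc \<Longrightarrow> integrable lborel (\<lambda>x. indicator {a..b} x * f x)"
  by (simp add: L1_loc_def set_integrable_def)

lemma L1_loc_integrable_Ioc:
  assumes "f \<in> L1_loc"
  shows "integrable lborel (\<lambda>x. indicator {a<..b} x * f x)"
proof (rule Bochner_Integration.integrable_bound[OF L1_loc_integrable[OF assms, of a b]])
  have [measurable]: "f \<in> borel_measurable borel"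
    using assms by (rule L1_loc_measurable)
  show "(\<lambda>x. indicator {a<..b} x * f x) \<in> borel_measurable lborel"
    by simp
qed (auto split: split_indicator)

lemma L1_loc_diff:
  assumes "f \<in> L1_loc" "g \<in> L1_loc"
  shows "(\<lambda>x. f x - g x) \<in> L1_loc"
proof -
  have "f \<in> borel_measurable borel" "g \<in> borel_measurable borel"
    using assms by (auto intro: L1_loc_measurable)
  then show ?thesis
    using Bochner_Integration.integrable_diff[OF L1_loc_integrable[OF assms(1)] L1_loc_integrable[OF assms(2)]]
    by (simp add: L1_loc_def set_integrable_def right_diff_distrib)
qed

lemma L2_imp_L1_loc:
  assumes f: "f \<in> L2"
  shows "f \<in> L1_loc"
proof -
  have [measurable]: "f \<in> borel_measurable borel"
    using f by (rule L2_measurable)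
  have "integrable lborel (\<lambda>x. indicator {a..b} x * f x)" for a b :: real
  proof (rule Bochner_Integration.integrable_bound)
    show "integrable lborel (\<lambda>x. indicator {a..b} x + (f x)\<^sup>2)"
      using L2_integrable_square[OF f]
      by (intro Bochner_Integration.integrable_add) (auto simp: integrable_indicator_iff emeasure_lborel_Icc_eq)
    have "\<bar>y\<bar> \<le> 1 + y\<^sup>2" for y :: real
      using sum_squares_bound[of 1 "\<bar>y\<bar>"] by simp
    then show "AE x in lborel. norm (indicator {a..b} x * f x) \<le> norm (indicator {a..b} x + (f x)\<^sup>2)"
      by (intro AE_I2) (auto split: split_indicator)
  qed simp
  then show ?thesis
    by (simp add: L1_loc_def set_integrable_def)
qed

lemma L1_loc_integrable_mult_test_fun:
  assumes f: "f \<in> L1_loc" and \<phi>: "\<phi> \<in> test_fun"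
  shows "integrable lborel (\<lambda>x. f x * \<phi> x)"
proof -
  have [measurable]: "f \<in> borel_measurable borel" "\<phi> \<in> borel_measurable borel"
    using f \<phi> by (auto intro: L1_loc_measurable test_fun_measurable)
  obtain R where R: "R > 0" "\<And>x. R < \<bar>x\<bar> \<Longrightarrow> \<phi> x = 0"
    using test_fun_support[OF \<phi>] by blast
  obtain B where B: "\<And>x. \<bar>\<phi> x\<bar> \<le> B"
    using test_fun_bounded[OF \<phi>] by blast
  show ?thesis
  proof (rule Bochner_Integration.integrable_bound)
    show "integrable lborel (\<lambda>x. B * (indicator {-R..R} x * f x))"
      using L1_loc_integrable[OF f] by simp
    have "\<bar>f x * \<phi> x\<bar> \<le> \<bar>B * (indicator {-R..R} x * f x)\<bar>" for x
    proof (cases "R < \<bar>x\<bar>")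
      case True
      then show ?thesis
        using R by simp
    next
      case False
      then have "x \<in> {-R..R}"
        by (auto simp: not_less abs_le_iff)
      then have "indicator {-R..R} x = (1::real)"
        by simp
      moreover have "\<bar>f x\<bar> * \<bar>\<phi> x\<bar> \<le> \<bar>f x\<bar> * \<bar>B\<bar>"
        using B[of x] by (intro mult_left_mono) auto
      ultimately show ?thesis
        by (simp add: abs_mult mult.commute)
    qed
    then show "AE x in lborel. norm (f x * \<phi> x) \<le> norm (B * (indicator {-R..R} x * f x))"
      by simp
  qed simp
qed

lemma has_weak_deriv_diff:
  assumes "has_weak_deriv f g" "has_weak_deriv f' g'"
  shows "has_weak_deriv (\<lambda>x. f x - f' x) (\<lambda>x. g x - g' x)"
  using assms unfolding has_weak_deriv_def
  by (simp add: L1_loc_diff left_diff_distrib L1_loc_integrable_mult_test_fun deriv_test_fun)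

lemma has_weak_deriv_weak_deriv: "has_weak_deriv f g \<Longrightarrow> has_weak_deriv f (weak_deriv f)"
  unfolding weak_deriv_def by (rule someI[of "has_weak_deriv f"])

subsection \<open>Approximating indicator functions of intervals by test functions\<close>

definition width :: "nat \<Rightarrow> real" where
  "width n = 1 / real (Suc n)"

lemma width_pos [simp]: "0 < width n"
  by (simp add: width_def)

lemma width_nonneg [simp]: "0 \<le> width n"
  by (simp add: width_def)

lemma width_le_1: "width n \<le> 1"
  by (simp add: width_def)

lemma width_tendsto: "width \<longlonglongrightarrow> 0"
  using LIMSEQ_inverse_real_of_nat by (simp add: width_def[abs_def] inverse_eq_divide)

abbreviation sharp_plateau :: "real \<Rightarrow> real \<Rightarrow> nat \<Rightarrow> real \<Rightarrow> real" where
  "sharp_plateau a b n \<equiv> plateau a (width n) b (width n)"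

lemma smooth_step_sharpen:
  "(\<lambda>n. smooth_step ((x - a) / width n)) \<longlonglongrightarrow> indicator {a<..} x"
proof (cases "a < x")
  case True
  then have "\<forall>\<^sub>F n in sequentially. width n < x - a"
    using order_tendstoD(2)[OF width_tendsto, of "x - a"] by simp
  then have "\<forall>\<^sub>F n in sequentially. smooth_step ((x - a) / width n) = indicator {a<..} x"
  proof eventually_elim
    case (elim n)
    then have "1 \<le> (x - a) / width n"
      by (simp add: le_divide_eq)
    then show ?case
      using True by (simp add: smooth_step_eq_1)
  qed
  then show ?thesis
    by (rule tendsto_eventually)
next
  case False
  then have "smooth_step ((x - a) / width n) = 0" for n
    by (intro smooth_step_eq_0) (simp add: divide_le_0_iff)
  with False show ?thesis
    by simp
qed

lemma sharp_plateau_tendsto: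
  assumes "a \<le> b"
  shows "(\<lambda>n. sharp_plateau a b n x) \<longlonglongrightarrow> indicator {a<..b} x"
proof -
  have "(\<lambda>n. sharp_plateau a b n x) \<longlonglongrightarrow> indicator {a<..} x - indicator {b<..} x"
    unfolding plateau_def by (intro tendsto_diff smooth_step_sharpen)
  moreover have "indicator {a<..} x - indicator {b<..} x = (indicator {a<..b} x :: real)"
    using assms by (auto split: split_indicator)
  ultimately show ?thesis
    by simp
qed

lemma plateau_abs_le_1: "\<bar>plateau a l b m x\<bar> \<le> 1"
  using smooth_step_nonneg[of "(x - a) / l"] smooth_step_le_1[of "(x - a) / l"]
    smooth_step_nonneg[of "(x - b) / m"] smooth_step_le_1[of "(x - b) / m"]
  by (simp add: plateau_def)

lemma tendsto_integral_sharp_plateau: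
  assumes g: "g \<in> L1_loc" and "a \<le> b"
  shows "(\<lambda>n. \<integral>x. g x * sharp_plateau a b n x \<partial>lborel) \<longlonglongrightarrow> (\<integral>x. indicator {a<..b} x * g x \<partial>lborel)"
proof (rule integral_dominated_convergence)
  have [measurable]: "g \<in> borel_measurable borel"
    using g by (rule L1_loc_measurable)
  show "(\<lambda>x. indicator {a<..b} x * g x) \<in> borel_measurable lborel"
    by simp
  fix n
  have [measurable]: "sharp_plateau a b n \<in> borel_measurable borel"
    using assms(2) by (intro test_fun_measurable plateau_test_fun) auto
  show "(\<lambda>x. g x * sharp_plateau a b n x) \<in> borel_measurable lborel"
    by simp
  show "AE x in lborel. norm (g x * sharp_plateau a b n x) \<le> \<bar>indicator {a..b + 1} x * g x\<bar>"
  proof (rule AE_I2)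
    fix x
    show "norm (g x * sharp_plateau a b n x) \<le> \<bar>indicator {a..b + 1} x * g x\<bar>"
    proof (cases "x \<in> {a..b + 1}")
      case True
      then show ?thesis
        using mult_left_mono[OF plateau_abs_le_1, of "\<bar>g x\<bar>" a _ b _ x] by (simp add: abs_mult)
    next
      case False
      moreover have "max (a + width n) (b + width n) \<le> b + 1"
        using assms(2) width_le_1[of n] by linarith
      ultimately have "x \<notin> {a..max (a + width n) (b + width n)}"
        by auto
      then have "sharp_plateau a b n x = 0"
        using assms(2) by (intro plateau_eq_0) auto
      then show ?thesis
        by simp
    qed
  qed
next
  show "integrable lborel (\<lambda>x. \<bar>indicator {a..b + 1} x * g x\<bar>)"
    using L1_loc_integrable[OF g] by (rule integrable_abs)
  show "AE x in lborel. (\<lambda>n. g x * sharp_plateau a b n x) \<longlonglongrightarrow> indicator {a<..b} x * g x"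
    using tendsto_mult_left[OF sharp_plateau_tendsto[OF assms(2)]] by (simp add: mult.commute)
qed

text \<open>
  Tested with plateaus that sharpen to the indicator function of an interval, the weak
  formulation becomes a statement about integrals over intervals.
\<close>

lemma weak_deriv_tendsto:
  assumes "has_weak_deriv f g" "a \<le> b"
  shows "(\<lambda>n. \<integral>x. f x * deriv (sharp_plateau a b n) x \<partial>lborel)
    \<longlonglongrightarrow> - (\<integral>x. indicator {a<..b} x * g x \<partial>lborel)"
proof -
  have "(\<integral>x. f x * deriv (sharp_plateau a b n) x \<partial>lborel)
      = - (\<integral>x. g x * sharp_plateau a b n x \<partial>lborel)" for n
    using assms plateau_test_fun[of "width n" "width n" a b]
    unfolding has_weak_deriv_def by simp
  moreover have "g \<in> L1_loc"
    using assms(1) by (simp add: has_weak_deriv_def)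
  ultimately show ?thesis
    using tendsto_minus[OF tendsto_integral_sharp_plateau[OF _ assms(2)]] by simp
qed

text \<open>
  Half-open intervals generate the Borel sets and are stable under intersection, so \<open>h\<close>
  integrates to \<open>0\<close> over every bounded Borel set.
\<close>

lemma AE_eq_0_if_interval_integrals_eq_0:
  fixes h :: "real \<Rightarrow> real"
  assumes h: "\<And>a b. integrable lborel (\<lambda>x. indicator {a<..b} x * h x)"
    and zero: "\<And>a b. a \<le> b \<Longrightarrow> (\<integral>x. indicator {a<..b} x * h x \<partial>lborel) = 0"
  shows "AE x in lborel. h x = 0"
proof -
  have "AE x in lborel. indicator {- real R<..real R} x * h x = 0" for R :: nat
  proof -
    let ?h = "\<lambda>x. indicator {- real R<..real R} x * h x"
    have set_int: "set_integrable lborel A ?h" if "A \<in> sets borel" for A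
      using integrable_mult_indicator[of A lborel ?h] h[of "- real R" "real R"] that
      by (simp add: set_integrable_def)
    have "(\<integral>x\<in>A. ?h x \<partial>lborel) = 0" if "A \<in> sets borel" for A
    proof -
      let ?G = "range (\<lambda>(a, b). {a<..b::real})"
      have "Int_stable ?G"
        by (auto simp: Int_stable_def)
      moreover have "?G \<subseteq> Pow UNIV"
        by simp
      moreover have "A \<in> sigma_sets UNIV ?G"
        using that unfolding borel_sigma_sets_Ioc by simp
      ultimately show ?thesis
      proof (induction rule: sigma_sets_induct_disjoint)
        case (basic B)
        then obtain a b where B: "B = {a<..b}"
          by auto
        have "(\<integral>x\<in>B. ?h x \<partial>lborel) = (\<integral>x. indicator {max a (- real R)<..min b (real R)} x * h x \<partial>lborel)"
          unfolding set_lebesgue_integral_def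
          by (intro Bochner_Integration.integral_cong) (auto simp: B split: split_indicator)
        moreover have "(\<integral>x. indicator {c<..d} x * h x \<partial>lborel) = 0" for c d
          using zero[of c d] by (cases "c \<le> d") auto
        ultimately show ?case
          by simp
      next
        case empty
        then show ?case
          by (simp add: set_lebesgue_integral_def)
      next
        case (compl B)
        then have B: "B \<in> sets borel"
          unfolding borel_sigma_sets_Ioc by simp
        have "(\<integral>x\<in>UNIV - B. ?h x \<partial>lborel) = (\<integral>x. ?h x - indicator B x *\<^sub>R ?h x \<partial>lborel)"
          unfolding set_lebesgue_integral_def
          by (intro Bochner_Integration.integral_cong) (auto split: split_indicator)
        also have "\<dots> = (\<integral>x. ?h x \<partial>lborel) - (\<integral>x\<in>B. ?h x \<partial>lborel)"
          using set_int[OF B] h[of "- real R" "real R"]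
          by (simp add: set_integrable_def set_lebesgue_integral_def)
        finally show ?case
          using compl.IH zero[of "- real R" "real R"] by simp
      next
        case (union B)
        then have B: "\<And>i. B i \<in> sets borel"
          unfolding borel_sigma_sets_Ioc by (auto simp: subset_eq)
        then have "(\<integral>x\<in>(\<Union>i. B i). ?h x \<partial>lborel) = (\<Sum>i. \<integral>x\<in>B i. ?h x \<partial>lborel)"
          using union.hyps(1)
          by (intro lebesgue_integral_countable_add set_int) (auto simp: disjoint_family_on_def)
        then show ?case
          using union.IH by simp
      qed
    qed
    then show ?thesis
      using density_unique_real[OF h[of "- real R" "real R"] integrable_zero] by simp
  qed
  then have "AE x in lborel. \<forall>R. indicator {- real R<..real R} x * h x = 0"
    by (subst AE_all_countable) blast
  then show ?thesis
  proof eventually_elim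
    case (elim x)
    obtain R where "\<bar>x\<bar> < real R"
      using reals_Archimedean2 by blast
    then have "x \<in> {- real R<..real R}"
      by auto
    then show ?case
      using elim[rule_format, of R] by simp
  qed
qed

lemma has_weak_deriv_unique:
  assumes "has_weak_deriv f g1" "has_weak_deriv f g2"
  shows "AE x in lborel. g1 x = g2 x"
proof -
  have L1: "g1 \<in> L1_loc" "g2 \<in> L1_loc"
    using assms by (auto simp: has_weak_deriv_def)
  have "AE x in lborel. g1 x - g2 x = 0"
  proof (rule AE_eq_0_if_interval_integrals_eq_0)
    fix a b :: real
    show "integrable lborel (\<lambda>x. indicator {a<..b} x * (g1 x - g2 x))"
      by (intro L1_loc_integrable_Ioc L1_loc_diff L1)
    assume "a \<le> b"
    from LIMSEQ_unique[OF weak_deriv_tendsto[OF assms(1) this] weak_deriv_tendsto[OF assms(2) this]]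
    show "(\<integral>x. indicator {a<..b} x * (g1 x - g2 x) \<partial>lborel) = 0"
      using L1_loc_integrable_Ioc[OF L1(1), of a b] L1_loc_integrable_Ioc[OF L1(2), of a b]
      by (simp add: right_diff_distrib)
  qed
  then show ?thesis
    by simp
qed

lemma weak_deriv_AE_eq: "has_weak_deriv f g \<Longrightarrow> AE x in lborel. weak_deriv f x = g x"
  using has_weak_deriv_unique has_weak_deriv_weak_deriv by blast

text \<open>
  The derivative of a sharp step at \<open>a\<close> is an approximate unit at \<open>a\<close>, so for a continuous function
  the weak formulation turns into the fundamental theorem of calculus.
\<close>

lemma tendsto_integral_sharp_bump:
  assumes f: "continuous_on UNIV f"
  shows "(\<lambda>n. \<integral>x. f x * (bump ((x - a) / width n) / width n) \<partial>lborel) \<longlonglongrightarrow> f a"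
proof -
  have [measurable]: "f \<in> borel_measurable borel"
    using f by (rule borel_measurable_continuous_onI)
  have eq: "(\<integral>x. f x * (bump ((x - a) / width n) / width n) \<partial>lborel)
      = (\<integral>z. f (a + width n * z) * bump z \<partial>lborel)" for n
  proof -
    have "(\<integral>x. f x * (bump ((x - a) / width n) / width n) \<partial>lborel)
        = width n * (\<integral>z. f (a + width n * z) * (bump z / width n) \<partial>lborel)"
      by (subst lborel_integral_real_affine[of "width n" _ a]) (simp_all add: less_imp_neq[OF width_pos, symmetric])
    also have "\<dots> = (\<integral>z. width n * (f (a + width n * z) * (bump z / width n)) \<partial>lborel)"
      by (rule integral_mult_right_zero[symmetric])
    finally show ?thesis
      by (simp add: less_imp_neq[OF width_pos, symmetric])
  qed
  have "compact (f ` {a..a + 1})"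
    using continuous_on_subset[OF f] by (intro compact_continuous_image) auto
  then have "bounded (f ` {a..a + 1})"
    by (rule compact_imp_bounded)
  then obtain C where C: "\<And>x. x \<in> {a..a + 1} \<Longrightarrow> \<bar>f x\<bar> \<le> C"
    unfolding bounded_iff by (metis image_eqI real_norm_def)
  have "(\<lambda>n. \<integral>z. f (a + width n * z) * bump z \<partial>lborel) \<longlonglongrightarrow> (\<integral>z. f a * bump z \<partial>lborel)"
  proof (rule integral_dominated_convergence)
    show "integrable lborel (\<lambda>z. C * bump z)"
      using bump_integrable by simp
    show "AE z in lborel. norm (f (a + width n * z) * bump z) \<le> C * bump z" for n
    proof (rule AE_I2)
      fix z
      show "norm (f (a + width n * z) * bump z) \<le> C * bump z"
      proof (cases "0 \<le> z \<and> z \<le> 1")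
        case True
        then have "width n * z \<le> 1 * 1"
          using width_le_1[of n] by (intro mult_mono) auto
        then have "a + width n * z \<in> {a..a + 1}"
          using True by simp
        from C[OF this] show ?thesis
          using bump_nonneg[of z] by (simp add: abs_mult mult_right_mono)
      next
        case False
        then have "bump z = 0"
          by (intro bump_eq_0) auto
        then show ?thesis
          by simp
      qed
    qed
    show "AE z in lborel. (\<lambda>n. f (a + width n * z) * bump z) \<longlonglongrightarrow> f a * bump z"
    proof (intro AE_I2 tendsto_mult_right)
      fix z
      have "(\<lambda>n. a + width n * z) \<longlonglongrightarrow> a + 0 * z"
        by (intro tendsto_add tendsto_const tendsto_mult_right width_tendsto)
      then have "(\<lambda>n. a + width n * z) \<longlonglongrightarrow> a"
        by simp
      then show "(\<lambda>n. f (a + width n * z)) \<longlonglongrightarrow> f a"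
        using f by (intro isCont_tendsto_compose[of a f]) (auto simp: continuous_on_eq_continuous_at)
    qed
  qed simp_all
  then show ?thesis
    unfolding eq by (simp add: bump_integral_1)
qed

lemma has_weak_deriv_continuous_FTC:
  assumes wd: "has_weak_deriv f g" and f: "continuous_on UNIV f" and "a \<le> b"
  shows "f b - f a = (\<integral>x. indicator {a<..b} x * g x \<partial>lborel)"
proof -
  have int: "integrable lborel (\<lambda>x. f x * (bump ((x - c) / width n) / width n))" for c n
  proof (rule L1_loc_integrable_mult_test_fun)
    show "f \<in> L1_loc"
      using wd by (simp add: has_weak_deriv_def)
    have eq: "bump ((x - c) / width n) / width n = 1 / width n * bump (1 / width n * x + - c / width n)" for x
      by (simp add: diff_divide_distrib)
    have "(\<lambda>x. bump ((x - c) / width n) / width n) \<in> flat_algebra"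
      unfolding eq by (intro flat_algebra.cmult flat_algebra.affine bump_flat_algebra)
    from flat_algebra_derivative[OF this] obtain g where "g \<in> flat_algebra"
      "\<And>x. ((\<lambda>x. bump ((x - c) / width n) / width n) has_real_derivative g x) (at x)"
      by blast
    moreover have "bump ((x - c) / width n) / width n = 0" if "x \<notin> {c..c + 1}" for x
    proof -
      have "x - c \<le> 0 \<or> width n \<le> x - c"
        using that width_le_1[of n] by auto
      then have "(x - c) / width n \<le> 0 \<or> 1 \<le> (x - c) / width n"
        by (simp add: divide_le_0_iff le_divide_eq)
      then have "bump ((x - c) / width n) = 0"
        by (rule bump_eq_0)
      then show ?thesis
        by simp
    qed
    ultimately show "(\<lambda>x. bump ((x - c) / width n) / width n) \<in> test_fun"
      by (intro test_funI)
  qed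
  have "(\<integral>x. f x * deriv (sharp_plateau a b n) x \<partial>lborel)
      = (\<integral>x. f x * (bump ((x - a) / width n) / width n) \<partial>lborel)
        - (\<integral>x. f x * (bump ((x - b) / width n) / width n) \<partial>lborel)" for n
    unfolding deriv_plateau plateau_deriv_def right_diff_distrib
    by (rule Bochner_Integration.integral_diff[OF int int])
  moreover have "(\<lambda>n. (\<integral>x. f x * (bump ((x - a) / width n) / width n) \<partial>lborel)
        - (\<integral>x. f x * (bump ((x - b) / width n) / width n) \<partial>lborel)) \<longlonglongrightarrow> f a - f b"
    by (intro tendsto_diff tendsto_integral_sharp_bump f)
  ultimately have "f a - f b = - (\<integral>x. indicator {a<..b} x * g x \<partial>lborel)"
    using LIMSEQ_unique[OF _ weak_deriv_tendsto[OF wd \<open>a \<le> b\<close>]] by simp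
  then show ?thesis
    by simp
qed

section \<open>Strong derivatives in the mean\<close>

text \<open>
  This describes the continuous representatives of \<open>H\<^sup>1\<close> functions. The fundamental theorem of
  calculus, rather than the weak formulation, is the form that passes to difference quotients.
\<close>

definition has_L2_deriv :: "(real \<Rightarrow> real) \<Rightarrow> (real \<Rightarrow> real) \<Rightarrow> bool" where
  "has_L2_deriv f g \<longleftrightarrow> f \<in> L2 \<and> g \<in> L2 \<and>
     (\<forall>a b. a \<le> b \<longrightarrow> f b - f a = (\<integral>x. indicator {a<..b} x * g x \<partial>lborel))"

lemma has_L2_derivD: "has_L2_deriv f g \<Longrightarrow> f \<in> L2" "has_L2_deriv f g \<Longrightarrow> g \<in> L2"
  by (auto simp: has_L2_deriv_def)

lemma has_L2_deriv_if_weak_deriv: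
  assumes "has_weak_deriv f g" "continuous_on UNIV f" "f \<in> L2" "g \<in> L2"
  shows "has_L2_deriv f g"
  using assms has_weak_deriv_continuous_FTC by (simp add: has_L2_deriv_def)

lemma has_L2_deriv_shift:
  assumes "has_L2_deriv f g"
  shows "has_L2_deriv (\<lambda>x. f (x + r)) (\<lambda>x. g (x + r))"
  unfolding has_L2_deriv_def
proof (intro conjI allI impI)
  fix a b :: real assume "a \<le> b"
  then have "f (b + r) - f (a + r) = (\<integral>x. indicator {a + r<..b + r} x * g x \<partial>lborel)"
    using assms by (simp add: has_L2_deriv_def)
  also have "\<dots> = (\<integral>x. indicator {a + r<..b + r} (x + r) * g (x + r) \<partial>lborel)"
    by (rule integral_shift[symmetric])
  also have "\<dots> = (\<integral>x. indicator {a<..b} x * g (x + r) \<partial>lborel)"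
    by (intro Bochner_Integration.integral_cong) (auto split: split_indicator)
  finally show "f (b + r) - f (a + r) = (\<integral>x. indicator {a<..b} x * g (x + r) \<partial>lborel)" .
qed (use assms in \<open>auto simp: has_L2_deriv_def L2_shift\<close>)

text \<open>
  The parametrisation by \<open>s \<in> [0, 1]\<close> gives one formula for increments of both signs, although
  the two signs lead to intervals that are open at different ends.
\<close>

lemma diff_quotient_eq_average:
  assumes fg: "has_L2_deriv f g" and h: "h \<noteq> 0"
  shows "(f (x + h) - f x) / h = (\<integral>s. indicator {0..1} s * g (x + h * s) \<partial>lborel)"
proof -
  have [measurable]: "g \<in> borel_measurable borel"
    using fg by (auto dest: has_L2_derivD L2_measurable)
  have subst: "(\<integral>y. indicator {a<..b} y * g y \<partial>lborel) = \<bar>h\<bar> * (\<integral>s. indicator {0..1} s * g (x + h * s) \<partial>lborel)"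
    if "{a<..b} = {x<..x + h} \<or> {a<..b} = {x + h<..x}" "{x, x + h} = {a, b}" "a < b" for a b
  proof -
    \<comment> \<open>Which end point belongs to the interval depends on the sign of \<open>h\<close>, but end points are null sets.\<close>
    have ind: "indicator {a<..b} (x + h * s) = (indicator {0..1} s :: real)" if "s \<noteq> 0" "s \<noteq> 1" for s
    proof (cases "h > 0")
      case True
      then have "a = x" "b = x + h"
        using \<open>{x, x + h} = {a, b}\<close> \<open>a < b\<close> by (auto simp: doubleton_eq_iff)
      then show ?thesis
        using that True by (auto simp: zero_le_mult_iff zero_less_mult_iff split: split_indicator)
    next
      case False
      then have "h < 0"
        using h by simp
      then have "a = x + h" "b = x"
        using \<open>{x, x + h} = {a, b}\<close> \<open>a < b\<close> by (auto simp: doubleton_eq_iff)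
      then show ?thesis
        using that \<open>h < 0\<close> by (auto simp: mult_le_0_iff split: split_indicator)
    qed
    have "(\<integral>y. indicator {a<..b} y * g y \<partial>lborel) = \<bar>h\<bar> * (\<integral>s. indicator {a<..b} (x + h * s) * g (x + h * s) \<partial>lborel)"
      by (subst lborel_integral_real_affine[OF h, of _ x]) simp
    also have "(\<integral>s. indicator {a<..b} (x + h * s) * g (x + h * s) \<partial>lborel) = (\<integral>s. indicator {0..1} s * g (x + h * s) \<partial>lborel)"
    proof (rule integral_cong_AE)
      show "AE s in lborel. indicator {a<..b} (x + h * s) * g (x + h * s) = indicator {0..1} s * g (x + h * s)"
        using AE_lborel_singleton[of 0] AE_lborel_singleton[of 1] by eventually_elim (simp add: ind)
    qed simp_all
    finally show ?thesis .
  qed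
  show ?thesis
  proof (cases "h > 0")
    case True
    then have "f (x + h) - f x = (\<integral>y. indicator {x<..x + h} y * g y \<partial>lborel)"
      using fg by (simp add: has_L2_deriv_def)
    then show ?thesis
      using subst[of x "x + h"] True by simp
  next
    case False
    then have "h < 0"
      using h by simp
    then have "f x - f (x + h) = (\<integral>y. indicator {x + h<..x} y * g y \<partial>lborel)"
      using fg by (simp add: has_L2_deriv_def)
    also have "\<dots> = - h * (\<integral>s. indicator {0..1} s * g (x + h * s) \<partial>lborel)"
      using subst[of "x + h" x] \<open>h < 0\<close> by (simp add: insert_commute)
    finally show ?thesis
      using \<open>h < 0\<close> by (simp add: field_simps)
  qed
qed

lemma L2_diff_quotient:
  assumes "has_L2_deriv f g"
  shows "(\<lambda>x. (f (x + h) - f x) / h) \<in> L2"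
  using has_L2_derivD(1)[OF assms] by (intro L2_cdiv L2_diff) (auto intro: L2_shift)

text \<open>
  A difference quotient averages translates of the derivative, and by Jensen's inequality and
  Fubini's theorem the \<open>L\<^sup>2\<close> distance of an average is at most the largest distance. The factor \<open>c\<close>
  is \<open>1\<close> for convergence and \<open>0\<close> for the bound on the norm.
\<close>

lemma diff_quotient_L2_le:
  assumes fg: "has_L2_deriv f g" and h: "h \<noteq> 0"
    and le: "\<And>r. \<bar>r\<bar> \<le> \<bar>h\<bar> \<Longrightarrow> (\<integral>x. (g (x + r) - c * g x)\<^sup>2 \<partial>lborel) \<le> e"
  shows "(\<integral>x. ((f (x + h) - f x) / h - c * g x)\<^sup>2 \<partial>lborel) \<le> e"
proof -
  have g: "g \<in> L2"
    using fg by (rule has_L2_derivD)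
  have [measurable]: "g \<in> borel_measurable borel"
    using g by (rule L2_measurable)
  have ind: "indicator {0..1} \<in> L2"
    by (rule L2I) (auto simp: indicator_def power2_eq_square
        intro!: Bochner_Integration.integrable_cong[THEN iffD1, OF refl _ integrable_real_indicator[of "{0..1::real}" lborel]])
  have e: "0 \<le> e"
  proof -
    have "0 \<le> (\<integral>x. (g (x + 0) - c * g x)\<^sup>2 \<partial>lborel)"
      by simp
    also have "\<dots> \<le> e"
      by (rule le) simp
    finally show ?thesis .
  qed
  define k where "k x s = g (x + h * s) - c * g x" for x s
  have [measurable]: "(\<lambda>(x, s). k x s) \<in> borel_measurable (borel \<Otimes>\<^sub>M borel)"
    unfolding k_def by measurable
  have pointwise: "ennreal (((f (x + h) - f x) / h - c * g x)\<^sup>2) \<le> (\<integral>\<^sup>+s. ennreal (indicator {0..1} s * (k x s)\<^sup>2) \<partial>lborel)" for x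
  proof -
    have "(\<lambda>s. g (x + h * s)) \<in> L2"
      using lborel_integrable_real_affine[OF L2_integrable_square[OF g] h, of x] by (intro L2I) auto
    then have "(\<lambda>s. indicator {0..1} s * g (x + h * s)) \<in> L2"
      by (rule L2_bounded_mult[where B = 1]) (auto split: split_indicator)
    then have "(\<lambda>s. indicator {0..1} s * g (x + h * s) - c * g x * indicator {0..1} s) \<in> L2"
      by (intro L2_diff L2_cmult ind)
    then have K: "(\<lambda>s. indicator {0..1} s * k x s) \<in> L2"
      by (simp add: k_def algebra_simps)
    have int: "integrable lborel (\<lambda>s. indicator {0..1} s * g (x + h * s))"
      using L2_integrable_mult[OF ind \<open>(\<lambda>s. g (x + h * s)) \<in> L2\<close>] .
    have intc: "integrable lborel (\<lambda>s. indicator {0..1::real} s * (c * g x))"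
      by (intro integrable_mult_left integrable_real_indicator) auto
    have "(f (x + h) - f x) / h - c * g x
        = (\<integral>s. indicator {0..1} s * g (x + h * s) \<partial>lborel) - (\<integral>s. indicator {0..1::real} s * (c * g x) \<partial>lborel)"
      by (simp add: diff_quotient_eq_average[OF fg h] content_real)
    also have "\<dots> = (\<integral>s. indicator {0..1} s * (indicator {0..1} s * k x s) \<partial>lborel)"
      by (subst Bochner_Integration.integral_diff[OF int intc, symmetric])
         (auto simp: k_def intro!: Bochner_Integration.integral_cong split: split_indicator)
    finally have eq: "(f (x + h) - f x) / h - c * g x = (\<integral>s. indicator {0..1} s * (indicator {0..1} s * k x s) \<partial>lborel)" .
    have "L2_norm (indicator {0..1}) = 1"
    proof -
      have "(indicator {0..1} s :: real)\<^sup>2 = indicator {0..1} s" for s :: real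
        by (auto split: split_indicator)
      then show ?thesis
        by (simp add: L2_norm_def)
    qed
    then have "\<bar>(f (x + h) - f x) / h - c * g x\<bar> \<le> L2_norm (\<lambda>s. indicator {0..1} s * k x s)"
      unfolding eq using order_trans[OF integral_abs_bound L2_Cauchy_Schwarz_abs[OF ind K]] by simp
    from power_mono[OF this, of 2]
    have "((f (x + h) - f x) / h - c * g x)\<^sup>2 \<le> (L2_norm (\<lambda>s. indicator {0..1} s * k x s))\<^sup>2"
      by simp
    also have "\<dots> = (\<integral>s. indicator {0..1} s * (k x s)\<^sup>2 \<partial>lborel)"
      unfolding L2_norm_square
      by (intro Bochner_Integration.integral_cong) (auto split: split_indicator)
    finally have "ennreal (((f (x + h) - f x) / h - c * g x)\<^sup>2) \<le> ennreal (\<integral>s. indicator {0..1} s * (k x s)\<^sup>2 \<partial>lborel)"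
      by (rule ennreal_leI)
    also have "\<dots> = (\<integral>\<^sup>+s. ennreal (indicator {0..1} s * (k x s)\<^sup>2) \<partial>lborel)"
    proof (rule nn_integral_eq_integral[symmetric])
      have "(indicator {0..1} s * k x s)\<^sup>2 = indicator {0..1} s * (k x s)\<^sup>2" for s
        by (auto split: split_indicator)
      then show "integrable lborel (\<lambda>s. indicator {0..1} s * (k x s)\<^sup>2)"
        using L2_integrable_square[OF K] by simp
    qed simp
    finally show ?thesis .
  qed
  have inner: "(\<integral>\<^sup>+x. ennreal (indicator {0..1} s * (k x s)\<^sup>2) \<partial>lborel) \<le> ennreal e * indicator {0..1} s" for s
  proof (cases "s \<in> {0..1}")
    case True
    then have "\<bar>h * s\<bar> \<le> \<bar>h\<bar>"
      by (simp add: abs_mult mult_left_le)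
    have "integrable lborel (\<lambda>x. (g (x + h * s) - c * g x)\<^sup>2)"
      by (rule L2_integrable_square[OF L2_diff[OF L2_shift[OF g] L2_cmult[OF g]]])
    then have "(\<integral>\<^sup>+x. ennreal ((k x s)\<^sup>2) \<partial>lborel) = ennreal (\<integral>x. (k x s)\<^sup>2 \<partial>lborel)"
      unfolding k_def by (rule nn_integral_eq_integral) simp
    also have "\<dots> \<le> ennreal e"
      unfolding k_def by (intro ennreal_leI le) fact
    finally show ?thesis
      using True by simp
  qed simp
  have "(\<integral>\<^sup>+x. ennreal (((f (x + h) - f x) / h - c * g x)\<^sup>2) \<partial>lborel)
      \<le> (\<integral>\<^sup>+x. (\<integral>\<^sup>+s. ennreal (indicator {0..1} s * (k x s)\<^sup>2) \<partial>lborel) \<partial>lborel)"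
    by (intro nn_integral_mono pointwise)
  also have "\<dots> = (\<integral>\<^sup>+s. (\<integral>\<^sup>+x. ennreal (indicator {0..1} s * (k x s)\<^sup>2) \<partial>lborel) \<partial>lborel)"
    by (rule lborel_pair.Fubini') measurable
  also have "\<dots> \<le> (\<integral>\<^sup>+s. ennreal e * indicator {0..1::real} s \<partial>lborel)"
    by (intro nn_integral_mono inner)
  also have "\<dots> = ennreal e"
    by (simp add: nn_integral_cmult_indicator)
  finally have le_e: "(\<integral>\<^sup>+x. ennreal (((f (x + h) - f x) / h - c * g x)\<^sup>2) \<partial>lborel) \<le> ennreal e" .
  have "integrable lborel (\<lambda>x. ((f (x + h) - f x) / h - c * g x)\<^sup>2)"
    by (intro L2_integrable_square L2_diff L2_diff_quotient[OF fg] L2_cmult g)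
  from nn_integral_eq_integral[OF this] le_e e show ?thesis
    by simp
qed

lemma diff_quotient_L2_norm_le:
  assumes fg: "has_L2_deriv f g" and h: "h \<noteq> 0"
  shows "(\<integral>x. ((f (x + h) - f x) / h)\<^sup>2 \<partial>lborel) \<le> (\<integral>x. (g x)\<^sup>2 \<partial>lborel)"
  using diff_quotient_L2_le[OF fg h, of 0] by (simp add: integral_shift[of "\<lambda>x. (g x)\<^sup>2"])

lemma tendsto_L2_diff_quotient:
  assumes fg: "has_L2_deriv f g"
  shows "tendsto_L2 (\<lambda>h x. (f (x + h) - f x) / h) g (at 0)"
  unfolding tendsto_L2_def
proof (intro conjI)
  have g: "g \<in> L2"
    using fg by (rule has_L2_derivD)
  show "\<forall>\<^sub>F h in at 0. (\<lambda>x. (f (x + h) - f x) / h) \<in> L2"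
    using L2_diff_quotient[OF fg] by simp
  show "g \<in> L2" by fact
  show "((\<lambda>h. L2_norm (\<lambda>x. (f (x + h) - f x) / h - g x)) \<longlongrightarrow> 0) (at 0)"
  proof (rule tendstoI)
    fix e :: real assume "0 < e"
    have "((\<lambda>r. L2_norm (\<lambda>x. g (x + r) - g x)) \<longlongrightarrow> 0) (at 0)"
      using tendsto_L2_translation[OF g] by (simp add: tendsto_L2_def)
    from tendstoD[OF this, of "e / 2"] \<open>0 < e\<close>
    obtain d where d: "d > 0" "\<And>r. r \<noteq> 0 \<Longrightarrow> \<bar>r\<bar> < d \<Longrightarrow> L2_norm (\<lambda>x. g (x + r) - g x) < e / 2"
      by (auto simp: eventually_at dist_norm)
    have small: "L2_norm (\<lambda>x. (f (x + h) - f x) / h - g x) < e" if h: "h \<noteq> 0" "\<bar>h\<bar> < d" for h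
    proof -
      have "(\<integral>x. (g (x + r) - 1 * g x)\<^sup>2 \<partial>lborel) \<le> (e / 2)\<^sup>2" if "\<bar>r\<bar> \<le> \<bar>h\<bar>" for r
      proof (cases "r = 0")
        case False
        then have "(L2_norm (\<lambda>x. g (x + r) - g x))\<^sup>2 \<le> (e / 2)\<^sup>2"
          using d(2)[of r] h that by (intro power_mono) auto
        then show ?thesis
          by (simp add: L2_norm_square)
      qed simp
      from diff_quotient_L2_le[OF fg h(1) this]
      have "(L2_norm (\<lambda>x. (f (x + h) - f x) / h - g x))\<^sup>2 \<le> (e / 2)\<^sup>2"
        by (simp add: L2_norm_square)
      then have "L2_norm (\<lambda>x. (f (x + h) - f x) / h - g x) \<le> e / 2"
        by (rule power2_le_imp_le) (use \<open>0 < e\<close> in simp)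
      then show ?thesis
        using \<open>0 < e\<close> by simp
    qed
    show "\<forall>\<^sub>F h in at 0. dist (L2_norm (\<lambda>x. (f (x + h) - f x) / h - g x)) 0 < e"
      unfolding eventually_at
      by (rule exI[of _ d]) (use d(1) small in \<open>auto simp: dist_norm\<close>)
  qed
qed

lemma tendsto_L2_backward_diff_quotient:
  assumes fg: "has_L2_deriv f g"
  shows "tendsto_L2 (\<lambda>h x. (f (x - h) - f x) / h) (\<lambda>x. - g x) (at 0)"
proof -
  have "(uminus \<longlongrightarrow> - (0::real)) (at 0)"
    by (intro tendsto_minus tendsto_ident_at)
  then have neg: "filterlim uminus (at (0::real)) (at 0)"
    by (auto simp: filterlim_at eventually_at_filter)
  have "((\<lambda>h. L2_norm (\<lambda>x. (f (x + h) - f x) / h - g x)) \<longlongrightarrow> 0) (at 0)"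
    using tendsto_L2_diff_quotient[OF fg] unfolding tendsto_L2_def by blast
  from filterlim_compose[OF this neg]
  have "((\<lambda>h. L2_norm (\<lambda>x. (f (x + (- h)) - f x) / (- h) - g x)) \<longlongrightarrow> 0) (at 0)" .
  then have lim: "tendsto_L2 (\<lambda>h x. (f (x + (- h)) - f x) / (- h)) g (at 0)"
    unfolding tendsto_L2_def
    using L2_diff_quotient[OF fg] has_L2_derivD(2)[OF fg] by (intro conjI always_eventually allI)
  have "- 1 * ((f (x + (- h)) - f x) / (- h)) = (f (x - h) - f x) / h" for x h
    by (cases "h = 0") (simp_all add: field_simps)
  with tendsto_L2_cmult[OF lim, of "-1"] show ?thesis
    by (simp only: mult_minus1[of "g _"])
qed

lemma integral_diff_mult:
  fixes p q :: "real \<Rightarrow> real"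
  assumes "integrable lborel (\<lambda>x. p (x + h) * q x)" "integrable lborel (\<lambda>x. p x * q x)"
  shows "(\<integral>x. (p (x + h) - p x) * q x \<partial>lborel) = (\<integral>x. p x * (q (x - h) - q x) \<partial>lborel)"
proof -
  have "integrable lborel (\<lambda>x. p x * q (x - h))"
    using integrable_shift[OF assms(1), of "- h"] by simp
  moreover have "(\<integral>x. p (x + h) * q x \<partial>lborel) = (\<integral>x. p x * q (x - h) \<partial>lborel)"
    using integral_shift[of "\<lambda>x. p (x + h) * q x" "- h"] by simp
  ultimately show ?thesis
    using assms by (simp add: left_diff_distrib right_diff_distrib)
qed

text \<open>
  The limit of the preceding identity, which is integration by parts for difference quotients.
\<close>

lemma L2_integral_by_parts:
  assumes f: "has_L2_deriv f f'" and g: "has_L2_deriv g g'"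
  shows "(\<integral>x. f x * g' x \<partial>lborel) = - (\<integral>x. f' x * g x \<partial>lborel)"
proof -
  note L2 = has_L2_derivD[OF f] has_L2_derivD[OF g]
  have 1: "((\<lambda>h. \<integral>x. 1 * ((f (x + h) - f x) / h * g x) \<partial>lborel) \<longlongrightarrow> (\<integral>x. 1 * (f' x * g x) \<partial>lborel)) (at 0)"
    by (rule tendsto_L2_integral[OF tendsto_L2_diff_quotient[OF f] tendsto_L2_const[OF L2(3)], of _ 1]) auto
  have 2: "((\<lambda>h. \<integral>x. 1 * (f x * ((g (x - h) - g x) / h)) \<partial>lborel) \<longlongrightarrow> (\<integral>x. 1 * (f x * - g' x) \<partial>lborel)) (at 0)"
    by (rule tendsto_L2_integral[OF tendsto_L2_const[OF L2(1)] tendsto_L2_backward_diff_quotient[OF g], of _ 1]) auto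
  have eq: "(\<integral>x. 1 * ((f (x + h) - f x) / h * g x) \<partial>lborel) = (\<integral>x. 1 * (f x * ((g (x - h) - g x) / h)) \<partial>lborel)" for h
    using integral_diff_mult[OF L2_integrable_mult[OF L2_shift[OF L2(1), of h] L2(3)] L2_integrable_mult[OF L2(1,3)]]
    by simp
  from LIM_unique[OF 1[unfolded eq] 2] show ?thesis
    by simp
qed

text \<open>
  This is \<open>\<integral> (f\<^sup>2 g)' = 0\<close>, again as a limit of discrete integration by parts. The difference
  quotient of \<open>f\<^sup>2\<close> is the product of \<open>f(x + h) + f(x)\<close> and the difference quotient of \<open>f\<close>, both of
  which converge in \<open>L\<^sup>2\<close>.
\<close>

lemma integral_deriv_square_mult:
  assumes f: "has_L2_deriv f f'" and g: "has_L2_deriv g g'"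
    and bdd: "\<And>x. \<bar>f x\<bar> \<le> B" "\<And>x. \<bar>g x\<bar> \<le> C"
  shows "(\<integral>x. f x * f x * g' x \<partial>lborel) = - 2 * (\<integral>x. f x * f' x * g x \<partial>lborel)"
proof -
  note L2 = has_L2_derivD[OF f] has_L2_derivD[OF g]
  have meas: "f \<in> borel_measurable borel" "g \<in> borel_measurable borel"
    using L2 by (auto intro: L2_measurable)
  have "tendsto_L2 (\<lambda>h x. f (x + h) + f x) (\<lambda>x. f x + f x) (at 0)"
    by (rule tendsto_L2_add[OF tendsto_L2_translation[OF L2(1)] tendsto_L2_const[OF L2(1)]])
  from tendsto_L2_integral[OF this tendsto_L2_diff_quotient[OF f] meas(2) bdd(2)]
  have 1: "((\<lambda>h. \<integral>x. g x * ((f (x + h) + f x) * ((f (x + h) - f x) / h)) \<partial>lborel)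
      \<longlongrightarrow> (\<integral>x. g x * ((f x + f x) * f' x) \<partial>lborel)) (at 0)" .
  from tendsto_L2_integral[OF tendsto_L2_const[OF L2(1)] tendsto_L2_backward_diff_quotient[OF g] meas(1) bdd(1)]
  have 2: "((\<lambda>h. \<integral>x. f x * (f x * ((g (x - h) - g x) / h)) \<partial>lborel)
      \<longlongrightarrow> (\<integral>x. f x * (f x * - g' x) \<partial>lborel)) (at 0)" .
  have eq: "(\<integral>x. g x * ((f (x + h) + f x) * ((f (x + h) - f x) / h)) \<partial>lborel)
      = (\<integral>x. f x * (f x * ((g (x - h) - g x) / h)) \<partial>lborel)" for h
  proof -
    have int: "integrable lborel (\<lambda>x. (f (x + h) * f (x + h)) * g x)" "integrable lborel (\<lambda>x. (f x * f x) * g x)"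
      using L2_integrable_weighted_mult[OF L2_shift[OF L2(1)] L2_shift[OF L2(1)] meas(2) bdd(2), of h h]
        L2_integrable_weighted_mult[OF L2(1,1) meas(2) bdd(2)]
      by (simp_all add: mult.commute)
    have "(\<integral>x. g x * ((f (x + h) + f x) * ((f (x + h) - f x) / h)) \<partial>lborel)
        = (\<integral>x. (f (x + h) * f (x + h) - f x * f x) * g x / h \<partial>lborel)"
      by (intro Bochner_Integration.integral_cong) (auto simp: algebra_simps)
    also have "\<dots> = (\<integral>x. (f (x + h) * f (x + h) - f x * f x) * g x \<partial>lborel) / h"
      by simp
    also have "\<dots> = (\<integral>x. f x * f x * (g (x - h) - g x) \<partial>lborel) / h"
      using integral_diff_mult[of "\<lambda>x. f x * f x", OF int] by simp
    also have "\<dots> = (\<integral>x. f x * f x * (g (x - h) - g x) / h \<partial>lborel)"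
      by simp
    finally show ?thesis
      by (simp add: mult.assoc)
  qed
  have "(\<integral>x. g x * ((f x + f x) * f' x) \<partial>lborel) = (\<integral>x. f x * (f x * - g' x) \<partial>lborel)"
    by (rule LIM_unique[OF 1[unfolded eq] 2])
  moreover have "(\<integral>x. g x * ((f x + f x) * f' x) \<partial>lborel) = (\<integral>x. 2 * (f x * f' x * g x) \<partial>lborel)"
    by (intro Bochner_Integration.integral_cong) auto
  ultimately show ?thesis
    by (simp add: mult.assoc)
qed

lemma has_L2_deriv_Lipschitz:
  assumes fg: "has_L2_deriv f g" and M: "AE x in lborel. \<bar>g x\<bar> \<le> M" "0 \<le> M"
  shows "\<bar>f (x + h) - f x\<bar> \<le> M * \<bar>h\<bar>"
proof (cases "h = 0")
  case False
  have [measurable]: "g \<in> borel_measurable borel"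
    using fg by (auto dest: has_L2_derivD L2_measurable)
  obtain a b where ab: "a \<le> b" "b - a = \<bar>h\<bar>" "\<bar>f (x + h) - f x\<bar> = \<bar>f b - f a\<bar>"
    by (cases "h > 0") (auto intro: that[of x "x + h"] that[of "x + h" x])
  have "\<bar>f b - f a\<bar> \<le> (\<integral>x. \<bar>indicator {a<..b} x * g x\<bar> \<partial>lborel)"
    using fg ab(1) integral_abs_bound[of lborel "\<lambda>x. indicator {a<..b} x * g x"]
    by (simp add: has_L2_deriv_def)
  also have "\<dots> \<le> (\<integral>x. indicator {a<..b} x * M \<partial>lborel)"
  proof (rule integral_mono_AE)
    show "integrable lborel (\<lambda>x. indicator {a<..b} x * M)"
      using ab(1) by (intro integrable_mult_left integrable_real_indicator) auto
    show "integrable lborel (\<lambda>x. \<bar>indicator {a<..b} x * g x\<bar>)"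
      using has_L2_derivD(2)[OF fg] by (intro integrable_abs L1_loc_integrable_Ioc L2_imp_L1_loc)
    show "AE x in lborel. \<bar>indicator {a<..b} x * g x\<bar> \<le> indicator {a<..b} x * M"
      using M(1) by eventually_elim (auto split: split_indicator)
  qed
  also have "\<dots> = M * \<bar>h\<bar>"
    using ab by simp
  finally show ?thesis
    using ab by simp
qed simp

lemma test_fun_L2:
  assumes "\<phi> \<in> test_fun"
  shows "\<phi> \<in> L2"
proof (rule L2I)
  have meas [measurable]: "\<phi> \<in> borel_measurable borel"
    using assms by (rule test_fun_measurable)
  then show "\<phi> \<in> borel_measurable borel" .
  have "set_integrable lborel {a..b} \<phi>" for a b
    using test_fun_isCont[OF assms]
    by (intro borel_integrable_atLeastAtMost' continuous_at_imp_continuous_on) auto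
  then have "\<phi> \<in> L1_loc"
    by (simp add: L1_loc_def)
  from L1_loc_integrable_mult_test_fun[OF this assms]
  show "integrable lborel (\<lambda>x. (\<phi> x)\<^sup>2)"
    by (simp add: power2_eq_square)
qed

lemma indicator_Ioc_integral_eq_Icc:
  fixes g :: "real \<Rightarrow> real"
  assumes [measurable]: "g \<in> borel_measurable borel"
  shows "(\<integral>x. indicator {a<..b} x * g x \<partial>lborel) = (\<integral>x. g x * indicator {a..b} x \<partial>lborel)"
proof (rule integral_cong_AE)
  show "AE x in lborel. indicator {a<..b} x * g x = g x * indicator {a..b} x"
    using AE_lborel_singleton[of a] by eventually_elim (auto split: split_indicator)
qed simp_all

lemma test_fun_has_L2_deriv:
  assumes "\<phi> \<in> test_fun"
  shows "has_L2_deriv \<phi> (deriv \<phi>)"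
  unfolding has_L2_deriv_def
proof (intro conjI allI impI)
  show "\<phi> \<in> L2" "deriv \<phi> \<in> L2"
    using assms by (auto intro: test_fun_L2 deriv_test_fun)
  fix a b :: real assume "a \<le> b"
  then have "(\<integral>x. deriv \<phi> x * indicator {a..b} x \<partial>lborel) = \<phi> b - \<phi> a"
    using assms by (intro integral_FTC_Icc_real) (auto intro: test_fun_has_real_derivative test_fun_isCont deriv_test_fun)
  then show "\<phi> b - \<phi> a = (\<integral>x. indicator {a<..b} x * deriv \<phi> x \<partial>lborel)"
    using indicator_Ioc_integral_eq_Icc[OF test_fun_measurable[OF deriv_test_fun[OF assms]]] by simp
qed

lemma has_weak_deriv_if_L2_deriv:
  assumes "has_L2_deriv f g"
  shows "has_weak_deriv f g"
  unfolding has_weak_deriv_def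
  using has_L2_derivD[OF assms] L2_integral_by_parts[OF assms test_fun_has_L2_deriv]
  by (auto intro: L2_imp_L1_loc)

section \<open>The nonlocal term\<close>

definition convol :: "(real \<Rightarrow> real) \<Rightarrow> (real \<Rightarrow> real) \<Rightarrow> real \<Rightarrow> real" where
  "convol k F x = (\<integral>y. k (x - y) * F y \<partial>lborel)"

text \<open>
  Convolution with an integrable kernel acts on \<open>L\<^sup>1\<close>; as the kernel is bounded too, the integral
  exists at every point and the convolution is bounded, hence in \<open>L\<^sup>2\<close>.
\<close>

locale convolution =
  fixes k F :: "real \<Rightarrow> real" and B :: real
  assumes k: "integrable lborel k" and F: "integrable lborel F" and bdd: "\<And>x. \<bar>k x\<bar> \<le> B"
begin

lemma measurable_kF [measurable]: "k \<in> borel_measurable borel" "F \<in> borel_measurable borel"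
  using borel_measurable_integrable[OF k] borel_measurable_integrable[OF F] by simp_all

lemma integrable_shifted_kernel: "integrable lborel (\<lambda>x. k (x - y))"
  using integrable_shift[OF k, of "- y"] by simp

lemma integrable_kernel_mult: "integrable lborel (\<lambda>y. k (x - y) * F y)"
  by (rule integrable_bounded_mult[OF F _ bdd]) simp

lemma integrable_pair: "integrable (lborel \<Otimes>\<^sub>M lborel) (\<lambda>(y, x). k (x - y) * F y)"
proof (rule lborel_pair.Fubini_integrable)
  show "(\<lambda>(y, x). k (x - y) * F y) \<in> borel_measurable (lborel \<Otimes>\<^sub>M lborel)"
    by measurable
  have "(\<integral>x. \<bar>k (x - y) * F y\<bar> \<partial>lborel) = (\<integral>x. \<bar>k x\<bar> \<partial>lborel) * \<bar>F y\<bar>" for y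
    using integral_shift[of "\<lambda>x. \<bar>k x\<bar>" "- y"] by (simp add: abs_mult)
  then show "integrable lborel (\<lambda>y. \<integral>x. norm (case (y, x) of (y, x) \<Rightarrow> k (x - y) * F y) \<partial>lborel)"
    using F by simp
  show "AE y in lborel. integrable lborel (\<lambda>x. case (y, x) of (y, x) \<Rightarrow> k (x - y) * F y)"
    using integrable_shifted_kernel by simp
qed

lemma integrable_convol: "integrable lborel (convol k F)"
  using lborel_pair.integrable_snd[OF integrable_pair] by (simp add: convol_def[abs_def])

lemma abs_convol_le: "\<bar>convol k F x\<bar> \<le> B * (\<integral>y. \<bar>F y\<bar> \<partial>lborel)"
proof -
  have "\<bar>convol k F x\<bar> \<le> (\<integral>y. \<bar>k (x - y) * F y\<bar> \<partial>lborel)"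
    unfolding convol_def by (rule integral_abs_bound)
  also have "\<dots> \<le> (\<integral>y. B * \<bar>F y\<bar> \<partial>lborel)"
  proof (rule integral_mono)
    show "integrable lborel (\<lambda>y. \<bar>k (x - y) * F y\<bar>)"
      using integrable_kernel_mult by simp
    show "integrable lborel (\<lambda>y. B * \<bar>F y\<bar>)"
      using F by simp
    show "\<bar>k (x - y) * F y\<bar> \<le> B * \<bar>F y\<bar>" for y
      unfolding abs_mult by (intro mult_right_mono bdd) simp
  qed
  finally show ?thesis
    by simp
qed

lemma convol_L1_le: "(\<integral>x. \<bar>convol k F x\<bar> \<partial>lborel) \<le> (\<integral>x. \<bar>k x\<bar> \<partial>lborel) * (\<integral>y. \<bar>F y\<bar> \<partial>lborel)"
proof -
  have pair: "integrable (lborel \<Otimes>\<^sub>M lborel) (\<lambda>(y, x). \<bar>k (x - y) * F y\<bar>)"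
    using integrable_abs[OF integrable_pair] by (simp add: case_prod_unfold)
  have "(\<integral>x. \<bar>convol k F x\<bar> \<partial>lborel) \<le> (\<integral>x. (\<integral>y. \<bar>k (x - y) * F y\<bar> \<partial>lborel) \<partial>lborel)"
  proof (rule integral_mono)
    show "integrable lborel (\<lambda>x. \<bar>convol k F x\<bar>)"
      using integrable_convol by simp
    show "integrable lborel (\<lambda>x. \<integral>y. \<bar>k (x - y) * F y\<bar> \<partial>lborel)"
      by (rule lborel_pair.integrable_snd[OF pair])
    show "\<bar>convol k F x\<bar> \<le> (\<integral>y. \<bar>k (x - y) * F y\<bar> \<partial>lborel)" for x
      unfolding convol_def by (rule integral_abs_bound)
  qed
  also have "\<dots> = (\<integral>y. (\<integral>x. \<bar>k (x - y) * F y\<bar> \<partial>lborel) \<partial>lborel)"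
    by (rule lborel_pair.Fubini_integral[OF pair])
  also have "\<dots> = (\<integral>y. (\<integral>x. \<bar>k x\<bar> \<partial>lborel) * \<bar>F y\<bar> \<partial>lborel)"
  proof (intro Bochner_Integration.integral_cong refl)
    fix y
    show "(\<integral>x. \<bar>k (x - y) * F y\<bar> \<partial>lborel) = (\<integral>x. \<bar>k x\<bar> \<partial>lborel) * \<bar>F y\<bar>"
      using integral_shift[of "\<lambda>x. \<bar>k x\<bar>" "- y"] by (simp add: abs_mult)
  qed
  finally show ?thesis
    by simp
qed

lemma convol_L2: "convol k F \<in> L2"
proof (rule L2I)
  show [measurable]: "convol k F \<in> borel_measurable borel"
    using borel_measurable_integrable[OF integrable_convol] by simp
  show "integrable lborel (\<lambda>x. (convol k F x)\<^sup>2)"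
    unfolding power2_eq_square by (rule integrable_bounded_mult[OF integrable_convol _ abs_convol_le]) simp
qed

end

definition green :: "real \<Rightarrow> real" where
  "green z = 1/2 * exp (- \<bar>z\<bar>)"

definition green_deriv :: "real \<Rightarrow> real" where
  "green_deriv z = - (1/2) * sgn z * exp (- \<bar>z\<bar>)"

lemma inv_helmholtz_eq_convol: "inv_helmholtz F = convol green F"
  by (simp add: inv_helmholtz_def convol_def green_def fun_eq_iff)

lemma green_measurable [measurable]: "green \<in> borel_measurable borel" "green_deriv \<in> borel_measurable borel"
  unfolding green_def[abs_def] green_deriv_def[abs_def] by measurable

lemma has_bochner_integral_exp_atLeast:
  "has_bochner_integral lborel (\<lambda>x::real. indicator {a..} x * exp (- x)) (exp (- a))"
proof -
  have "((\<lambda>x::real. - exp (- x)) \<longlongrightarrow> - 0) at_top"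
    by (intro tendsto_minus filterlim_compose[OF exp_at_bot filterlim_uminus_at_bot_at_top])
  then have "(\<integral>\<^sup>+x. ennreal (exp (- x)) * indicator {a..} x \<partial>lborel) = ennreal (- 0 - (- exp (- a)))"
    by (intro nn_integral_FTC_atLeast) (auto intro!: derivative_eq_intros)
  moreover have "(\<integral>\<^sup>+x. ennreal (exp (- x)) * indicator {a..} x \<partial>lborel)
      = (\<integral>\<^sup>+x. ennreal (indicator {a..} x * exp (- x)) \<partial>lborel)"
    by (intro nn_integral_cong) (simp split: split_indicator)
  ultimately have "(\<integral>\<^sup>+x. ennreal (indicator {a..} x * exp (- x)) \<partial>lborel) = ennreal (exp (- a))"
    by simp
  then show ?thesis
    by (intro has_bochner_integral_nn_integral) simp_all
qed

lemma has_bochner_integral_exp_abs: "has_bochner_integral lborel (\<lambda>x::real. exp (- \<bar>x\<bar>)) 2"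
proof -
  have "indicator {0..} x * exp (- x) = indicator {0..} x *\<^sub>R exp (- \<bar>x\<bar>)" for x :: real
    by (simp split: split_indicator)
  with has_bochner_integral_exp_atLeast[of 0]
  have "has_bochner_integral lborel (\<lambda>x::real. indicator {0..} x *\<^sub>R exp (- \<bar>x\<bar>)) 1"
    by simp
  from has_bochner_integral_even_function[OF this] show ?thesis
    by simp
qed

lemma green_integrable: "integrable lborel green" and green_integral: "(\<integral>z. \<bar>green z\<bar> \<partial>lborel) = 1"
  using has_bochner_integral_exp_abs
  by (auto simp: green_def[abs_def] has_bochner_integral_iff)

lemma green_deriv_integrable: "integrable lborel green_deriv"
  and green_deriv_integral: "(\<integral>z. \<bar>green_deriv z\<bar> \<partial>lborel) \<le> 1"
proof -
  have le: "\<bar>green_deriv z\<bar> \<le> green z" for z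
    by (simp add: green_deriv_def green_def abs_mult sgn_if)
  show int: "integrable lborel green_deriv"
    by (rule Bochner_Integration.integrable_bound[OF green_integrable])
       (use le in \<open>auto intro!: order_trans[OF le]\<close>)
  have "(\<integral>z. \<bar>green_deriv z\<bar> \<partial>lborel) \<le> (\<integral>z. \<bar>green z\<bar> \<partial>lborel)"
    using int green_integrable le by (intro integral_mono integrable_abs) (auto intro: order_trans[OF le])
  then show "(\<integral>z. \<bar>green_deriv z\<bar> \<partial>lborel) \<le> 1"
    by (simp add: green_integral)
qed

lemma abs_green_le: "\<bar>green z\<bar> \<le> 1" "\<bar>green_deriv z\<bar> \<le> 1"
proof -
  have "\<bar>green z\<bar> = 1/2 * exp (- \<bar>z\<bar>)" "\<bar>green_deriv z\<bar> \<le> 1/2 * exp (- \<bar>z\<bar>)"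
    by (simp_all add: green_def green_deriv_def abs_mult sgn_if)
  moreover have "exp (- \<bar>z\<bar>) \<le> 1"
    by simp
  ultimately show "\<bar>green z\<bar> \<le> 1" "\<bar>green_deriv z\<bar> \<le> 1"
    by linarith+
qed

lemma green_FTC:
  assumes "a \<le> b"
  shows "green b - green a = (\<integral>x. indicator {a<..b} x * green_deriv x \<partial>lborel)"
proof -
  have "(green_deriv has_integral (green b - green a)) {a..b}"
  proof (rule fundamental_theorem_of_calculus_strong[where S = "{0}"])
    show "continuous_on {a..b} green"
      unfolding green_def[abs_def] by (intro continuous_intros)
    fix x assume x: "x \<in> {a..b} - {0}"
    have "(green has_real_derivative green_deriv x) (at x)"
    proof (cases "x > 0")
      case True
      have "((\<lambda>z. 1/2 * exp (- z)) has_real_derivative green_deriv x) (at x)"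
        using True by (auto intro!: derivative_eq_intros simp: green_deriv_def)
      then show ?thesis
        by (rule has_field_derivative_transform_within_open[where S = "{0<..}"])
           (use True in \<open>auto simp: green_def\<close>)
    next
      case False
      then have "x < 0"
        using x by auto
      have "((\<lambda>z. 1/2 * exp z) has_real_derivative green_deriv x) (at x)"
        using \<open>x < 0\<close> by (auto intro!: derivative_eq_intros simp: green_deriv_def)
      then show ?thesis
        by (rule has_field_derivative_transform_within_open[where S = "{..<0}"])
           (use \<open>x < 0\<close> in \<open>auto simp: green_def\<close>)
    qed
    then show "(green has_vector_derivative green_deriv x) (at x)"
      by (simp add: has_real_derivative_iff_has_vector_derivative)
  qed (use assms in auto)
  moreover have "set_integrable lborel {a..b} green_deriv"
    unfolding set_integrable_def using green_deriv_integrable by (intro integrable_mult_indicator) auto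
  from set_borel_integral_eq_integral(2)[OF this]
  have "(\<integral>x. green_deriv x * indicator {a..b} x \<partial>lborel) = integral {a..b} green_deriv"
    by (simp add: set_lebesgue_integral_def mult.commute)
  ultimately show ?thesis
    using indicator_Ioc_integral_eq_Icc[OF green_measurable(2), of a b] by (simp add: integral_unique)
qed

text \<open>
  Away from its jump at \<open>0\<close> the derivative of the kernel is Lipschitz with an integrable constant;
  the jump contributes on an interval of length \<open>h\<close> only.
\<close>

lemma green_deriv_shift_L1_le:
  assumes h: "0 < h" "h \<le> 1"
  shows "(\<integral>z. \<bar>green_deriv (z + h) - green_deriv z\<bar> \<partial>lborel) \<le> 5 * h"
proof -
  have eh: "1 - exp (- h) \<le> h" "0 \<le> 1 - exp (- h)"
    using exp_ge_add_one_self[of "- h"] h by auto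
  have e3: "exp h \<le> 3"
    using exp_le h order_trans[of "exp h" "exp 1" 3] by simp
  have le: "\<bar>green_deriv (z + h) - green_deriv z\<bar> \<le> 2 * h * exp (- \<bar>z\<bar>) + indicator {-h..0} z" for z
  proof -
    consider "z > 0" | "z < - h" | "z \<in> {-h..0}"
      by force
    then show ?thesis
    proof cases
      case 1
      then have "green_deriv (z + h) - green_deriv z = 1/2 * exp (- z) * (1 - exp (- h))"
        using h by (simp add: green_deriv_def exp_diff exp_minus field_simps exp_add)
      moreover have "1/2 * exp (- z) * (1 - exp (- h)) \<le> 1/2 * exp (- z) * h"
        using eh by (intro mult_left_mono) auto
      moreover have "1/2 * exp (- z) * h \<le> 2 * h * exp (- z)"
        using h by simp
      moreover have "0 \<le> 1/2 * exp (- z) * (1 - exp (- h))"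
        using eh by simp
      ultimately have "\<bar>green_deriv (z + h) - green_deriv z\<bar> \<le> 2 * h * exp (- z)"
        by linarith
      then show ?thesis
        using 1 by simp
    next
      case 2
      then have "green_deriv (z + h) - green_deriv z = 1/2 * (exp h * exp z) * (1 - exp (- h))"
        using h by (simp add: green_deriv_def exp_minus field_simps exp_add)
      moreover have "1/2 * (exp h * exp z) * (1 - exp (- h)) \<le> 1/2 * (3 * exp z) * h"
        using eh e3 by (intro mult_mono) auto
      moreover have "1/2 * (3 * exp z) * h \<le> 2 * h * exp z"
        using h by simp
      moreover have "0 \<le> 1/2 * (exp h * exp z) * (1 - exp (- h))"
        using eh by simp
      ultimately have "\<bar>green_deriv (z + h) - green_deriv z\<bar> \<le> 2 * h * exp z"
        by linarith
      then show ?thesis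
        using 2 h by simp
    next
      case 3
      have half: "\<bar>green_deriv y\<bar> \<le> 1/2" for y
      proof -
        have "\<bar>green_deriv y\<bar> \<le> 1/2 * exp (- \<bar>y\<bar>)"
          by (simp add: green_deriv_def abs_mult sgn_if)
        moreover have "exp (- \<bar>y\<bar>) \<le> 1"
          by simp
        ultimately show ?thesis
          by linarith
      qed
      have "\<bar>green_deriv (z + h) - green_deriv z\<bar> \<le> 1"
        using half[of z] half[of "z + h"] by linarith
      moreover have "0 \<le> 2 * h * exp (- \<bar>z\<bar>)"
        using h by simp
      moreover have "indicator {-h..0} z = (1::real)"
        using 3 by simp
      ultimately show ?thesis
        by linarith
    qed
  qed
  have exp: "integrable lborel (\<lambda>z::real. exp (- \<bar>z\<bar>))" "(\<integral>(z::real). exp (- \<bar>z\<bar>) \<partial>lborel) = 2"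
    using has_bochner_integral_exp_abs by (auto simp: has_bochner_integral_iff)
  have ind: "integrable lborel (indicator {-h..0} :: real \<Rightarrow> real)"
    using h by (intro integrable_real_indicator) auto
  have "(\<integral>z. \<bar>green_deriv (z + h) - green_deriv z\<bar> \<partial>lborel)
      \<le> (\<integral>z. 2 * h * exp (- \<bar>z\<bar>) + indicator {-h..0} z \<partial>lborel)"
  proof (rule integral_mono)
    show "integrable lborel (\<lambda>z. \<bar>green_deriv (z + h) - green_deriv z\<bar>)"
      using green_deriv_integrable integrable_shift[OF green_deriv_integrable, of h] by simp
    show "integrable lborel (\<lambda>z. 2 * h * exp (- \<bar>z\<bar>) + indicator {-h..0} z)"
      using exp ind by simp
  qed (rule le)
  also have "\<dots> = 5 * h"
    using exp ind h by simp
  finally show ?thesis .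
qed

definition inv_helmholtz_deriv :: "(real \<Rightarrow> real) \<Rightarrow> real \<Rightarrow> real" where
  "inv_helmholtz_deriv = convol green_deriv"

context
  fixes F :: "real \<Rightarrow> real"
  assumes F: "integrable lborel F"
begin

interpretation G: convolution green F 1
  by unfold_locales (use F green_integrable abs_green_le in auto)

interpretation G': convolution green_deriv F 1
  by unfold_locales (use F green_deriv_integrable abs_green_le in auto)

lemma inv_helmholtz_integrable: "integrable lborel (inv_helmholtz F)"
  unfolding inv_helmholtz_eq_convol by (rule G.integrable_convol)

lemma inv_helmholtz_L1_le: "(\<integral>x. \<bar>inv_helmholtz F x\<bar> \<partial>lborel) \<le> (\<integral>x. \<bar>F x\<bar> \<partial>lborel)"
  using G.convol_L1_le by (simp add: inv_helmholtz_eq_convol green_integral)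

lemma inv_helmholtz_deriv_integrable: "integrable lborel (inv_helmholtz_deriv F)"
  unfolding inv_helmholtz_deriv_def by (rule G'.integrable_convol)

lemma inv_helmholtz_deriv_L1_le: "(\<integral>x. \<bar>inv_helmholtz_deriv F x\<bar> \<partial>lborel) \<le> (\<integral>x. \<bar>F x\<bar> \<partial>lborel)"
proof -
  have "(\<integral>x. \<bar>green_deriv x\<bar> \<partial>lborel) * (\<integral>x. \<bar>F x\<bar> \<partial>lborel) \<le> 1 * (\<integral>x. \<bar>F x\<bar> \<partial>lborel)"
    using green_deriv_integral by (intro mult_right_mono) auto
  then show ?thesis
    using G'.convol_L1_le by (simp add: inv_helmholtz_deriv_def)
qed

lemma inv_helmholtz_deriv_shift_L1_le:
  assumes h: "0 < h" "h \<le> 1"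
  shows "(\<integral>x. \<bar>inv_helmholtz_deriv F (x + h) - inv_helmholtz_deriv F x\<bar> \<partial>lborel) \<le> 5 * h * (\<integral>x. \<bar>F x\<bar> \<partial>lborel)"
proof -
  let ?k = "\<lambda>z. green_deriv (z + h) - green_deriv z"
  have two: "\<bar>?k z\<bar> \<le> 2" for z
    using abs_green_le(2)[of z] abs_green_le(2)[of "z + h"] by linarith
  interpret D: convolution ?k F 2
    by unfold_locales (use F two integrable_shift[OF green_deriv_integrable] green_deriv_integrable in auto)
  have "inv_helmholtz_deriv F (x + h) - inv_helmholtz_deriv F x = convol ?k F x" for x
  proof -
    have "convol ?k F x = (\<integral>y. green_deriv (x + h - y) * F y - green_deriv (x - y) * F y \<partial>lborel)"
      unfolding convol_def by (intro Bochner_Integration.integral_cong) (auto simp: algebra_simps)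
    then show ?thesis
      using G'.integrable_kernel_mult by (simp add: inv_helmholtz_deriv_def convol_def)
  qed
  then have "(\<integral>x. \<bar>inv_helmholtz_deriv F (x + h) - inv_helmholtz_deriv F x\<bar> \<partial>lborel)
      \<le> (\<integral>z. \<bar>?k z\<bar> \<partial>lborel) * (\<integral>x. \<bar>F x\<bar> \<partial>lborel)"
    using D.convol_L1_le by simp
  also have "\<dots> \<le> 5 * h * (\<integral>x. \<bar>F x\<bar> \<partial>lborel)"
    by (intro mult_right_mono green_deriv_shift_L1_le h) simp
  finally show ?thesis .
qed

text \<open>
  By Fubini's theorem the fundamental theorem of calculus is inherited from the kernel.
\<close>

lemma inv_helmholtz_has_L2_deriv: "has_L2_deriv (inv_helmholtz F) (inv_helmholtz_deriv F)"
  unfolding has_L2_deriv_def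
proof (intro conjI allI impI)
  show "inv_helmholtz F \<in> L2" "inv_helmholtz_deriv F \<in> L2"
    unfolding inv_helmholtz_eq_convol inv_helmholtz_deriv_def by (rule G.convol_L2, rule G'.convol_L2)
  fix a b :: real assume "a \<le> b"
  have "integrable (lborel \<Otimes>\<^sub>M lborel) (\<lambda>(y, x). indicator {a<..b} x * (green_deriv (x - y) * F y))"
  proof (rule Bochner_Integration.integrable_bound[OF G'.integrable_pair])
    show "(\<lambda>(y, x). indicator {a<..b} x * (green_deriv (x - y) * F y)) \<in> borel_measurable (lborel \<Otimes>\<^sub>M lborel)"
      by measurable
  qed (auto split: split_indicator)
  note Fubini = lborel_pair.Fubini_integral[OF this]
  have inner: "(\<integral>x. indicator {a<..b} x * (green_deriv (x - y) * F y) \<partial>lborel) = (green (b - y) - green (a - y)) * F y" for y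
  proof -
    have "(\<integral>x. indicator {a<..b} x * green_deriv (x - y) \<partial>lborel)
        = (\<integral>x. indicator {a - y<..b - y} (x + - y) * green_deriv (x + - y) \<partial>lborel)"
      by (intro Bochner_Integration.integral_cong) (auto split: split_indicator)
    also have "\<dots> = green (b - y) - green (a - y)"
      using \<open>a \<le> b\<close> green_FTC[of "a - y" "b - y"]
        integral_shift[of "\<lambda>x. indicator {a - y<..b - y} x * green_deriv x" "- y"] by simp
    finally show ?thesis
      by (simp flip: mult.assoc)
  qed
  have "(\<integral>x. indicator {a<..b} x * inv_helmholtz_deriv F x \<partial>lborel)
      = (\<integral>x. (\<integral>y. indicator {a<..b} x * (green_deriv (x - y) * F y) \<partial>lborel) \<partial>lborel)"
    by (simp add: inv_helmholtz_deriv_def convol_def)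
  also have "\<dots> = (\<integral>y. green (b - y) * F y - green (a - y) * F y \<partial>lborel)"
    unfolding Fubini inner left_diff_distrib ..
  also have "\<dots> = inv_helmholtz F b - inv_helmholtz F a"
    using G.integrable_kernel_mult by (simp add: inv_helmholtz_eq_convol convol_def)
  finally show "inv_helmholtz F b - inv_helmholtz F a = (\<integral>x. indicator {a<..b} x * inv_helmholtz_deriv F x \<partial>lborel)"
    by simp
qed

lemma inv_helmholtz_nonneg:
  assumes "\<And>x. 0 \<le> F x"
  shows "0 \<le> inv_helmholtz F x"
  unfolding inv_helmholtz_def using assms by simp

text \<open>
  By the triangle inequality, \<open>e\<^bsup>-\<bar>x - y\<bar>\<^esup> \<ge> e\<^bsup>-\<bar>x\<bar>\<^esup> e\<^bsup>-\<bar>y\<bar>\<^esup>\<close>. This is the obstruction to fast decay on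
  which the theorem rests.
\<close>

lemma inv_helmholtz_Harnack:
  assumes "\<And>x. 0 \<le> F x"
  shows "exp (- \<bar>x\<bar>) * inv_helmholtz F 0 \<le> inv_helmholtz F x"
proof -
  have "exp (- \<bar>x\<bar>) * inv_helmholtz F 0 = (\<integral>y. exp (- \<bar>x\<bar>) * (green (0 - y) * F y) \<partial>lborel)"
    by (simp add: inv_helmholtz_eq_convol convol_def)
  also have "\<dots> \<le> (\<integral>y. green (x - y) * F y \<partial>lborel)"
  proof (rule integral_mono)
    fix y
    have "exp (- \<bar>x\<bar>) * exp (- \<bar>y\<bar>) \<le> exp (- \<bar>x - y\<bar>)"
      by (simp flip: exp_add)
    then have "exp (- \<bar>x\<bar>) * green (0 - y) \<le> green (x - y)"
      by (simp add: green_def)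
    from mult_right_mono[OF this assms]
    show "exp (- \<bar>x\<bar>) * (green (0 - y) * F y) \<le> green (x - y) * F y"
      by (simp add: mult.assoc)
  qed (use G.integrable_kernel_mult[of x] G.integrable_kernel_mult[of 0] in auto)
  finally show ?thesis
    by (simp add: inv_helmholtz_eq_convol convol_def)
qed

lemma inv_helmholtz_eq_0D:
  assumes "\<And>x. 0 \<le> F x" "inv_helmholtz F 0 = 0"
  shows "AE x in lborel. F x = 0"
proof -
  have "(\<integral>y. green (0 - y) * F y \<partial>lborel) = 0"
    using assms(2) by (simp add: inv_helmholtz_eq_convol convol_def)
  then have "AE y in lborel. green (0 - y) * F y = 0"
    using assms(1) by (subst (asm) integral_nonneg_eq_0_iff_AE[OF G.integrable_kernel_mult]) (auto simp: green_def)
  then show ?thesis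
    by eventually_elim (simp add: green_def)
qed

end

section \<open>Regular solutions\<close>

text \<open>
  For \<open>g = f'\<close> this is the function to which \<open>(1 - \<partial>\<^sub>x\<^sup>2)\<^sup>-\<^sup>1\<close> is applied in the equation.
\<close>

definition source_term :: "(real \<Rightarrow> real) \<Rightarrow> (real \<Rightarrow> real) \<Rightarrow> real \<Rightarrow> real" where
  "source_term f g y = (f y)\<^sup>2 + 1/2 * (g y)\<^sup>2"

lemma source_term_nonneg: "0 \<le> source_term f g y"
  by (simp add: source_term_def)

lemma source_term_integrable: "f \<in> L2 \<Longrightarrow> g \<in> L2 \<Longrightarrow> integrable lborel (source_term f g)"
  unfolding source_term_def[abs_def]
  by (intro Bochner_Integration.integrable_add integrable_mult_right L2_integrable_square)

lemma source_term_integral: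
  "f \<in> L2 \<Longrightarrow> g \<in> L2 \<Longrightarrow>
    (\<integral>y. \<bar>source_term f g y\<bar> \<partial>lborel) = (L2_norm f)\<^sup>2 + 1/2 * (L2_norm g)\<^sup>2"
  using source_term_nonneg[of f g]
  by (simp add: source_term_def L2_norm_square L2_integrable_square)

text \<open>
  Here \<open>v\<close> is \<open>\<partial>\<^sub>x u\<close> and \<open>ut\<close> is \<open>\<partial>\<^sub>t u\<close>. The Lipschitz bound holds at every time, and the spatial
  derivative of the nonlocal term is given by a formula; the function spaces of the theorem only
  provide an almost everywhere bound and some weak derivative.
\<close>

locale camassa_holm_flow =
  fixes T M :: real and u v ut :: "real \<Rightarrow> real \<Rightarrow> real"
  assumes T: "0 < T"
    and deriv: "t \<in> {-T..T} \<Longrightarrow> has_L2_deriv (u t) (v t)"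
    and u_le: "t \<in> {-T..T} \<Longrightarrow> \<bar>u t x\<bar> \<le> M"
    and v_le: "t \<in> {-T..T} \<Longrightarrow> AE x in lborel. \<bar>v t x\<bar> \<le> M"
    and u_cont: "t \<in> {-T..T} \<Longrightarrow> tendsto_L2 u (u t) (at t within {-T..T})"
    and v_cont: "t \<in> {-T..T} \<Longrightarrow> tendsto_L2 v (v t) (at t within {-T..T})"
    and time_deriv: "t \<in> {-T<..<T} \<Longrightarrow> tendsto_L2 (\<lambda>h x. (u (t + h) x - u t x) / h) (ut t) (at 0)"
    and equation: "t \<in> {-T<..<T} \<Longrightarrow>
      AE x in lborel. ut t x = - (u t x * v t x + inv_helmholtz_deriv (source_term (u t) (v t)) x)"

subsection \<open>From the function space to pointwise bounds\<close>

lemma eventually_interval: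
  fixes t :: real
  assumes "t \<in> {a<..<b}"
  shows "\<forall>\<^sub>F h in at 0. t + h \<in> {a<..<b}"
proof (rule topological_tendstoD)
  have "((\<lambda>h. t + h) \<longlongrightarrow> t + 0) (at 0)"
    by (intro tendsto_intros)
  then show "((\<lambda>h. t + h) \<longlongrightarrow> t) (at 0)"
    by simp
qed (use assms in auto)

text \<open>
  A set of times of full measure accumulates at every time.
\<close>

lemma frequently_AE:
  fixes a b t :: real
  assumes ae: "AE s in lborel. s \<in> {a..b} \<longrightarrow> P s" and t: "t \<in> {a..b}" and "a < b"
  shows "\<exists>\<^sub>F s in at t within {a..b}. P s"
proof (rule ccontr)
  assume "\<not> ?thesis"
  then have "\<forall>\<^sub>F s in at t within {a..b}. \<not> P s"
    by (simp add: frequently_def)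
  then obtain d where d: "0 < d" "\<And>s. s \<in> {a..b} \<Longrightarrow> s \<noteq> t \<Longrightarrow> \<bar>s - t\<bar> < d \<Longrightarrow> \<not> P s"
    by (auto simp: eventually_at dist_real_def)
  obtain c e where J: "c < e" "{c<..<e} \<subseteq> {a..b}" "\<And>s. s \<in> {c<..<e} \<Longrightarrow> s \<noteq> t \<and> \<bar>s - t\<bar> < d"
  proof (cases "a < t")
    case True
    then show ?thesis
      using t d(1) by (intro that[of "max a (t - d)" t]) auto
  next
    case False
    then show ?thesis
      using t d(1) \<open>a < b\<close> by (intro that[of t "min b (t + d)"]) auto
  qed
  have "AE s in lborel. s \<notin> {c<..<e}"
    using ae by eventually_elim (use J d(2) in blast)
  then have "{c<..<e} \<in> null_sets lborel"
    by (subst AE_iff_null_sets) auto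
  then have "emeasure lborel {c<..<e} = 0"
    by auto
  then show False
    using J(1) by simp
qed

text \<open>
  If \<open>\<bar>a\<bar> \<le> C\<close>, then the positive part of \<open>\<bar>b\<bar> - C\<close> is at most \<open>\<bar>a - b\<bar>\<close>, so its \<open>L\<^sup>2\<close> norm is
  arbitrarily small.
\<close>

lemma tendsto_L2_AE_bound:
  assumes lim: "tendsto_L2 a b F" and bound: "\<exists>\<^sub>F i in F. AE x in lborel. \<bar>a i x\<bar> \<le> C"
  shows "AE x in lborel. \<bar>b x\<bar> \<le> C"
proof -
  have b: "b \<in> L2"
    using lim by (simp add: tendsto_L2_def)
  have [measurable]: "b \<in> borel_measurable borel"
    using b by (rule L2_measurable)
  define e where "e x = max 0 (\<bar>b x\<bar> - C)" for x
  have [measurable]: "e \<in> borel_measurable borel"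
    unfolding e_def[abs_def] by measurable
  have le: "\<exists>r<d. integrable lborel (\<lambda>x. (e x)\<^sup>2) \<and> (\<integral>x. (e x)\<^sup>2 \<partial>lborel) \<le> r\<^sup>2 \<and> 0 \<le> r" if "0 < d" for d
  proof -
    have "\<forall>\<^sub>F i in F. L2_norm (\<lambda>x. a i x - b x) < d"
      using lim that by (auto simp: tendsto_L2_def intro: order_tendstoD)
    moreover have "\<forall>\<^sub>F i in F. a i \<in> L2"
      using lim by (simp add: tendsto_L2_def)
    ultimately have ev: "\<forall>\<^sub>F i in F. a i \<in> L2 \<and> L2_norm (\<lambda>x. a i x - b x) < d"
      by eventually_elim simp
    have "\<exists>i. a i \<in> L2 \<and> L2_norm (\<lambda>x. a i x - b x) < d \<and> (AE x in lborel. \<bar>a i x\<bar> \<le> C)"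
    proof (rule ccontr)
      assume none: "\<not> ?thesis"
      have "\<forall>\<^sub>F i in F. \<not> (AE x in lborel. \<bar>a i x\<bar> \<le> C)"
        using ev by eventually_elim (use none in blast)
      then show False
        using bound by (simp add: frequently_def)
    qed
    then obtain i where i: "a i \<in> L2" "L2_norm (\<lambda>x. a i x - b x) < d" "AE x in lborel. \<bar>a i x\<bar> \<le> C"
      by blast
    have int: "integrable lborel (\<lambda>x. (a i x - b x)\<^sup>2)"
      by (intro L2_integrable_square L2_diff i b)
    have ae: "AE x in lborel. (e x)\<^sup>2 \<le> (a i x - b x)\<^sup>2"
      using i(3)
    proof eventually_elim
      case (elim x)
      have "\<bar>e x\<bar> \<le> \<bar>a i x - b x\<bar>"
        using elim by (auto simp: e_def)
      then show ?case
        by (simp add: abs_le_square_iff)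
    qed
    have inte: "integrable lborel (\<lambda>x. (e x)\<^sup>2)"
      by (rule Bochner_Integration.integrable_bound[OF int]) (use ae in auto)
    have "(\<integral>x. (e x)\<^sup>2 \<partial>lborel) \<le> (L2_norm (\<lambda>x. a i x - b x))\<^sup>2"
      unfolding L2_norm_square by (rule integral_mono_AE[OF inte int ae])
    with i(2) inte show ?thesis
      by (intro exI[of _ "L2_norm (\<lambda>x. a i x - b x)"]) simp
  qed
  have inte: "integrable lborel (\<lambda>x. (e x)\<^sup>2)"
    using le[of 1] by auto
  have "(\<integral>x. (e x)\<^sup>2 \<partial>lborel) \<le> 0"
  proof (rule field_le_epsilon)
    fix d :: real assume "0 < d"
    then obtain r where r: "r < sqrt d" "(\<integral>x. (e x)\<^sup>2 \<partial>lborel) \<le> r\<^sup>2" "0 \<le> r"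
      using le[of "sqrt d"] by auto
    have "r\<^sup>2 \<le> (sqrt d)\<^sup>2"
      using r by (intro power_mono) auto
    then show "(\<integral>x. (e x)\<^sup>2 \<partial>lborel) \<le> 0 + d"
      using r(2) \<open>0 < d\<close> by simp
  qed
  moreover have "0 \<le> (\<integral>x. (e x)\<^sup>2 \<partial>lborel)"
    by simp
  ultimately have "AE x in lborel. (e x)\<^sup>2 = 0"
    using integral_nonneg_eq_0_iff_AE[OF inte] by auto
  then show ?thesis
    by eventually_elim (auto simp: e_def max_def split: if_splits)
qed

lemma continuous_AE_bound:
  fixes f :: "real \<Rightarrow> real"
  assumes f: "continuous_on UNIV f" and ae: "AE x in lborel. \<bar>f x\<bar> \<le> C"
  shows "\<bar>f x\<bar> \<le> C"
proof (rule ccontr)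
  assume "\<not> ?thesis"
  moreover have "open {x. C < \<bar>f x\<bar>}"
    using f by (intro open_Collect_less continuous_intros)
  ultimately obtain e where e: "0 < e" "ball x e \<subseteq> {x. C < \<bar>f x\<bar>}"
    by (metis linorder_not_less mem_Collect_eq open_contains_ball)
  have "AE y in lborel. y \<notin> ball x e"
    using ae by eventually_elim (use e(2) in auto)
  then have "ball x e \<in> null_sets lborel"
    by (subst AE_iff_null_sets) auto
  then have "emeasure lborel {x - e<..<x + e} = 0"
    by (auto simp: ball_eq_greaterThanLessThan)
  then show False
    using e(1) by simp
qed

lemma Linf_norm_nonneg:
  assumes [measurable]: "f \<in> borel_measurable borel"
  shows "0 \<le> Linf_norm f"
proof -
  have "esssup lborel (\<lambda>x::real. 0::ereal) \<le> esssup lborel (\<lambda>x. ereal \<bar>f x\<bar>)"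
    by (intro esssup_mono) auto
  then show ?thesis
    by (simp add: Linf_norm_def esssup_const)
qed

lemma Linf_norm_AE_le:
  assumes "Linf_norm f \<le> ereal C"
  shows "AE x in lborel. \<bar>f x\<bar> \<le> C"
  using esssup_AE[where M = lborel and f = "\<lambda>x. ereal \<bar>f x\<bar>"]
proof eventually_elim
  case (elim x)
  then have "ereal \<bar>f x\<bar> \<le> ereal C"
    using assms unfolding Linf_norm_def by (rule order_trans)
  then show ?case
    by simp
qed

lemma W1inf_norm_AE_le:
  assumes meas: "f \<in> borel_measurable borel" "weak_deriv f \<in> borel_measurable borel"
    and le: "W1inf_norm f \<le> ereal C"
  shows "AE x in lborel. \<bar>f x\<bar> \<le> C" "AE x in lborel. \<bar>weak_deriv f x\<bar> \<le> C"
proof -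
  have "Linf_norm f \<le> W1inf_norm f" "Linf_norm (weak_deriv f) \<le> W1inf_norm f"
    using add_left_mono[OF Linf_norm_nonneg[OF meas(2)], of "Linf_norm f"]
      add_right_mono[OF Linf_norm_nonneg[OF meas(1)], of "Linf_norm (weak_deriv f)"]
    by (simp_all add: W1inf_norm_def)
  then show "AE x in lborel. \<bar>f x\<bar> \<le> C" "AE x in lborel. \<bar>weak_deriv f x\<bar> \<le> C"
    using le by (auto intro!: Linf_norm_AE_le intro: order_trans)
qed

lemma H1_weak_deriv:
  assumes "f \<in> H1"
  shows "f \<in> L2" "weak_deriv f \<in> L2" "has_weak_deriv f (weak_deriv f)"
proof -
  show "f \<in> L2"
    using assms by (simp add: H1_def)
  obtain g where g: "g \<in> L2" "has_weak_deriv f g"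
    using assms by (auto simp: H1_def)
  show wd: "has_weak_deriv f (weak_deriv f)"
    using g(2) by (rule has_weak_deriv_weak_deriv)
  then have meas: "weak_deriv f \<in> borel_measurable borel" "g \<in> borel_measurable borel"
    using g(1) by (auto simp: has_weak_deriv_def intro: L1_loc_measurable L2_measurable)
  have "AE x in lborel. (g x)\<^sup>2 = (weak_deriv f x)\<^sup>2"
    using weak_deriv_AE_eq[OF g(2)] by eventually_elim simp
  with L2_integrable_square[OF g(1)] have "integrable lborel (\<lambda>x. (weak_deriv f x)\<^sup>2)"
    using meas by (subst (asm) integrable_cong_AE) auto
  then show "weak_deriv f \<in> L2"
    using meas(1) by (intro L2I)
qed

text \<open>
  The chosen weak derivative of a difference agrees with the difference of the chosen weak
  derivatives almost everywhere only, which is enough for norms.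
\<close>

lemma H1_norm_ge:
  assumes "f \<in> H1" "g \<in> H1"
  shows "L2_norm (\<lambda>x. f x - g x) \<le> H1_norm (\<lambda>x. f x - g x)"
    "L2_norm (\<lambda>x. weak_deriv f x - weak_deriv g x) \<le> H1_norm (\<lambda>x. f x - g x)"
proof -
  note f = H1_weak_deriv[OF assms(1)] and g = H1_weak_deriv[OF assms(2)]
  have wd: "has_weak_deriv (\<lambda>x. f x - g x) (\<lambda>x. weak_deriv f x - weak_deriv g x)"
    by (rule has_weak_deriv_diff[OF f(3) g(3)])
  have "L2_norm (\<lambda>x. weak_deriv f x - weak_deriv g x) = L2_norm (weak_deriv (\<lambda>x. f x - g x))"
  proof (rule L2_norm_cong_AE)
    show "AE x in lborel. weak_deriv f x - weak_deriv g x = weak_deriv (\<lambda>x. f x - g x) x"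
      using weak_deriv_AE_eq[OF wd] by eventually_elim simp
    show "(\<lambda>x. weak_deriv f x - weak_deriv g x) \<in> borel_measurable borel"
      by (rule L2_measurable[OF L2_diff[OF f(2) g(2)]])
    show "weak_deriv (\<lambda>x. f x - g x) \<in> borel_measurable borel"
      using has_weak_deriv_weak_deriv[OF wd] by (auto simp: has_weak_deriv_def intro: L1_loc_measurable)
  qed
  then show "L2_norm (\<lambda>x. f x - g x) \<le> H1_norm (\<lambda>x. f x - g x)"
    "L2_norm (\<lambda>x. weak_deriv f x - weak_deriv g x) \<le> H1_norm (\<lambda>x. f x - g x)"
    unfolding H1_norm_def by (auto intro!: real_le_rsqrt)
qed

text \<open>
  The bounds, known for almost every time, extend to every time by continuity in \<open>H\<^sup>1\<close>.
\<close>

lemma camassa_holm_flow_exists: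
  assumes T: "T > 0" and Z: "u \<in> Z_space T" and CH: "CH_solution T u"
  shows "\<exists>M. camassa_holm_flow T M u (\<lambda>t. weak_deriv (u t)) (time_deriv u)"
proof -
  let ?I = "{-T..T}" and ?v = "\<lambda>t. weak_deriv (u t)"
  have H1: "u t \<in> H1" if "t \<in> ?I" for t
    using Z that by (auto simp: Z_space_def cont_H1_def)
  note wd = H1_weak_deriv[OF H1]
  have cont: "continuous_on UNIV (u t)" if "t \<in> ?I" for t
    using Z that by (auto simp: Z_space_def)
  have H1_lim: "((\<lambda>s. H1_norm (\<lambda>x. u s x - u t x)) \<longlongrightarrow> 0) (at t within ?I)" if "t \<in> ?I" for t
    using Z that by (auto simp: Z_space_def cont_H1_def)
  have ev: "\<forall>\<^sub>F s in at t within ?I. s \<in> ?I" for t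
    by (simp add: eventually_at_filter)
  have u_lim: "tendsto_L2 u (u t) (at t within ?I)" if t: "t \<in> ?I" for t
  proof (rule tendsto_L2_le[OF _ wd(1)[OF t] _ H1_lim[OF t]])
    show "\<forall>\<^sub>F s in at t within ?I. u s \<in> L2"
      using ev by eventually_elim (rule wd(1))
    show "\<forall>\<^sub>F s in at t within ?I. L2_norm (\<lambda>x. u s x - u t x) \<le> H1_norm (\<lambda>x. u s x - u t x)"
      using ev by eventually_elim (intro H1_norm_ge H1 t)
  qed
  have v_lim: "tendsto_L2 ?v (?v t) (at t within ?I)" if t: "t \<in> ?I" for t
  proof (rule tendsto_L2_le[OF _ wd(2)[OF t] _ H1_lim[OF t]])
    show "\<forall>\<^sub>F s in at t within ?I. ?v s \<in> L2"
      using ev by eventually_elim (rule wd(2))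
    show "\<forall>\<^sub>F s in at t within ?I. L2_norm (\<lambda>x. ?v s x - ?v t x) \<le> H1_norm (\<lambda>x. u s x - u t x)"
      using ev by eventually_elim (intro H1_norm_ge H1 t)
  qed
  obtain C where C: "AE t in lborel. t \<in> ?I \<longrightarrow> u t \<in> W1inf \<and> W1inf_norm (u t) \<le> ereal C"
    using Z by (auto simp: Z_space_def ess_bdd_W1inf_def)
  have "AE t in lborel. t \<in> ?I \<longrightarrow> (AE x in lborel. \<bar>u t x\<bar> \<le> C) \<and> (AE x in lborel. \<bar>?v t x\<bar> \<le> C)"
    using C
  proof eventually_elim
    case (elim t)
    then show ?case
      using W1inf_norm_AE_le[of "u t" C] wd(1,2)[of t] by (auto dest: L2_measurable)
  qed
  then have freq: "\<exists>\<^sub>F s in at t within ?I. (AE x in lborel. \<bar>u s x\<bar> \<le> C) \<and> (AE x in lborel. \<bar>?v s x\<bar> \<le> C)"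
    if "t \<in> ?I" for t
    by (rule frequently_AE) (use that T in auto)
  have deriv: "has_time_deriv u (time_deriv u t) t" if "t \<in> {-T<..<T}" for t
  proof -
    have "\<exists>v. has_time_deriv u v t"
      using Z that by (auto simp: Z_space_def C1_L2_def)
    then show ?thesis
      unfolding time_deriv_def by (rule someI_ex)
  qed
  have "camassa_holm_flow T C u ?v (time_deriv u)"
  proof
    fix t x assume t: "t \<in> ?I"
    show "has_L2_deriv (u t) (?v t)"
      by (intro has_L2_deriv_if_weak_deriv wd cont t)
    have "AE x in lborel. \<bar>u t x\<bar> \<le> C"
      using freq[OF t] by (intro tendsto_L2_AE_bound[OF u_lim[OF t]]) (auto elim: frequently_mono[rotated])
    then show "\<bar>u t x\<bar> \<le> C"
      by (rule continuous_AE_bound[OF cont[OF t]])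
    show "AE x in lborel. \<bar>?v t x\<bar> \<le> C"
      using freq[OF t] by (intro tendsto_L2_AE_bound[OF v_lim[OF t]]) (auto elim: frequently_mono[rotated])
    show "tendsto_L2 u (u t) (at t within ?I)" "tendsto_L2 ?v (?v t) (at t within ?I)"
      by (fact u_lim[OF t] v_lim[OF t])+
  next
    fix t assume t: "t \<in> {-T<..<T}"
    then have tI: "t \<in> ?I"
      by auto
    have "\<forall>\<^sub>F h in at 0. (\<lambda>x. (u (t + h) x - u t x) / h) \<in> L2"
      using eventually_interval[OF t] by eventually_elim (intro L2_cdiv L2_diff wd(1) tI, auto)
    then show "tendsto_L2 (\<lambda>h x. (u (t + h) x - u t x) / h) (time_deriv u t) (at 0)"
      using deriv[OF t] by (simp add: tendsto_L2_def has_time_deriv_def)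
    let ?F = "source_term (u t) (?v t)"
    have "has_weak_deriv (inv_helmholtz ?F) (inv_helmholtz_deriv ?F)"
      by (intro has_weak_deriv_if_L2_deriv inv_helmholtz_has_L2_deriv source_term_integrable wd tI)
    from weak_deriv_AE_eq[OF this]
    have "AE x in lborel. weak_deriv (inv_helmholtz ?F) x = inv_helmholtz_deriv ?F x" .
    moreover have "AE x in lborel. time_deriv u t x + u t x * ?v t x = - weak_deriv (inv_helmholtz ?F) x"
      using CH t by (simp add: CH_solution_def source_term_def[abs_def])
    ultimately show "AE x in lborel. time_deriv u t x = - (u t x * ?v t x + inv_helmholtz_deriv ?F x)"
      by eventually_elim simp
  qed (rule T)
  then show ?thesis ..
qed

section \<open>Differentiation along the flow\<close>

lemma L2_curve_derivative_linear:
  assumes dq: "tendsto_L2 (\<lambda>h x. (U (t + h) x - U t x) / h) V (at 0)"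
    and U: "\<forall>\<^sub>F h in at 0. U (t + h) \<in> L2" "U t \<in> L2" and \<phi>: "\<phi> \<in> L2"
  shows "((\<lambda>t. \<integral>x. U t x * \<phi> x \<partial>lborel) has_real_derivative (\<integral>x. V x * \<phi> x \<partial>lborel)) (at t)"
  unfolding DERIV_def
proof (rule Lim_transform_eventually)
  show "((\<lambda>h. \<integral>x. 1 * ((U (t + h) x - U t x) / h * \<phi> x) \<partial>lborel) \<longlongrightarrow> (\<integral>x. V x * \<phi> x \<partial>lborel)) (at 0)"
    using tendsto_L2_integral[OF dq tendsto_L2_const[OF \<phi>], of "\<lambda>_. 1" 1] by simp
  show "\<forall>\<^sub>F h in at 0. (\<integral>x. 1 * ((U (t + h) x - U t x) / h * \<phi> x) \<partial>lborel)
      = ((\<integral>x. U (t + h) x * \<phi> x \<partial>lborel) - (\<integral>x. U t x * \<phi> x \<partial>lborel)) / h"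
    using U(1)
  proof eventually_elim
    case (elim h)
    show ?case
      using L2_integrable_mult[OF elim \<phi>] L2_integrable_mult[OF U(2) \<phi>]
      by (simp add: left_diff_distrib)
  qed
qed

lemma L2_curve_derivative_square:
  assumes dq: "tendsto_L2 (\<lambda>h x. (U (t + h) x - U t x) / h) V (at 0)"
    and U: "\<forall>\<^sub>F h in at 0. U (t + h) \<in> L2" "U t \<in> L2"
  shows "((\<lambda>t. \<integral>x. (U t x)\<^sup>2 \<partial>lborel) has_real_derivative 2 * (\<integral>x. U t x * V x \<partial>lborel)) (at t)"
  unfolding DERIV_def
proof (rule Lim_transform_eventually)
  have "tendsto_L2 (\<lambda>h. U (t + h)) (U t) (at 0)"
    unfolding tendsto_L2_def
  proof (intro conjI U)
    have "((\<lambda>h. \<bar>h\<bar> * L2_norm (\<lambda>x. (U (t + h) x - U t x) / h)) \<longlongrightarrow> 0 * L2_norm V) (at 0)"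
      by (intro tendsto_mult tendsto_rabs_zero tendsto_ident_at tendsto_L2_norm dq)
    moreover have "\<bar>h\<bar> * L2_norm (\<lambda>x. (U (t + h) x - U t x) / h) = L2_norm (\<lambda>x. U (t + h) x - U t x)" for h
      using L2_norm_cmult[of h "\<lambda>x. (U (t + h) x - U t x) / h"] by (cases "h = 0") (auto simp: L2_norm_def)
    ultimately show "((\<lambda>h. L2_norm (\<lambda>x. U (t + h) x - U t x)) \<longlongrightarrow> 0) (at 0)"
      by simp
  qed
  from tendsto_L2_add[OF this tendsto_L2_const[OF U(2)]]
  have "tendsto_L2 (\<lambda>h x. U (t + h) x + U t x) (\<lambda>x. U t x + U t x) (at 0)" .
  from tendsto_L2_integral[OF dq this, of "\<lambda>_. 1" 1]
  have "((\<lambda>h. \<integral>x. (U (t + h) x - U t x) / h * (U (t + h) x + U t x) \<partial>lborel)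
      \<longlongrightarrow> (\<integral>x. V x * (U t x + U t x) \<partial>lborel)) (at 0)"
    by simp
  moreover have "(\<integral>x. V x * (U t x + U t x) \<partial>lborel) = (\<integral>x. 2 * (U t x * V x) \<partial>lborel)"
    by (intro Bochner_Integration.integral_cong) auto
  ultimately show "((\<lambda>h. \<integral>x. (U (t + h) x - U t x) / h * (U (t + h) x + U t x) \<partial>lborel)
      \<longlongrightarrow> 2 * (\<integral>x. U t x * V x \<partial>lborel)) (at 0)"
    by simp
  show "\<forall>\<^sub>F h in at 0. (\<integral>x. (U (t + h) x - U t x) / h * (U (t + h) x + U t x) \<partial>lborel)
      = ((\<integral>x. (U (t + h) x)\<^sup>2 \<partial>lborel) - (\<integral>x. (U t x)\<^sup>2 \<partial>lborel)) / h"
    using U(1)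
  proof eventually_elim
    case (elim h)
    have "(\<integral>x. (U (t + h) x - U t x) / h * (U (t + h) x + U t x) \<partial>lborel)
        = (\<integral>x. ((U (t + h) x)\<^sup>2 - (U t x)\<^sup>2) / h \<partial>lborel)"
      by (intro Bochner_Integration.integral_cong) (auto simp: power2_eq_square algebra_simps)
    then show ?case
      using L2_integrable_square[OF elim] L2_integrable_square[OF U(2)] by simp
  qed
qed

context camassa_holm_flow
begin

abbreviation source :: "real \<Rightarrow> real \<Rightarrow> real" where
  "source t \<equiv> source_term (u t) (v t)"

abbreviation pressure :: "real \<Rightarrow> real \<Rightarrow> real" where
  "pressure t \<equiv> inv_helmholtz (source t)"

abbreviation pressure_deriv :: "real \<Rightarrow> real \<Rightarrow> real" where
  "pressure_deriv t \<equiv> inv_helmholtz_deriv (source t)"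

text \<open>
  The square of the \<open>H\<^sup>1\<close> norm.
\<close>

definition energy :: "real \<Rightarrow> real" where
  "energy t = (L2_norm (u t))\<^sup>2 + (L2_norm (v t))\<^sup>2"

lemma M_nonneg: "0 \<le> M"
  using u_le[of 0 0] T by simp

lemma u_L2: "t \<in> {-T..T} \<Longrightarrow> u t \<in> L2" and v_L2: "t \<in> {-T..T} \<Longrightarrow> v t \<in> L2"
  using deriv by (auto dest: has_L2_derivD)

lemma u_measurable: "t \<in> {-T..T} \<Longrightarrow> u t \<in> borel_measurable borel"
  by (rule L2_measurable[OF u_L2])

lemma source_integrable: "t \<in> {-T..T} \<Longrightarrow> integrable lborel (source t)"
  by (intro source_term_integrable u_L2 v_L2)

lemma source_integral_le: "t \<in> {-T..T} \<Longrightarrow> (\<integral>y. \<bar>source t y\<bar> \<partial>lborel) \<le> energy t"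
  using source_term_integral[OF u_L2 v_L2] by (simp add: energy_def)

lemma energy_nonneg: "0 \<le> energy t"
  by (simp add: energy_def)

lemma energy_continuous: "continuous_on {-T..T} energy"
  unfolding continuous_on_def energy_def
  by (intro ballI tendsto_add tendsto_power tendsto_L2_norm u_cont v_cont)

lemma energy_eq_0D:
  assumes t: "t \<in> {-T..T}" and "energy t = 0"
  shows "u t x = 0"
proof -
  have "L2_norm (u t) = 0" "L2_norm (v t) = 0"
    using assms(2) by (auto simp: energy_def sum_power2_eq_zero_iff)
  then have "AE x in lborel. u t x = 0" "AE x in lborel. v t x = 0"
    by (auto intro: L2_norm_eq_0D u_L2 v_L2 t)
  have lip: "\<bar>u t (y + h) - u t y\<bar> \<le> 0 * \<bar>h\<bar>" for y h
    using \<open>AE x in lborel. v t x = 0\<close> by (intro has_L2_deriv_Lipschitz[OF deriv[OF t]]) auto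
  then have const: "u t y = u t x" for y
    using lip[of x "y - x"] by simp
  have "continuous_on UNIV (u t)"
    by (rule continuous_on_cong[THEN iffD2, OF refl _ continuous_on_const]) (rule const)
  moreover have "AE x in lborel. \<bar>u t x\<bar> \<le> 0"
    using \<open>AE x in lborel. u t x = 0\<close> by simp
  ultimately have "\<bar>u t x\<bar> \<le> 0"
    by (rule continuous_AE_bound)
  then show ?thesis
    by simp
qed

text \<open>
  At a fixed point the pressure is a quadratic form in \<open>u\<close> and \<open>v\<close> with a bounded weight.
\<close>

lemma pressure_continuous:
  assumes "t \<in> {-T..T}"
  shows "((\<lambda>s. pressure s 0) \<longlongrightarrow> pressure t 0) (at t within {-T..T})"
proof -
  have w: "(\<lambda>y. green (0 - y)) \<in> borel_measurable borel" "\<And>y. \<bar>green (0 - y)\<bar> \<le> 1"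
    using abs_green_le by auto
  have eq: "pressure s 0 = (\<integral>y. green (0 - y) * (u s y * u s y) \<partial>lborel) + 1/2 * (\<integral>y. green (0 - y) * (v s y * v s y) \<partial>lborel)"
    if "s \<in> {-T..T}" for s
  proof -
    have "integrable lborel (\<lambda>y. green (0 - y) * (u s y * u s y))" "integrable lborel (\<lambda>y. green (0 - y) * (v s y * v s y))"
      by (intro L2_integrable_weighted_mult[OF _ _ w] u_L2 v_L2 that)+
    then show ?thesis
      by (simp add: inv_helmholtz_eq_convol convol_def source_term_def power2_eq_square distrib_left)
  qed
  have "((\<lambda>s. (\<integral>y. green (0 - y) * (u s y * u s y) \<partial>lborel) + 1/2 * (\<integral>y. green (0 - y) * (v s y * v s y) \<partial>lborel))
      \<longlongrightarrow> pressure t 0) (at t within {-T..T})"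
    unfolding eq[OF assms] using assms
    by (intro tendsto_add tendsto_mult tendsto_const tendsto_L2_integral[OF _ _ w] u_cont v_cont)
  then show ?thesis
    by (rule Lim_transform_eventually) (auto simp: eventually_at_filter eq)
qed

lemma ut_L2: "t \<in> {-T<..<T} \<Longrightarrow> ut t \<in> L2"
  using time_deriv by (auto simp: tendsto_L2_def)

end

section \<open>Uniqueness of the zero solution\<close>

text \<open>
  The functions \<open>G n\<close> are differentiable approximations of \<open>N\<close>. In the limit, \<open>N\<close> is at most \<open>C K\<close>,
  where \<open>K\<close> is the integral of \<open>N\<close>; so \<open>e\<^bsup>-C s\<^esup> K\<close> is nonincreasing and starts at \<open>0\<close>.
\<close>

lemma Gronwall_approx:
  fixes N :: "real \<Rightarrow> real" and G G' :: "nat \<Rightarrow> real \<Rightarrow> real"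
  assumes b: "0 \<le> b" and N: "continuous_on {0..b} N" "\<And>t. t \<in> {0..b} \<Longrightarrow> 0 \<le> N t" and C: "0 \<le> C"
    and G: "\<And>n t. t \<in> {0..b} \<Longrightarrow> (G n has_real_derivative G' n t) (at t)"
    and le: "\<And>n t. t \<in> {0..b} \<Longrightarrow> G' n t \<le> C * N t"
    and G0: "\<And>n. G n 0 = 0"
    and lim: "\<And>t. t \<in> {0..b} \<Longrightarrow> (\<lambda>n. G n t) \<longlonglongrightarrow> N t"
    and t: "t \<in> {0..b}"
  shows "N t = 0"
proof -
  define K where "K s = integral {0..s} N" for s
  have K_deriv: "(K has_real_derivative N s) (at s within {0..b})" if "s \<in> {0..b}" for s
    unfolding K_def[abs_def] by (rule integral_has_real_derivative[OF N(1) that])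
  have K0: "K 0 = 0"
    by (simp add: K_def)
  have mono: "h 0 \<le> h s"
    if h: "\<And>s. s \<in> {0..b} \<Longrightarrow> (h has_real_derivative h' s) (at s within {0..b})"
      and nonneg: "\<And>s. s \<in> {0..b} \<Longrightarrow> 0 \<le> h' s" and s: "s \<in> {0..b}" for h h' :: "real \<Rightarrow> real" and s
  proof (rule DERIV_nonneg_imp_increasing_open[where f = h and a = 0 and b = s])
    show "0 \<le> s"
      using s by simp
    have "continuous_on {0..b} h"
      using h by (rule DERIV_continuous_on)
    then show "continuous_on {0..s} h"
      by (rule continuous_on_subset) (use s in auto)
    fix x assume x: "0 < x" "x < s"
    then have "x \<in> {0..b}"
      using s by auto
    moreover have "at x within {0..b} = at x"
      using x s by (intro at_within_interior) auto
    ultimately show "\<exists>y. (h has_real_derivative y) (at x) \<and> 0 \<le> y"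
      using h[of x] nonneg[of x] by auto
  qed
  have N_le: "N s \<le> C * K s" if s: "s \<in> {0..b}" for s
  proof -
    have "G n s \<le> C * K s" for n
    proof -
      have "C * K 0 - G n 0 \<le> C * K s - G n s"
      proof (rule mono[where h' = "\<lambda>s. C * N s - G' n s"])
        fix r assume r: "r \<in> {0..b}"
        show "((\<lambda>s. C * K s - G n s) has_real_derivative C * N r - G' n r) (at r within {0..b})"
          by (intro DERIV_diff DERIV_cmult K_deriv has_field_derivative_at_within[OF G] r)
        show "0 \<le> C * N r - G' n r"
          using le[OF r] by simp
      qed (rule s)
      then show ?thesis
        by (simp add: K0 G0)
    qed
    then show ?thesis
      by (intro LIMSEQ_le_const2[OF lim[OF s]]) auto
  qed
  have "- (exp (- C * 0) * K 0) \<le> - (exp (- C * t) * K t)"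
  proof (rule mono[where h' = "\<lambda>s. exp (- C * s) * (C * K s - N s)"])
    fix r assume r: "r \<in> {0..b}"
    show "((\<lambda>s. - (exp (- C * s) * K s)) has_real_derivative exp (- C * r) * (C * K r - N r)) (at r within {0..b})"
      using K_deriv[OF r] by (auto intro!: derivative_eq_intros simp: algebra_simps)
    show "0 \<le> exp (- C * r) * (C * K r - N r)"
      using N_le[OF r] by simp
  qed (rule t)
  then have "K t \<le> 0"
    by (simp add: K0 mult_le_0_iff)
  then have "C * K t \<le> 0"
    using C by (simp add: mult_nonneg_nonpos)
  then show ?thesis
    using N_le[OF t] N(2)[OF t] by simp
qed

context camassa_holm_flow
begin

lemma pressure_deriv_L2: "t \<in> {-T..T} \<Longrightarrow> pressure_deriv t \<in> L2"
  using has_L2_derivD(2)[OF inv_helmholtz_has_L2_deriv[OF source_integrable]] .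

lemma u_Lipschitz: "t \<in> {-T..T} \<Longrightarrow> \<bar>u t (x + h) - u t x\<bar> \<le> M * \<bar>h\<bar>"
  by (intro has_L2_deriv_Lipschitz[OF deriv] v_le M_nonneg)

text \<open>The transport term drops out because \<open>\<integral> u\<^sup>2 \<partial>\<^sub>x u = 0\<close>.\<close>

lemma L2_energy_derivative:
  assumes t: "t \<in> {-T<..<T}"
  shows "\<exists>D. ((\<lambda>t. \<integral>x. (u t x)\<^sup>2 \<partial>lborel) has_real_derivative D) (at t) \<and> \<bar>D\<bar> \<le> 2 * M * energy t"
proof (intro exI conjI)
  have tI: "t \<in> {-T..T}"
    using t by auto
  let ?D = "pressure_deriv t"
  note L2 = u_L2[OF tI] v_L2[OF tI]
  have "\<forall>\<^sub>F h in at 0. u (t + h) \<in> L2"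
    using eventually_interval[OF t] by eventually_elim (rule u_L2, auto)
  then show "((\<lambda>t. \<integral>x. (u t x)\<^sup>2 \<partial>lborel) has_real_derivative 2 * (\<integral>x. u t x * ut t x \<partial>lborel)) (at t)"
    by (rule L2_curve_derivative_square[OF time_deriv[OF t] _ u_L2[OF tI]])
  have cube: "(\<integral>x. u t x * (u t x * v t x) \<partial>lborel) = 0"
    using integral_deriv_square_mult[OF deriv[OF tI] deriv[OF tI] u_le[OF tI] u_le[OF tI]]
    by (simp add: ac_simps)
  have int: "integrable lborel (\<lambda>x. u t x * (u t x * v t x))" "integrable lborel (\<lambda>x. u t x * ?D x)"
    using L2_integrable_weighted_mult[OF L2 u_measurable[OF tI] u_le[OF tI]]
      L2_integrable_mult[OF L2(1) pressure_deriv_L2[OF tI]] by auto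
  have "(\<integral>x. u t x * ut t x \<partial>lborel) = (\<integral>x. - (u t x * (u t x * v t x)) - u t x * ?D x \<partial>lborel)"
  proof (rule integral_cong_AE)
    show "AE x in lborel. u t x * ut t x = - (u t x * (u t x * v t x)) - u t x * ?D x"
      using equation[OF t]
    proof eventually_elim
      case (elim x)
      show ?case
        unfolding elim by (simp add: algebra_simps)
    qed
  qed (use L2 ut_L2[OF t] pressure_deriv_L2[OF tI] in \<open>auto dest!: L2_measurable\<close>)
  also have "\<dots> = - (\<integral>x. u t x * ?D x \<partial>lborel)"
    using int cube by simp
  finally have "\<bar>2 * (\<integral>x. u t x * ut t x \<partial>lborel)\<bar> = 2 * \<bar>\<integral>x. u t x * ?D x \<partial>lborel\<bar>"
    by simp
  also have "\<dots> \<le> 2 * (\<integral>x. \<bar>u t x * ?D x\<bar> \<partial>lborel)"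
    by (intro mult_left_mono integral_abs_bound) simp
  also have "\<dots> \<le> 2 * (\<integral>x. M * \<bar>?D x\<bar> \<partial>lborel)"
  proof (intro mult_left_mono integral_mono)
    show "integrable lborel (\<lambda>x. \<bar>u t x * ?D x\<bar>)"
      using int by simp
    show "integrable lborel (\<lambda>x. M * \<bar>?D x\<bar>)"
      using inv_helmholtz_deriv_integrable[OF source_integrable[OF tI]] by simp
    show "\<bar>u t x * ?D x\<bar> \<le> M * \<bar>?D x\<bar>" for x
      unfolding abs_mult by (intro mult_right_mono u_le tI) simp
  qed simp
  also have "\<dots> = 2 * M * (\<integral>x. \<bar>?D x\<bar> \<partial>lborel)"
    by simp
  also have "\<dots> \<le> 2 * M * energy t"
    using M_nonneg inv_helmholtz_deriv_L1_le[OF source_integrable[OF tI]] source_integral_le[OF tI]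
    by (intro mult_left_mono) auto
  finally show "\<bar>2 * (\<integral>x. u t x * ut t x \<partial>lborel)\<bar> \<le> 2 * M * energy t" .
qed

definition increment :: "real \<Rightarrow> real \<Rightarrow> real \<Rightarrow> real" where
  "increment k t x = u t (x + k) - u t x"

lemma increment_L2: "t \<in> {-T..T} \<Longrightarrow> increment k t \<in> L2"
  unfolding increment_def[abs_def] by (intro L2_diff L2_shift[OF u_L2] u_L2)

lemma increment_norm_le:
  assumes t: "t \<in> {-T..T}" and k: "0 < k"
  shows "(\<integral>x. (increment k t x)\<^sup>2 \<partial>lborel) \<le> k\<^sup>2 * (L2_norm (v t))\<^sup>2"
proof -
  have "(\<integral>x. (increment k t x)\<^sup>2 \<partial>lborel) = k\<^sup>2 * (\<integral>x. ((u t (x + k) - u t x) / k)\<^sup>2 \<partial>lborel)"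
    using k by (simp add: increment_def power_divide)
  also have "\<dots> \<le> k\<^sup>2 * (L2_norm (v t))\<^sup>2"
    unfolding L2_norm_square using k by (intro mult_left_mono diff_quotient_L2_norm_le[OF deriv[OF t]]) auto
  finally show ?thesis .
qed

text \<open>
  With \<open>w\<close> the increment and \<open>m\<close> the mean of \<open>u\<close> and its translate, the increment of \<open>u \<partial>\<^sub>x u\<close> is
  \<open>(m w)'\<close>, and \<open>\<integral> w (m w)' = 1/2 \<integral> w\<^sup>2 m'\<close>. Expanded, the two sides of the last
  identity differ by a combination of integrals \<open>\<integral> (f\<^sup>2 g)' = 0\<close>, where \<open>f\<close> and \<open>g\<close> are \<open>u\<close> or its
  translate.
\<close>

lemma increment_transport:
  fixes k :: real
  assumes t: "t \<in> {-T..T}"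
  defines "g \<equiv> \<lambda>x. u t (x + k)" and "g' \<equiv> \<lambda>x. v t (x + k)"
  shows "integrable lborel (\<lambda>x. increment k t x * (g x * g' x - u t x * v t x))"
    and "\<bar>\<integral>x. increment k t x * (g x * g' x - u t x * v t x) \<partial>lborel\<bar>
      \<le> 1/2 * M * (\<integral>x. (increment k t x)\<^sup>2 \<partial>lborel)"
proof -
  let ?f = "u t" and ?f' = "v t"
  note df = deriv[OF t]
  have dg: "has_L2_deriv g g'"
    unfolding g_def g'_def by (rule has_L2_deriv_shift[OF df])
  note L2 = has_L2_derivD[OF df] has_L2_derivD[OF dg]
  have f_le: "\<bar>?f x\<bar> \<le> M" and g_le: "\<bar>g x\<bar> \<le> M" for x
    using u_le[OF t] by (auto simp: g_def)
  have meas [measurable]: "?f \<in> borel_measurable borel" "g \<in> borel_measurable borel"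
    "?f' \<in> borel_measurable borel" "g' \<in> borel_measurable borel"
    using L2 by (auto intro: L2_measurable)
  note wf = L2_integrable_weighted_mult[OF _ _ meas(1) f_le]
  note wg = L2_integrable_weighted_mult[OF _ _ meas(2) g_le]
  note int = wf[OF L2(1,2)] wf[OF L2(1,4)] wf[OF L2(3,2)] wf[OF L2(3,4)] wg[OF L2(3,2)] wg[OF L2(3,4)]
  have zero: "(\<integral>x. ?f x * (?f x * ?f' x) \<partial>lborel) = 0" "(\<integral>x. g x * (g x * g' x) \<partial>lborel) = 0"
    and mixed: "(\<integral>x. ?f x * (?f x * g' x) \<partial>lborel) = - 2 * (\<integral>x. ?f x * (g x * ?f' x) \<partial>lborel)"
      "(\<integral>x. g x * (g x * ?f' x) \<partial>lborel) = - 2 * (\<integral>x. ?f x * (g x * g' x) \<partial>lborel)"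
    using integral_deriv_square_mult[OF df df f_le f_le] integral_deriv_square_mult[OF dg dg g_le g_le]
      integral_deriv_square_mult[OF df dg f_le g_le] integral_deriv_square_mult[OF dg df g_le f_le]
    by (simp_all add: ac_simps)
  \<comment> \<open>Monomials are written with a bounded first factor and two square integrable ones.\<close>
  have e1: "increment k t x * (g x * g' x - ?f x * ?f' x) =
      g x * (g x * g' x) - ?f x * (g x * ?f' x) - ?f x * (g x * g' x) + ?f x * (?f x * ?f' x)" for x
    by (simp add: increment_def g_def algebra_simps)
  show "integrable lborel (\<lambda>x. increment k t x * (g x * g' x - ?f x * ?f' x))"
    unfolding e1 using int by simp
  have e2: "(increment k t x)\<^sup>2 * (g' x + ?f' x) =
      g x * (g x * g' x) + g x * (g x * ?f' x) - 2 * (?f x * (g x * g' x)) - 2 * (?f x * (g x * ?f' x))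
      + ?f x * (?f x * g' x) + ?f x * (?f x * ?f' x)" for x
    by (simp add: increment_def g_def power2_eq_square algebra_simps)
  have int2: "integrable lborel (\<lambda>x. (increment k t x)\<^sup>2 * (g' x + ?f' x))"
    unfolding e2 using int by simp
  have "(\<integral>x. increment k t x * (g x * g' x - ?f x * ?f' x) \<partial>lborel)
      = 1/4 * (\<integral>x. (increment k t x)\<^sup>2 * (g' x + ?f' x) \<partial>lborel)"
    unfolding e1 e2 using int zero mixed by simp
  then have "\<bar>\<integral>x. increment k t x * (g x * g' x - ?f x * ?f' x) \<partial>lborel\<bar>
      = 1/4 * \<bar>\<integral>x. (increment k t x)\<^sup>2 * (g' x + ?f' x) \<partial>lborel\<bar>"
    by simp
  also have "\<dots> \<le> 1/4 * (\<integral>x. \<bar>(increment k t x)\<^sup>2 * (g' x + ?f' x)\<bar> \<partial>lborel)"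
    by (intro mult_left_mono integral_abs_bound) simp
  also have "\<dots> \<le> 1/4 * (\<integral>x. 2 * M * (increment k t x)\<^sup>2 \<partial>lborel)"
  proof (intro mult_left_mono integral_mono_AE)
    show "integrable lborel (\<lambda>x. \<bar>(increment k t x)\<^sup>2 * (g' x + ?f' x)\<bar>)"
      using int2 by simp
    show "integrable lborel (\<lambda>x. 2 * M * (increment k t x)\<^sup>2)"
      using L2_integrable_square[OF increment_L2[OF t]] by simp
    have "AE x in lborel. \<bar>?f' (k + 1 * x)\<bar> \<le> M"
      using v_le[OF t] by (intro AE_borel_affine[where P = "\<lambda>x. \<bar>?f' x\<bar> \<le> M"]) auto
    with v_le[OF t]
    show "AE x in lborel. \<bar>(increment k t x)\<^sup>2 * (g' x + ?f' x)\<bar> \<le> 2 * M * (increment k t x)\<^sup>2"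
    proof eventually_elim
      case (elim x)
      then have "\<bar>g' x + ?f' x\<bar> \<le> 2 * M"
        by (simp add: g'_def add.commute)
      then have "(increment k t x)\<^sup>2 * \<bar>g' x + ?f' x\<bar> \<le> (increment k t x)\<^sup>2 * (2 * M)"
        by (intro mult_left_mono) auto
      then show ?case
        by (simp add: abs_mult mult.commute)
    qed
  qed simp
  finally show "\<bar>\<integral>x. increment k t x * (g x * g' x - u t x * v t x) \<partial>lborel\<bar>
      \<le> 1/2 * M * (\<integral>x. (increment k t x)\<^sup>2 \<partial>lborel)"
    by simp
qed

text \<open>
  Each factor contributes one power of \<open>k\<close>: the increment of \<open>u\<close> is small uniformly, that of the
  derivative of the pressure in \<open>L\<^sup>1\<close>.
\<close>

lemma increment_pressure:
  assumes t: "t \<in> {-T..T}" and k: "0 < k" "k \<le> 1"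
  shows "\<bar>\<integral>x. increment k t x * (pressure_deriv t (x + k) - pressure_deriv t x) \<partial>lborel\<bar> \<le> 5 * M * k\<^sup>2 * energy t"
proof -
  let ?D = "pressure_deriv t"
  have int: "integrable lborel ?D"
    by (rule inv_helmholtz_deriv_integrable[OF source_integrable[OF t]])
  have DL2: "(\<lambda>x. ?D (x + k) - ?D x) \<in> L2"
    by (intro L2_diff L2_shift[OF pressure_deriv_L2] pressure_deriv_L2 t)
  have "\<bar>\<integral>x. increment k t x * (?D (x + k) - ?D x) \<partial>lborel\<bar> \<le> (\<integral>x. \<bar>increment k t x * (?D (x + k) - ?D x)\<bar> \<partial>lborel)"
    by (rule integral_abs_bound)
  also have "\<dots> \<le> (\<integral>x. M * k * \<bar>?D (x + k) - ?D x\<bar> \<partial>lborel)"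
  proof (rule integral_mono)
    show "integrable lborel (\<lambda>x. \<bar>increment k t x * (?D (x + k) - ?D x)\<bar>)"
      by (intro integrable_abs L2_integrable_mult increment_L2 t DL2)
    show "integrable lborel (\<lambda>x. M * k * \<bar>?D (x + k) - ?D x\<bar>)"
      using int integrable_shift[OF int, of k] by simp
    show "\<bar>increment k t x * (?D (x + k) - ?D x)\<bar> \<le> M * k * \<bar>?D (x + k) - ?D x\<bar>" for x
      unfolding abs_mult increment_def using u_Lipschitz[OF t, of x k] k by (intro mult_right_mono) auto
  qed
  also have "\<dots> = M * k * (\<integral>x. \<bar>?D (x + k) - ?D x\<bar> \<partial>lborel)"
    by simp
  also have "\<dots> \<le> M * k * (5 * k * energy t)"
  proof (intro mult_left_mono)
    have "5 * k * (\<integral>x. \<bar>source t x\<bar> \<partial>lborel) \<le> 5 * k * energy t"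
      using source_integral_le[OF t] k by (intro mult_left_mono) auto
    then show "(\<integral>x. \<bar>?D (x + k) - ?D x\<bar> \<partial>lborel) \<le> 5 * k * energy t"
      using inv_helmholtz_deriv_shift_L1_le[OF source_integrable[OF t] k] by linarith
  qed (use M_nonneg k in auto)
  finally show ?thesis
    by (simp add: power2_eq_square mult.assoc mult.left_commute)
qed

lemma increment_energy_derivative:
  assumes t: "t \<in> {-T<..<T}" and k: "0 < k" "k \<le> 1"
  shows "\<exists>D. ((\<lambda>t. \<integral>x. (increment k t x)\<^sup>2 \<partial>lborel) has_real_derivative D) (at t) \<and> \<bar>D\<bar> \<le> 11 * M * k\<^sup>2 * energy t"
proof (intro exI conjI)
  have tI: "t \<in> {-T..T}"
    using t by auto
  let ?D = "pressure_deriv t"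
  let ?V = "\<lambda>x. ut t (x + k) - ut t x"
  let ?a = "\<lambda>x. u t (x + k) * v t (x + k) - u t x * v t x" and ?b = "\<lambda>x. ?D (x + k) - ?D x"
  have "tendsto_L2 (\<lambda>h x. (u (t + h) (x + k) - u t (x + k)) / h - (u (t + h) x - u t x) / h) ?V (at 0)"
    by (intro tendsto_L2_diff tendsto_L2_shift[OF time_deriv[OF t]] time_deriv[OF t])
  moreover have "(u (t + h) (x + k) - u t (x + k)) / h - (u (t + h) x - u t x) / h
      = (increment k (t + h) x - increment k t x) / h" for h x
    by (simp add: increment_def algebra_simps flip: diff_divide_distrib)
  ultimately have dq: "tendsto_L2 (\<lambda>h x. (increment k (t + h) x - increment k t x) / h) ?V (at 0)"
    by simp
  have "\<forall>\<^sub>F h in at 0. increment k (t + h) \<in> L2"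
    using eventually_interval[OF t] by eventually_elim (rule increment_L2, auto)
  then show "((\<lambda>t. \<integral>x. (increment k t x)\<^sup>2 \<partial>lborel) has_real_derivative
      2 * (\<integral>x. increment k t x * ?V x \<partial>lborel)) (at t)"
    by (rule L2_curve_derivative_square[OF dq _ increment_L2[OF tI]])
  have meas [measurable]: "ut t \<in> borel_measurable borel" "u t \<in> borel_measurable borel"
    "v t \<in> borel_measurable borel" "?D \<in> borel_measurable borel" "increment k t \<in> borel_measurable borel"
    using ut_L2[OF t] u_L2[OF tI] v_L2[OF tI] pressure_deriv_L2[OF tI] increment_L2[OF tI] by (auto dest: L2_measurable)
  have eq: "AE x in lborel. ut t (k + 1 * x) = - (u t (k + 1 * x) * v t (k + 1 * x) + ?D (k + 1 * x))"
    using equation[OF t] by (intro AE_borel_affine[where P = "\<lambda>x. ut t x = - (u t x * v t x + ?D x)"]) auto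
  have "(\<integral>x. increment k t x * ?V x \<partial>lborel) = (\<integral>x. - (increment k t x * ?a x) - increment k t x * ?b x \<partial>lborel)"
  proof (rule integral_cong_AE)
    show "AE x in lborel. increment k t x * ?V x = - (increment k t x * ?a x) - increment k t x * ?b x"
      using equation[OF t] eq
    proof eventually_elim
      case (elim x)
      have shifted: "ut t (x + k) = - (u t (x + k) * v t (x + k) + ?D (x + k))"
        using elim(2) by (simp add: add.commute)
      show ?case
        unfolding elim(1) shifted by (simp add: algebra_simps)
    qed
  qed simp_all
  also have "\<dots> = - (\<integral>x. increment k t x * ?a x \<partial>lborel) - (\<integral>x. increment k t x * ?b x \<partial>lborel)"
  proof -
    have "integrable lborel (\<lambda>x. increment k t x * ?b x)"
      by (intro L2_integrable_mult increment_L2 L2_diff L2_shift[OF pressure_deriv_L2] pressure_deriv_L2 tI)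
    then show ?thesis
      using increment_transport(1)[OF tI, of k] by simp
  qed
  finally have "\<bar>2 * (\<integral>x. increment k t x * ?V x \<partial>lborel)\<bar>
      \<le> 2 * (1/2 * M * (\<integral>x. (increment k t x)\<^sup>2 \<partial>lborel)) + 2 * (5 * M * k\<^sup>2 * energy t)"
    using increment_transport(2)[OF tI, of k] increment_pressure[OF tI k] by linarith
  also have "\<dots> \<le> M * (k\<^sup>2 * energy t) + 2 * (5 * M * k\<^sup>2 * energy t)"
  proof -
    have "k\<^sup>2 * (L2_norm (v t))\<^sup>2 \<le> k\<^sup>2 * energy t"
      by (intro mult_left_mono) (auto simp: energy_def)
    then have "M * (\<integral>x. (increment k t x)\<^sup>2 \<partial>lborel) \<le> M * (k\<^sup>2 * energy t)"
      using increment_norm_le[OF tI k(1)] M_nonneg by (intro mult_left_mono) auto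
    then show ?thesis
      by linarith
  qed
  also have "\<dots> = 11 * M * k\<^sup>2 * energy t"
    by simp
  finally show "\<bar>2 * (\<integral>x. increment k t x * ?V x \<partial>lborel)\<bar> \<le> 11 * M * k\<^sup>2 * energy t" .
qed

text \<open>
  The energy with the derivative replaced by a difference quotient is differentiable in time,
  which is not clear for \<^term>\<open>energy\<close> itself.
\<close>

definition discrete_energy :: "real \<Rightarrow> real \<Rightarrow> real" where
  "discrete_energy k t = (\<integral>x. (u t x)\<^sup>2 \<partial>lborel) + (\<integral>x. (increment k t x)\<^sup>2 \<partial>lborel) / k\<^sup>2"

lemma discrete_energy_derivative:
  assumes t: "t \<in> {-T<..<T}" and k: "0 < k" "k \<le> 1"
  shows "\<exists>D. (discrete_energy k has_real_derivative D) (at t) \<and> \<bar>D\<bar> \<le> 13 * M * energy t"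
proof -
  obtain D1 where D1: "((\<lambda>t. \<integral>x. (u t x)\<^sup>2 \<partial>lborel) has_real_derivative D1) (at t)" "\<bar>D1\<bar> \<le> 2 * M * energy t"
    using L2_energy_derivative[OF t] by blast
  obtain D2 where D2: "((\<lambda>t. \<integral>x. (increment k t x)\<^sup>2 \<partial>lborel) has_real_derivative D2) (at t)"
    "\<bar>D2\<bar> \<le> 11 * M * k\<^sup>2 * energy t"
    using increment_energy_derivative[OF t k] by blast
  have "(discrete_energy k has_real_derivative D1 + D2 / k\<^sup>2) (at t)"
    unfolding discrete_energy_def[abs_def] by (intro DERIV_add DERIV_cdivide D1 D2)
  moreover have "\<bar>D1 + D2 / k\<^sup>2\<bar> \<le> 13 * M * energy t"
  proof -
    have "\<bar>D2 / k\<^sup>2\<bar> \<le> 11 * M * energy t"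
      using D2(2) k by (simp add: abs_divide divide_le_eq ac_simps)
    then show ?thesis
      using D1(2) by linarith
  qed
  ultimately show ?thesis
    by blast
qed

lemma discrete_energy_tendsto:
  assumes t: "t \<in> {-T..T}"
  shows "(\<lambda>n. discrete_energy (width n) t) \<longlonglongrightarrow> energy t"
proof -
  have "filterlim width (at 0) sequentially"
    unfolding filterlim_at using width_tendsto by (auto intro!: always_eventually simp: less_imp_neq[OF width_pos, symmetric])
  from filterlim_compose[OF tendsto_L2_norm[OF tendsto_L2_diff_quotient[OF deriv[OF t]]] this]
  have "(\<lambda>n. (L2_norm (\<lambda>x. (u t (x + width n) - u t x) / width n))\<^sup>2) \<longlonglongrightarrow> (L2_norm (v t))\<^sup>2"
    by (rule tendsto_power)
  moreover have "(L2_norm (\<lambda>x. (u t (x + width n) - u t x) / width n))\<^sup>2 = (\<integral>x. (increment (width n) t x)\<^sup>2 \<partial>lborel) / (width n)\<^sup>2" for n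
    by (simp add: L2_norm_square increment_def power_divide)
  ultimately show ?thesis
    unfolding discrete_energy_def energy_def L2_norm_square[of "u t"] by (intro tendsto_add tendsto_const) simp
qed

text \<open>
  The estimates are symmetric in time, so negative times are treated by reflection; the end
  points follow by continuity of the energy.
\<close>

lemma zero_if_zero_initially:
  assumes zero: "\<And>x. u 0 x = 0" and t: "t \<in> {-T..T}"
  shows "u t x = 0"
proof -
  have init: "discrete_energy k 0 = 0" for k
    by (simp add: discrete_energy_def increment_def zero)
  define D where "D n = deriv (discrete_energy (width n))" for n
  have D: "(discrete_energy (width n) has_real_derivative D n t) (at t)" "\<bar>D n t\<bar> \<le> 13 * M * energy t"
    if "t \<in> {-T<..<T}" for n t
    using discrete_energy_derivative[OF that width_pos[of n] width_le_1]
    by (auto simp: D_def DERIV_imp_deriv)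
  have interior: "energy t = 0" if t: "t \<in> {-T<..<T}" for t
  proof (cases "0 \<le> t")
    case True
    show ?thesis
    proof (rule Gronwall_approx[where b = t and t = t and N = energy and G = "\<lambda>n. discrete_energy (width n)" and G' = D and C = "13 * M"])
      show "continuous_on {0..t} energy"
        by (rule continuous_on_subset[OF energy_continuous]) (use t in auto)
      show "D n s \<le> 13 * M * energy s" if "s \<in> {0..t}" for n s
        using D(2)[of s n] that t by auto
    qed (use t True D(1) init M_nonneg energy_nonneg discrete_energy_tendsto in auto)
  next
    case False
    have "energy (- (- t)) = 0"
    proof (rule Gronwall_approx[where b = "- t" and t = "- t" and G = "\<lambda>n s. discrete_energy (width n) (- s)"
          and G' = "\<lambda>n s. - D n (- s)" and C = "13 * M" and N = "\<lambda>s. energy (- s)"])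
      show "continuous_on {0..- t} (\<lambda>s. energy (- s))"
        by (rule continuous_on_compose2[OF energy_continuous]) (use t in \<open>auto intro: continuous_on_minus continuous_on_id\<close>)
      show "- D n (- s) \<le> 13 * M * energy (- s)" if "s \<in> {0..- t}" for n s
        using D(2)[of "- s" n] that t by auto
      show "((\<lambda>s. discrete_energy (width n) (- s)) has_real_derivative - D n (- s)) (at s)" if "s \<in> {0..- t}" for n s
      proof -
        have "- s \<in> {-T<..<T}"
          using that t by auto
        from DERIV_chain2[OF D(1)[OF this] DERIV_minus[OF DERIV_ident]] show ?thesis
          by simp
      qed
    qed (use t False init M_nonneg energy_nonneg discrete_energy_tendsto in auto)
    then show ?thesis
      by simp
  qed
  have "energy t = 0"
  proof -
    have "closure {-T<..<T} = {-T..T}"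
      using T by (intro closure_greaterThanLessThan) simp
    then have "\<And>x. x \<in> {-T..T} \<Longrightarrow> energy x = 0"
      using continuous_constant_on_closure[of "{-T<..<T}" energy 0] energy_continuous interior by auto
    then show ?thesis
      using t by blast
  qed
  then show ?thesis
    by (rule energy_eq_0D[OF t])
qed

end

section \<open>Decay at two times forces vanishing initial data\<close>

lemma increase_ge:
  fixes \<Phi> \<Phi>' :: "real \<Rightarrow> real"
  assumes "a \<le> b" "continuous_on {a..b} \<Phi>"
    and deriv: "\<And>t. a < t \<Longrightarrow> t < b \<Longrightarrow> (\<Phi> has_real_derivative \<Phi>' t) (at t)"
    and ge: "\<And>t. a < t \<Longrightarrow> t < b \<Longrightarrow> m \<le> \<Phi>' t"
  shows "m * (b - a) \<le> \<Phi> b - \<Phi> a"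
proof -
  have "\<Phi> a - m * a \<le> \<Phi> b - m * b"
  proof (rule DERIV_nonneg_imp_increasing_open[where f = "\<lambda>t. \<Phi> t - m * t"])
    fix t assume t: "a < t" "t < b"
    have "((\<lambda>t. \<Phi> t - m * t) has_real_derivative \<Phi>' t - m * 1) (at t)"
      by (intro DERIV_diff deriv t DERIV_cmult DERIV_ident)
    then show "\<exists>y. ((\<lambda>t. \<Phi> t - m * t) has_real_derivative y) (at t) \<and> 0 \<le> y"
      using ge[OF t] by auto
  qed (use assms(1,2) in \<open>auto intro: continuous_on_diff continuous_on_mult_left continuous_on_id\<close>)
  then show ?thesis
    by (simp add: algebra_simps)
qed

context camassa_holm_flow
begin

text \<open>
  The equation as a conservation law with flux \<open>u\<^sup>2/2 + P\<close>.
\<close>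

lemma u_test_derivative:
  assumes t: "t \<in> {-T<..<T}" and \<phi>: "\<phi> \<in> test_fun"
  shows "((\<lambda>t. \<integral>x. u t x * \<phi> x \<partial>lborel) has_real_derivative
    (\<integral>x. (1/2 * (u t x)\<^sup>2 + pressure t x) * deriv \<phi> x \<partial>lborel)) (at t)"
proof -
  have tI: "t \<in> {-T..T}"
    using t by auto
  let ?D = "pressure_deriv t"
  note L2 = u_L2[OF tI] v_L2[OF tI] test_fun_L2[OF \<phi>] test_fun_L2[OF deriv_test_fun[OF \<phi>]]
  have d\<phi>: "has_L2_deriv \<phi> (deriv \<phi>)"
    by (rule test_fun_has_L2_deriv[OF \<phi>])
  have dP: "has_L2_deriv (pressure t) ?D"
    by (rule inv_helmholtz_has_L2_deriv[OF source_integrable[OF tI]])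
  obtain B where B: "\<And>x. \<bar>\<phi> x\<bar> \<le> B"
    using test_fun_bounded[OF \<phi>] by blast
  have "\<forall>\<^sub>F h in at 0. u (t + h) \<in> L2"
    using eventually_interval[OF t] by eventually_elim (rule u_L2, auto)
  from L2_curve_derivative_linear[OF time_deriv[OF t] this L2(1,3)]
  have lhs: "((\<lambda>t. \<integral>x. u t x * \<phi> x \<partial>lborel) has_real_derivative (\<integral>x. ut t x * \<phi> x \<partial>lborel)) (at t)" .
  have int: "integrable lborel (\<lambda>x. u t x * (v t x * \<phi> x))" "integrable lborel (\<lambda>x. u t x * (u t x * deriv \<phi> x))"
    "integrable lborel (\<lambda>x. ?D x * \<phi> x)" "integrable lborel (\<lambda>x. pressure t x * deriv \<phi> x)"
    by (intro L2_integrable_weighted_mult[OF _ _ u_measurable[OF tI] u_le[OF tI]] L2_integrable_mult L2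
        has_L2_derivD[OF dP])+
  have "(\<integral>x. ut t x * \<phi> x \<partial>lborel) = (\<integral>x. - (u t x * (v t x * \<phi> x)) - ?D x * \<phi> x \<partial>lborel)"
  proof (rule integral_cong_AE)
    show "AE x in lborel. ut t x * \<phi> x = - (u t x * (v t x * \<phi> x)) - ?D x * \<phi> x"
      using equation[OF t]
    proof eventually_elim
      case (elim x)
      show ?case
        unfolding elim by (simp add: algebra_simps)
    qed
  qed (use L2 ut_L2[OF t] has_L2_derivD[OF dP] in \<open>auto dest!: L2_measurable\<close>)
  also have "\<dots> = - (\<integral>x. u t x * (v t x * \<phi> x) \<partial>lborel) - (\<integral>x. ?D x * \<phi> x \<partial>lborel)"
    using int by simp
  also have "(\<integral>x. ?D x * \<phi> x \<partial>lborel) = - (\<integral>x. pressure t x * deriv \<phi> x \<partial>lborel)"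
    using L2_integral_by_parts[OF dP d\<phi>] by simp
  also have "(\<integral>x. u t x * (v t x * \<phi> x) \<partial>lborel) = - 1/2 * (\<integral>x. u t x * (u t x * deriv \<phi> x) \<partial>lborel)"
    using integral_deriv_square_mult[OF deriv[OF tI] d\<phi> u_le[OF tI] B] by (simp add: mult.assoc)
  also have "- (- 1/2 * (\<integral>x. u t x * (u t x * deriv \<phi> x) \<partial>lborel)) - - (\<integral>x. pressure t x * deriv \<phi> x \<partial>lborel)
      = (\<integral>x. 1/2 * (u t x * (u t x * deriv \<phi> x)) + pressure t x * deriv \<phi> x \<partial>lborel)"
    using int by simp
  also have "\<dots> = (\<integral>x. (1/2 * (u t x)\<^sup>2 + pressure t x) * deriv \<phi> x \<partial>lborel)"
    by (intro Bochner_Integration.integral_cong) (auto simp: power2_eq_square algebra_simps)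
  finally show ?thesis
    using lhs by simp
qed

lemma u_test_continuous:
  assumes \<phi>: "\<phi> \<in> test_fun"
  shows "continuous_on {-T..T} (\<lambda>t. \<integral>x. u t x * \<phi> x \<partial>lborel)"
  unfolding continuous_on_def
proof
  fix t assume t: "t \<in> {-T..T}"
  show "((\<lambda>t. \<integral>x. u t x * \<phi> x \<partial>lborel) \<longlongrightarrow> (\<integral>x. u t x * \<phi> x \<partial>lborel)) (at t within {-T..T})"
    using tendsto_L2_integral[OF u_cont[OF t] tendsto_L2_const[OF test_fun_L2[OF \<phi>]], of "\<lambda>_. 1" 1] by simp
qed

lemma pressure_nonneg: "t \<in> {-T..T} \<Longrightarrow> 0 \<le> pressure t x"
  by (intro inv_helmholtz_nonneg source_integrable source_term_nonneg)

text \<open>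
  On the short ascent the flux is at least \<open>e\<^bsup>-y-1\<^esup>\<close> times the pressure at the origin; the long
  descent has slope of order \<open>1/L\<close> and meets a flux whose integral is bounded by the energy.
\<close>

lemma flux_plateau_ge:
  assumes t: "t \<in> {-T..T}" and y: "0 \<le> y" and L: "0 < L"
  shows "exp (- y - 1) * pressure t 0 - 2 * energy t / (step0 1 * L)
    \<le> (\<integral>x. (1/2 * (u t x)\<^sup>2 + pressure t x) * plateau_deriv y 1 (y + 1) L x \<partial>lborel)"
proof -
  let ?A = "\<lambda>x. 1/2 * (u t x)\<^sup>2 + pressure t x"
  let ?b = "\<lambda>x. bump ((x - (y + 1)) / L) / L"
  have intP: "integrable lborel (pressure t)"
    by (rule inv_helmholtz_integrable[OF source_integrable[OF t]])
  have A: "integrable lborel ?A"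
    using L2_integrable_square[OF u_L2[OF t]] intP by simp
  have A_nonneg: "0 \<le> ?A x" for x
    using pressure_nonneg[OF t, of x] by simp
  have A_le: "(\<integral>x. ?A x \<partial>lborel) \<le> 2 * energy t"
  proof -
    have "(\<integral>x. pressure t x \<partial>lborel) \<le> energy t"
      using inv_helmholtz_L1_le[OF source_integrable[OF t]] source_integral_le[OF t] pressure_nonneg[OF t] by simp
    moreover have "(\<integral>x. (u t x)\<^sup>2 \<partial>lborel) \<le> energy t"
      by (simp add: energy_def L2_norm_square)
    moreover have "(\<integral>x. ?A x \<partial>lborel) = 1/2 * (\<integral>x. (u t x)\<^sup>2 \<partial>lborel) + (\<integral>x. pressure t x \<partial>lborel)"
      using L2_integrable_square[OF u_L2[OF t]] intP by simp
    ultimately show ?thesis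
      using energy_nonneg[of t] by linarith
  qed
  have [measurable]: "u t \<in> borel_measurable borel" "pressure t \<in> borel_measurable borel"
    using u_measurable[OF t] borel_measurable_integrable[OF intP] by simp_all
  have int1: "integrable lborel (\<lambda>x. ?A x * bump (x - y))"
    using integrable_bounded_mult[OF A, of "\<lambda>x. bump (x - y)" "1 / step0 1"] bump_nonneg bump_le
    by (simp add: mult.commute)
  have int2: "integrable lborel (\<lambda>x. ?A x * ?b x)"
    using integrable_bounded_mult[OF A, of ?b "1 / step0 1 / L"] bump_nonneg divide_right_mono[OF bump_le, of L] L
    by (simp add: mult.commute)
  have "exp (- y - 1) * pressure t 0 = (\<integral>x. exp (- y - 1) * pressure t 0 * bump (x - y) \<partial>lborel)"
    using integral_shift[of bump "- y"] by (simp add: bump_integral_1)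
  also have "\<dots> \<le> (\<integral>x. ?A x * bump (x - y) \<partial>lborel)"
  proof (rule integral_mono)
    show "integrable lborel (\<lambda>x. exp (- y - 1) * pressure t 0 * bump (x - y))"
      using integrable_shift[OF bump_integrable, of "- y"] by simp
    fix x
    show "exp (- y - 1) * pressure t 0 * bump (x - y) \<le> ?A x * bump (x - y)"
    proof (cases "x - y \<le> 0 \<or> 1 \<le> x - y")
      case True
      then show ?thesis
        by (simp add: bump_eq_0)
    next
      case False
      then have "exp (- y - 1) \<le> exp (- \<bar>x\<bar>)"
        using y by simp
      then have "exp (- y - 1) * pressure t 0 \<le> exp (- \<bar>x\<bar>) * pressure t 0"
        by (intro mult_right_mono pressure_nonneg t)
      also have "\<dots> \<le> pressure t x"
        by (intro inv_helmholtz_Harnack source_integrable source_term_nonneg t)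
      also have "\<dots> \<le> ?A x"
        by simp
      finally show ?thesis
        by (intro mult_right_mono bump_nonneg)
    qed
  qed (rule int1)
  finally have 1: "exp (- y - 1) * pressure t 0 \<le> (\<integral>x. ?A x * bump (x - y) \<partial>lborel)" .
  have "(\<integral>x. ?A x * ?b x \<partial>lborel) \<le> (\<integral>x. ?A x * (1 / step0 1 / L) \<partial>lborel)"
    using A_nonneg bump_le L by (intro integral_mono int2 integrable_mult_left A mult_left_mono divide_right_mono) auto
  also have "\<dots> = (\<integral>x. ?A x \<partial>lborel) / (step0 1 * L)"
    by simp
  also have "\<dots> \<le> 2 * energy t / (step0 1 * L)"
    using A_le step0_1_pos L by (intro divide_right_mono) auto
  finally have 2: "(\<integral>x. ?A x * ?b x \<partial>lborel) \<le> 2 * energy t / (step0 1 * L)" .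
  have "(\<integral>x. ?A x * plateau_deriv y 1 (y + 1) L x \<partial>lborel)
      = (\<integral>x. ?A x * bump (x - y) \<partial>lborel) - (\<integral>x. ?A x * ?b x \<partial>lborel)"
    unfolding plateau_deriv_def right_diff_distrib using int1 int2 by simp
  with 1 2 show ?thesis
    by linarith
qed

text \<open>
  A plateau that starts at \<open>y\<close> sees \<open>u\<close> only on \<open>{y..}\<close>, where it is small compared with \<open>e\<^bsup>-x\<^esup>\<close>.
\<close>

lemma u_plateau_le:
  assumes t: "t \<in> {-T..T}" and L: "0 < L" and d: "\<And>x. y \<le> x \<Longrightarrow> \<bar>u t x\<bar> \<le> d * exp (- x)"
  shows "\<bar>\<integral>x. u t x * plateau y 1 (y + 1) L x \<partial>lborel\<bar> \<le> d * exp (- y)"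
proof -
  note exp = has_bochner_integral_exp_atLeast[of y]
  have d0: "0 \<le> d"
    using d[of y] by (metis abs_ge_zero exp_gt_zero order_refl order_trans zero_le_mult_iff not_less)
  let ?\<phi> = "plateau y 1 (y + 1) L"
  have \<phi>: "?\<phi> \<in> test_fun"
    using L by (intro plateau_test_fun) auto
  have "\<bar>\<integral>x. u t x * ?\<phi> x \<partial>lborel\<bar> \<le> (\<integral>x. \<bar>u t x * ?\<phi> x\<bar> \<partial>lborel)"
    by (rule integral_abs_bound)
  also have "\<dots> \<le> (\<integral>x. d * (indicator {y..} x * exp (- x)) \<partial>lborel)"
  proof (rule integral_mono)
    show "integrable lborel (\<lambda>x. \<bar>u t x * ?\<phi> x\<bar>)"
      by (intro integrable_abs L2_integrable_mult u_L2 t test_fun_L2 \<phi>)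
    show "integrable lborel (\<lambda>x. d * (indicator {y..} x * exp (- x)))"
      using exp by (intro integrable_mult_right) (simp add: has_bochner_integral_iff)
    fix x
    show "\<bar>u t x * ?\<phi> x\<bar> \<le> d * (indicator {y..} x * exp (- x))"
    proof (cases "y \<le> x")
      case True
      have "\<bar>u t x\<bar> * \<bar>?\<phi> x\<bar> \<le> (d * exp (- x)) * 1"
        using d[OF True] d0 by (intro mult_mono plateau_abs_le_1) auto
      then show ?thesis
        using True by (simp add: abs_mult)
    next
      case False
      then have "?\<phi> x = 0"
        using L by (intro plateau_eq_0) auto
      then show ?thesis
        using d0 by simp
    qed
  qed
  also have "\<dots> = d * exp (- y)"
    using exp by (simp add: has_bochner_integral_iff)
  finally show ?thesis .
qed

text \<open>
  If the pressure at the origin were positive at time \<open>0\<close>, it would be at least some \<open>c > 0\<close> up to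
  some time \<open>\<tau>\<close>, and the integral of \<open>u\<close> against a plateau starting at \<open>y\<close> would grow by about
  \<open>c \<tau> e\<^bsup>-y-1\<^esup>\<close> during \<open>[0, t1]\<close>, while at both ends of this interval it is \<open>o(e\<^sup>-\<^sup>y)\<close>.
\<close>

lemma pressure_0_eq_0:
  assumes t1: "0 < t1" "t1 \<le> T"
    and decay0: "(\<lambda>x. \<bar>u 0 x\<bar>) \<in> o[at_top](\<lambda>x. exp (- x))"
    and decay1: "(\<lambda>x. \<bar>u t1 x\<bar>) \<in> o[at_top](\<lambda>x. exp (- x))"
  shows "pressure 0 0 = 0"
proof (rule ccontr)
  assume "pressure 0 0 \<noteq> 0"
  moreover have zero_in: "0 \<in> {-T..T}" "t1 \<in> {-T..T}"
    using T t1 by auto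
  ultimately have pos: "0 < pressure 0 0"
    using pressure_nonneg[of 0 0] by simp
  define c where "c = pressure 0 0 / 2"
  have c: "0 < c" "c < pressure 0 0"
    using pos by (auto simp: c_def)
  from order_tendstoD(1)[OF pressure_continuous[OF zero_in(1)] c(2)]
  obtain r where r: "0 < r" "\<And>s. s \<in> {-T..T} \<Longrightarrow> s \<noteq> 0 \<Longrightarrow> \<bar>s\<bar> < r \<Longrightarrow> c < pressure s 0"
    by (auto simp: eventually_at)
  define \<tau> where "\<tau> = min r t1"
  have \<tau>: "0 < \<tau>" "\<tau> \<le> t1"
    using r(1) t1 by (auto simp: \<tau>_def)
  have c_less: "c < pressure s 0" if "0 < s" "s < \<tau>" for s
    using that t1 T by (intro r(2)) (auto simp: \<tau>_def)
  have "compact (energy ` {-T..T})"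
    by (intro compact_continuous_image energy_continuous compact_Icc)
  then have "bounded (energy ` {-T..T})"
    by (rule compact_imp_bounded)
  then obtain K where K: "0 < K" "\<And>s. s \<in> {-T..T} \<Longrightarrow> energy s \<le> K"
    unfolding bounded_pos by (auto simp: abs_le_iff)
  \<comment> \<open>The gain is \<open>c \<tau> e\<^bsup>-y-1\<^esup> = 8 d e\<^sup>-\<^sup>y\<close>. Against it stand the integrals of \<open>u\<close> at the two times,
    each at most \<open>d e\<^sup>-\<^sup>y\<close>, and the loss on the descent, which \<open>L\<close> below makes equal to \<open>d e\<^sup>-\<^sup>y\<close> in total.\<close>
  define d where "d = c * \<tau> * exp (- 1) / 8"
  have d: "0 < d"
    using c \<tau> by (simp add: d_def)
  have "\<forall>\<^sub>F x in at_top. \<bar>u 0 x\<bar> \<le> d * exp (- x)" "\<forall>\<^sub>F x in at_top. \<bar>u t1 x\<bar> \<le> d * exp (- x)"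
    using landau_o.smallD[OF decay0 d] landau_o.smallD[OF decay1 d] by simp_all
  then have "\<forall>\<^sub>F x in at_top. \<bar>u 0 x\<bar> \<le> d * exp (- x) \<and> \<bar>u t1 x\<bar> \<le> d * exp (- x)"
    by eventually_elim simp
  then obtain y0 where y0: "\<And>x. y0 \<le> x \<Longrightarrow> \<bar>u 0 x\<bar> \<le> d * exp (- x) \<and> \<bar>u t1 x\<bar> \<le> d * exp (- x)"
    by (auto simp: eventually_at_top_linorder)
  define y where "y = max y0 0"
  have y: "0 \<le> y" "y0 \<le> y"
    by (auto simp: y_def)
  define L where "L = 2 * K * t1 / (step0 1 * d * exp (- y))"
  have L: "0 < L"
    using K(1) t1 step0_1_pos d by (simp add: L_def)
  let ?\<phi> = "plateau y 1 (y + 1) L"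
  let ?\<Phi> = "\<lambda>t. \<integral>x. u t x * ?\<phi> x \<partial>lborel"
  let ?\<Phi>' = "\<lambda>t. \<integral>x. (1/2 * (u t x)\<^sup>2 + pressure t x) * deriv ?\<phi> x \<partial>lborel"
  have \<phi>: "?\<phi> \<in> test_fun"
    using L by (intro plateau_test_fun) auto
  define \<epsilon> where "\<epsilon> = d * exp (- y) / t1"
  have ge: "exp (- y - 1) * pressure t 0 - \<epsilon> \<le> ?\<Phi>' t" if "t \<in> {-T..T}" for t
  proof -
    have "2 * energy t / (step0 1 * L) \<le> 2 * K / (step0 1 * L)"
      using K(2)[OF that] step0_1_pos L by (intro divide_right_mono) auto
    also have "\<dots> = \<epsilon>"
      using K(1) t1 step0_1_pos d by (simp add: L_def \<epsilon>_def)
    finally show ?thesis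
      using flux_plateau_ge[OF that y(1) L] by (simp add: deriv_plateau)
  qed
  have deriv_\<Phi>: "(?\<Phi> has_real_derivative ?\<Phi>' t) (at t)" if "0 < t" "t < t1" for t
    using that t1 T by (intro u_test_derivative \<phi>) auto
  have cont: "continuous_on {a..b} ?\<Phi>" if "0 \<le> a" "b \<le> t1" for a b
    by (rule continuous_on_subset[OF u_test_continuous[OF \<phi>]]) (use that t1 T in auto)
  have "(exp (- y - 1) * c - \<epsilon>) * (\<tau> - 0) \<le> ?\<Phi> \<tau> - ?\<Phi> 0"
  proof (rule increase_ge[where \<Phi>' = ?\<Phi>'])
    fix t assume t: "0 < t" "t < \<tau>"
    have "exp (- y - 1) * c \<le> exp (- y - 1) * pressure t 0"
      using c_less[OF t] by simp
    moreover have "t \<in> {-T..T}"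
      using t \<tau> t1 by auto
    ultimately show "exp (- y - 1) * c - \<epsilon> \<le> ?\<Phi>' t"
      using ge[of t] by linarith
    show "(?\<Phi> has_real_derivative ?\<Phi>' t) (at t)"
      using t \<tau> by (intro deriv_\<Phi>) auto
  qed (use \<tau> cont in auto)
  moreover have "- \<epsilon> * (t1 - \<tau>) \<le> ?\<Phi> t1 - ?\<Phi> \<tau>"
  proof (rule increase_ge[where \<Phi>' = ?\<Phi>'])
    fix t assume t: "\<tau> < t" "t < t1"
    then have tI: "t \<in> {-T..T}"
      using \<tau> t1 by auto
    have "0 \<le> exp (- y - 1) * pressure t 0"
      using pressure_nonneg[OF tI] by simp
    then show "- \<epsilon> \<le> ?\<Phi>' t"
      using ge[OF tI] by linarith
    show "(?\<Phi> has_real_derivative ?\<Phi>' t) (at t)"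
      using t \<tau> by (intro deriv_\<Phi>) auto
  qed (use \<tau> cont in auto)
  ultimately have "exp (- y - 1) * c * \<tau> - \<epsilon> * t1 \<le> ?\<Phi> t1 - ?\<Phi> 0"
    by (simp add: algebra_simps)
  also have "\<dots> \<le> 2 * (d * exp (- y))"
    using u_plateau_le[OF zero_in(1) L, of y d] u_plateau_le[OF zero_in(2) L, of y d] y0 y(2)
    by (fastforce simp: abs_le_iff)
  finally have "exp (- y - 1) * c * \<tau> \<le> 3 * (d * exp (- y))"
    using t1 by (simp add: \<epsilon>_def)
  moreover have "exp (- y - 1) * c * \<tau> = 8 * (d * exp (- y))"
  proof -
    have "exp (- y - 1) = exp (- y) * exp (- 1)"
      by (simp flip: exp_add)
    then show ?thesis
      by (simp add: d_def)
  qed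
  moreover have "0 < d * exp (- y)"
    using d by simp
  ultimately show False
    by linarith
qed

lemma initially_zero:
  assumes "pressure 0 0 = 0"
  shows "u 0 x = 0"
proof -
  have t: "0 \<in> {-T..T}"
    using T by simp
  have F0: "AE x in lborel. source 0 x = 0"
    by (rule inv_helmholtz_eq_0D[OF source_integrable[OF t] source_term_nonneg assms])
  then have "(\<integral>x. \<bar>source 0 x\<bar> \<partial>lborel) = (\<integral>x. 0 \<partial>(lborel :: real measure))"
    by (intro integral_cong_AE) (use borel_measurable_integrable[OF source_integrable[OF t]] in auto)
  then have "(L2_norm (u 0))\<^sup>2 + 1/2 * (L2_norm (v 0))\<^sup>2 = 0"
    using source_term_integral[OF u_L2[OF t] v_L2[OF t]] by simp
  moreover have "0 \<le> (L2_norm (u 0))\<^sup>2" "0 \<le> (L2_norm (v 0))\<^sup>2"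
    by simp_all
  ultimately have "energy 0 = 0"
    unfolding energy_def by linarith
  then show ?thesis
    by (rule energy_eq_0D[OF t])
qed

end

theorem theorem1p12:
  fixes T \<alpha> t1 :: real and u :: "real \<Rightarrow> real \<Rightarrow> real" and u0 :: "real \<Rightarrow> real"
  assumes "T > 0"
    and "u \<in> Z_space T"
    and "CH_solution T u"
    and "u0 = u 0"
    and "u0 \<in> H1 \<inter> W1inf"
    and "1/2 < \<alpha>" and "\<alpha> < 1"
    and "(\<lambda>x. \<bar>u0 x\<bar>) \<in> o[at_top](\<lambda>x. exp (- x))"
    and "(\<lambda>x. \<bar>weak_deriv u0 x\<bar>) \<in> O[ae_at_top](\<lambda>x. exp (- \<alpha> * x))"
    and "0 < t1" and "t1 \<le> T"
    and "(\<lambda>x. \<bar>u t1 x\<bar>) \<in> o[at_top](\<lambda>x. exp (- x))"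
  shows "\<forall>t\<in>{-T..T}. \<forall>x. u t x = 0"
proof -
  obtain M where "camassa_holm_flow T M u (\<lambda>t. weak_deriv (u t)) (time_deriv u)"
    using camassa_holm_flow_exists[OF assms(1-3)] by blast
  then interpret camassa_holm_flow T M u "\<lambda>t. weak_deriv (u t)" "time_deriv u" .
  have "pressure 0 0 = 0"
    by (rule pressure_0_eq_0[OF assms(10,11)]) (use assms(4,8,12) in simp_all)
  then have "u 0 x = 0" for x
    by (rule initially_zero)
  then show ?thesis
    using zero_if_zero_initially by blast
qed

end
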